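(* Let $X$ be a compact metric space, and let a discrete group $\Gamma$ act on $X$ (by homeomorphisms) in a Lyapunov stable way. Then the Hilbert $C_\Gamma(X)$-module $L_\Gamma(X)$ is $C^*$-reflexive.
   Context: $C_\Gamma(X)\subset C(X)$ is the $C^*$-subalgebra of $\Gamma$-invariant continuous complex-valued functions on $X$. The action of $\Gamma$ on the metric space $(X,\rho)$ is Lyapunov stable if for every $\varepsilon>0$ and every $x\in X$ there is $\delta>0$ such that $\rho(x,y)<\delta$ implies $\rho(gx,gy)<\varepsilon$ for all $g\in\Gamma$. For $\varphi\in C(X)$, $x\in X$ put $\varphi_x(g)=\varphi(gx)$, $g\in\Gamma$. A bounded function $f:\Gamma\to\mathbb{C}$ is almost periodic if the set of its translates $\{h\mapsto f(hg): g\in\Gamma\}$ is totally bounded in the uniform norm; $M$ is the unique invariant mean (positive, normalized, translation-invariant linear functional) on almost periodic functions on $\Gamma$. For a Lyapunov stable action all $\varphi_x$ are almost periodic, $x\mapsto M(\varphi_x)$ is continuous and $\Gamma$-invariant, and $$\langle\varphi,\psi\rangle(x)=M(\varphi_x\overline{\psi_x})$$ makes $C(X)$ a pre-Hilbert $C^*$-module over $C_\Gamma(X)$. Its completion with respect to the norm $\|\varphi\|_L=\|\langle\varphi,\varphi\rangle\|^{1/2}$ is the Hilbert $C_\Gamma(X)$-module $L_\Gamma(X)$. For a Hilbert $C^*$-module $L$ over a $C^*$-algebra $A$, the dual module $L'$ is the module of all bounded $A$-linear maps $L\to A$, and $L''=(L')'$; $L$ is $C^*$-reflexive if $L=L''$,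 i.e. the canonical map $L\to L''$ (evaluation, $x\mapsto(f\mapsto f(x)^* )$, where $L'$ has the module structure $(f\cdot a)(x)=a^*f(x)$) is onto. *)

theory Defs
  imports "HOL-Analysis.Analysis" "HOL-Algebra.Group_Action" "HOL-Algebra.Ring"
begin

section \<open>Almost periodic functions and the invariant mean\<close>

definition almost_periodic :: "('g, 'b) monoid_scheme \<Rightarrow> ('g \<Rightarrow> complex) \<Rightarrow> bool" where
  "almost_periodic G f \<longleftrightarrow>
     bounded (f ` carrier G) \<and>
     Metric_space.mtotally_bounded
       (mspace (funspace (carrier G) euclidean_metric))
       (mdist (funspace (carrier G) euclidean_metric))
       ((\<lambda>g. \<lambda>h\<in>carrier G. f (h \<otimes>\<^bsub>G\<^esub> g)) ` carrier G)"

text \<open>Only the values on \<open>carrier G\<close> matter: linearity and positivity force \<open>m f = m f'\<close> whenever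
  \<open>f\<close> and \<open>f'\<close> agree there.\<close>

definition invariant_mean :: "('g, 'b) monoid_scheme \<Rightarrow> (('g \<Rightarrow> complex) \<Rightarrow> complex) \<Rightarrow> bool" where
  "invariant_mean G m \<longleftrightarrow>
     (\<forall>f f'. almost_periodic G f \<longrightarrow> almost_periodic G f' \<longrightarrow> m (\<lambda>h. f h + f' h) = m f + m f') \<and>
     (\<forall>c f. almost_periodic G f \<longrightarrow> m (\<lambda>h. c * f h) = c * m f) \<and>
     (\<forall>f. almost_periodic G f \<longrightarrow> (\<forall>h\<in>carrier G. f h \<in> \<real>\<^sub>\<ge>\<^sub>0) \<longrightarrow> m f \<in> \<real>\<^sub>\<ge>\<^sub>0) \<and>
     m (\<lambda>h. 1) = 1 \<and>
     (\<forall>f. \<forall>g\<in>carrier G. almost_periodic G f \<longrightarrow> m (\<lambda>h. f (h \<otimes>\<^bsub>G\<^esub> g)) = m f)"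

text \<open>The value at \<open>f\<close> of the unique invariant mean; meaningful for almost periodic \<open>f\<close>.\<close>

definition ap_mean :: "('g, 'b) monoid_scheme \<Rightarrow> ('g \<Rightarrow> complex) \<Rightarrow> complex" where
  "ap_mean G f = (THE c. \<exists>m. invariant_mean G m \<and> m f = c)"


section \<open>Modules over a \<open>C\<^sup>*\<close>-algebra and \<open>C\<^sup>*\<close>-reflexivity\<close>

text \<open>The records below carry the operations only. Modules are right modules: \<open>mact x a\<close> is \<open>x a\<close>.\<close>

record 'a cstar_algebra = "'a ring" +
  ascale :: "complex \<Rightarrow> 'a \<Rightarrow> 'a"
  astar :: "'a \<Rightarrow> 'a"
  anorm :: "'a \<Rightarrow> real"

record ('a, 'm) cmodule = "'m partial_object" +
  madd :: "'m \<Rightarrow> 'm \<Rightarrow> 'm"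
  mscale :: "complex \<Rightarrow> 'm \<Rightarrow> 'm"
  mact :: "'m \<Rightarrow> 'a \<Rightarrow> 'm"

record ('a, 'm) normed_cmodule = "('a, 'm) cmodule" +
  mnorm :: "'m \<Rightarrow> real"

record ('a, 'm) hilbert_cmodule = "('a, 'm) cmodule" +
  minner :: "'m \<Rightarrow> 'm \<Rightarrow> 'a"

definition mdiff :: "('a, 'm, 'z) cmodule_scheme \<Rightarrow> 'm \<Rightarrow> 'm \<Rightarrow> 'm" where
  "mdiff L x y = madd L x (mscale L (-1) y)"

definition hilbert_norm :: "'a cstar_algebra \<Rightarrow> ('a, 'm) hilbert_cmodule \<Rightarrow> 'm \<Rightarrow> real" where
  "hilbert_norm A L x = sqrt (anorm A (minner L x x))"

definition underlying_normed :: "'a cstar_algebra \<Rightarrow> ('a, 'm) hilbert_cmodule \<Rightarrow> ('a, 'm) normed_cmodule" where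
  "underlying_normed A L =
     \<lparr>carrier = carrier L, madd = madd L, mscale = mscale L, mact = mact L, mnorm = hilbert_norm A L\<rparr>"

text \<open>The dual module. As the action is \<open>(f a)(x) = a\<^sup>* f(x)\<close>, complex scalars act by their
  conjugates. Functionals are extensional, so that they are determined by their values on
  \<open>carrier N\<close>.\<close>

definition dual_module ::
  "'a cstar_algebra \<Rightarrow> ('a, 'm) normed_cmodule \<Rightarrow> ('a, 'm \<Rightarrow> 'a) normed_cmodule" where
  "dual_module A N =
     \<lparr>carrier = {f \<in> carrier N \<rightarrow>\<^sub>E carrier A.
        (\<forall>x\<in>carrier N. \<forall>y\<in>carrier N. f (madd N x y) = f x \<oplus>\<^bsub>A\<^esub> f y) \<and>
        (\<forall>c. \<forall>x\<in>carrier N. f (mscale N c x) = ascale A c (f x)) \<and>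
        (\<forall>x\<in>carrier N. \<forall>a\<in>carrier A. f (mact N x a) = f x \<otimes>\<^bsub>A\<^esub> a) \<and>
        (\<exists>C. \<forall>x\<in>carrier N. anorm A (f x) \<le> C * mnorm N x)},
      madd = (\<lambda>f f'. \<lambda>x\<in>carrier N. f x \<oplus>\<^bsub>A\<^esub> f' x),
      mscale = (\<lambda>c f. \<lambda>x\<in>carrier N. ascale A (cnj c) (f x)),
      mact = (\<lambda>f a. \<lambda>x\<in>carrier N. astar A a \<otimes>\<^bsub>A\<^esub> f x),
      mnorm = (\<lambda>f. SUP x\<in>{x \<in> carrier N. mnorm N x \<le> 1}. anorm A (f x))\<rparr>"

definition bidual_map :: "'a cstar_algebra \<Rightarrow> ('a, 'm) normed_cmodule \<Rightarrow> 'm \<Rightarrow> ('m \<Rightarrow> 'a) \<Rightarrow> 'a" where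
  "bidual_map A N x = (\<lambda>f\<in>carrier (dual_module A N). astar A (f x))"

definition cstar_reflexive :: "'a cstar_algebra \<Rightarrow> ('a, 'm) hilbert_cmodule \<Rightarrow> bool" where
  "cstar_reflexive A L \<longleftrightarrow>
     (let N = underlying_normed A L in
      bidual_map A N ` carrier N = carrier (dual_module A (dual_module A N)))"


section \<open>Completion of a pre-Hilbert module\<close>

definition cauchy_seqs :: "'a cstar_algebra \<Rightarrow> ('a, 'm) hilbert_cmodule \<Rightarrow> (nat \<Rightarrow> 'm) set" where
  "cauchy_seqs A P =
     {s. (\<forall>n. s n \<in> carrier P) \<and>
         (\<forall>e>0. \<exists>N. \<forall>m\<ge>N. \<forall>n\<ge>N. hilbert_norm A P (mdiff P (s m) (s n)) < e)}"

definition null_rel :: "'a cstar_algebra \<Rightarrow> ('a, 'm) hilbert_cmodule \<Rightarrow> ((nat \<Rightarrow> 'm) \<times> (nat \<Rightarrow> 'm)) set" where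
  "null_rel A P =
     {(s, t). s \<in> cauchy_seqs A P \<and> t \<in> cauchy_seqs A P \<and>
              (\<lambda>n. hilbert_norm A P (mdiff P (s n) (t n))) \<longlonglongrightarrow> 0}"

text \<open>The inner product of two classes is the norm limit in \<open>A\<close> of the inner products of
  representatives.\<close>

definition hilbert_completion ::
  "'a cstar_algebra \<Rightarrow> ('a, 'm) hilbert_cmodule \<Rightarrow> ('a, (nat \<Rightarrow> 'm) set) hilbert_cmodule" where
  "hilbert_completion A P =
     \<lparr>carrier = cauchy_seqs A P // null_rel A P,
      madd = (\<lambda>U V. \<Union>s\<in>U. \<Union>t\<in>V. null_rel A P `` {\<lambda>n. madd P (s n) (t n)}),
      mscale = (\<lambda>c U. \<Union>s\<in>U. null_rel A P `` {\<lambda>n. mscale P c (s n)}),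
      mact = (\<lambda>U a. \<Union>s\<in>U. null_rel A P `` {\<lambda>n. mact P (s n) a}),
      minner = (\<lambda>U V. THE a. a \<in> carrier A \<and>
        (\<forall>s\<in>U. \<forall>t\<in>V. (\<lambda>n. anorm A (minner P (s n) (t n) \<ominus>\<^bsub>A\<^esub> a)) \<longlonglongrightarrow> 0))\<rparr>"


section \<open>Group actions on a compact metric space\<close>

definition lyapunov_stable :: "('g, 'b) monoid_scheme \<Rightarrow> ('g \<Rightarrow> 'x::metric_space \<Rightarrow> 'x) \<Rightarrow> bool" where
  "lyapunov_stable G \<alpha> \<longleftrightarrow>
     (\<forall>\<epsilon>>0. \<forall>x. \<exists>\<delta>>0. \<forall>y. dist x y < \<delta> \<longrightarrow> (\<forall>g\<in>carrier G. dist (\<alpha> g x) (\<alpha> g y) < \<epsilon>))"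

definition invariant_algebra ::
  "('g, 'b) monoid_scheme \<Rightarrow> ('g \<Rightarrow> 'x::metric_space \<Rightarrow> 'x) \<Rightarrow> ('x \<Rightarrow> complex) cstar_algebra" where
  "invariant_algebra G \<alpha> =
     \<lparr>carrier = {a. continuous_on UNIV a \<and> (\<forall>g\<in>carrier G. \<forall>x. a (\<alpha> g x) = a x)},
      mult = (\<lambda>a b x. a x * b x),
      one = (\<lambda>x. 1),
      zero = (\<lambda>x. 0),
      add = (\<lambda>a b x. a x + b x),
      ascale = (\<lambda>c a x. c * a x),
      astar = (\<lambda>a x. cnj (a x)),
      anorm = (\<lambda>a. SUP x. cmod (a x))\<rparr>"

definition function_module ::
  "('g, 'b) monoid_scheme \<Rightarrow> ('g \<Rightarrow> 'x::metric_space \<Rightarrow> 'x) \<Rightarrow> ('x \<Rightarrow> complex, 'x \<Rightarrow> complex) hilbert_cmodule" where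
  "function_module G \<alpha> =
     \<lparr>carrier = {\<phi>. continuous_on UNIV \<phi>},
      madd = (\<lambda>\<phi> \<psi> x. \<phi> x + \<psi> x),
      mscale = (\<lambda>c \<phi> x. c * \<phi> x),
      mact = (\<lambda>\<phi> a x. \<phi> x * a x),
      minner = (\<lambda>\<phi> \<psi> x. ap_mean G (\<lambda>g. \<phi> (\<alpha> g x) * cnj (\<psi> (\<alpha> g x))))\<rparr>"

definition L_module ::
  "('g, 'b) monoid_scheme \<Rightarrow> ('g \<Rightarrow> 'x::metric_space \<Rightarrow> 'x) \<Rightarrow>
   ('x \<Rightarrow> complex, (nat \<Rightarrow> 'x \<Rightarrow> complex) set) hilbert_cmodule" where
  "L_module G \<alpha> = hilbert_completion (invariant_algebra G \<alpha>) (function_module G \<alpha>)"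

end

theory Submission
  imports Defs
begin

text \<open>
  An element \<open>F\<close> of the bidual is local in a strong sense: if a functional \<open>f\<close> in the dual vanishes
  at a point \<open>x\<^sub>0\<close>, then so does \<open>F f\<close>. Since \<open>X\<close> is metric, an invariant function \<open>d\<close> has the orbit
  closure of \<open>x\<^sub>0\<close> as its zero set; for \<open>h\<close> oscillating near \<open>0\<close> the product \<open>h(d) f\<close> is again a bounded
  functional, \<open>F(h(d) f) = h(d) F(f)\<close> away from \<open>x\<^sub>0\<close>, and continuity of both sides forces the limit of
  \<open>F f\<close> at \<open>x\<^sub>0\<close> to be \<open>0\<close>. Hence \<open>F f x\<^sub>0\<close> depends only on the fibre of \<open>f\<close> at \<open>x\<^sub>0\<close>, where \<open>f\<close> agrees with
  an inner product, and \<open>F\<close> is at each point evaluation at some vector \<open>v\<^sub>x\<close>. The functional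
  \<open>u y = F \<langle>\<cdot>, y\<rangle>\<close> lies in the dual and \<open>F u\<close> has the value \<open>\<parallel>v\<^sub>x\<parallel>\<^sup>2\<close>, so these norms are continuous in \<open>x\<close>.
  The distance from \<open>v\<^sub>x\<close> to a fixed \<open>\<phi> \<in> C(X)\<close> is therefore continuous, and an invariant partition of
  unity produces functions approximating all the \<open>v\<^sub>x\<close> uniformly.

  The invariant mean of an almost periodic \<open>f\<close> is the constant approximated uniformly by averages of
  right translates. It exists because averaging over a finite net of left translates lowers the
  supremum of a non-constant function, and it is unique because left and right averages commute.
\<close>

section \<open>Almost periodic functions on a group\<close>

text \<open>The module need not be self-dual. For the reflection of [-1,1], the functional sending
  \<phi> to the function h(|t|) (\<phi>(|t|) - \<phi>(-|t|)), with value 0 at t = 0, is bounded for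
  every bounded h continuous off 0, yet it is an inner product only if h tends to 0 at 0. So the
  vectors that represent a functional fibre by fibre need not vary continuously, and a pointwise
  Riesz argument on \<open>L\<close> alone cannot produce an element of \<open>L\<close>. In the
  bidual this surplus becomes a constraint: the multipliers that enlarge the dual are the ones with
  which \<open>F\<close> has to be compatible. Where the gauge has no small positive values there is
  nowhere to oscillate, and a continuous invariant indicator function takes over. All estimates are
  made with the seminorm \<open>fnorm x\<close> of the fibre over a point; linearity over the
  invariant functions, together with invariant cutoffs, links them to norm estimates.\<close>

context group
begin

section \<open>Finite nets of translates and finite covers of the group\<close>

lemma almost_periodicD:
  assumes "almost_periodic G f"
  shows "bounded (f ` carrier G)"
    and "\<And>e. e > 0 \<Longrightarrow> \<exists>K. finite K \<and> K \<subseteq> carrier G \<and>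
      (\<forall>g\<in>carrier G. \<exists>k\<in>K. \<forall>h\<in>carrier G. cmod (f (h \<otimes> g) - f (h \<otimes> k)) < e)"
proof -
  show bd: "bounded (f ` carrier G)"
    using assms by (simp add: almost_periodic_def)
  fix e :: real assume e: "e > 0"
  let ?F = "funspace (carrier G) (euclidean_metric :: complex metric)"
  let ?T = "\<lambda>g. \<lambda>h\<in>carrier G. f (h \<otimes> g)"
  interpret F: Metric_space "mspace ?F" "mdist ?F" by (rule Metric_space_mspace_mdist)
  have "F.mtotally_bounded (?T ` carrier G)"
    using assms unfolding almost_periodic_def by blast
  then have "\<exists>K'. finite K' \<and> K' \<subseteq> ?T ` carrier G \<and> ?T ` carrier G \<subseteq> (\<Union>x\<in>K'. F.mball x e)"
    using e unfolding F.mtotally_bounded_def by (elim allE impE)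
  then obtain K' where K': "finite K'" "K' \<subseteq> ?T ` carrier G"
      "?T ` carrier G \<subseteq> (\<Union>x\<in>K'. F.mball x e)"
    by (elim exE conjE)
  then obtain K where K: "finite K" "K \<subseteq> carrier G" "K' = ?T ` K"
    by (meson finite_subset_image)
  show "\<exists>K. finite K \<and> K \<subseteq> carrier G \<and>
      (\<forall>g\<in>carrier G. \<exists>k\<in>K. \<forall>h\<in>carrier G. cmod (f (h \<otimes> g) - f (h \<otimes> k)) < e)"
  proof (intro exI[of _ K] conjI ballI K)
    fix g assume g: "g \<in> carrier G"
    then obtain k where k: "k \<in> K" "?T g \<in> F.mball (?T k) e"
      using subsetD[OF K'(3) imageI[OF g]] unfolding K(3) by (elim UN_E imageE) auto
    then have mem: "?T g \<in> mspace ?F" "?T k \<in> mspace ?F" and d: "mdist ?F (?T k) (?T g) < e"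
      by (auto simp del: mspace_funspace mdist_funspace)
    have "cmod (f (h \<otimes> g) - f (h \<otimes> k)) < e" if h: "h \<in> carrier G" for h
    proof -
      have "mdist euclidean_metric (?T k h) (?T g h) \<le> mdist ?F (?T k) (?T g)"
        using h funspace_mdist_le[OF mem(2,1), of "mdist ?F (?T k) (?T g)"] by blast
      then show ?thesis using d h by (simp add: dist_norm norm_minus_commute del: mdist_funspace)
    qed
    then show "\<exists>k\<in>K. \<forall>h\<in>carrier G. cmod (f (h \<otimes> g) - f (h \<otimes> k)) < e"
      using k by blast
  qed
qed

text \<open>Pieces on which translates differ little are easier to handle than net points: they can
  be intersected and pulled back without choosing new centres. The centres that total boundedness
  asks for are picked at the end, one in each piece that meets the group.\<close>

lemma almost_periodicI:
  assumes bd: "bounded (f ` carrier G)"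
    and cover: "\<And>e. e > 0 \<Longrightarrow> \<exists>\<P>. finite \<P> \<and> carrier G \<subseteq> \<Union>\<P> \<and>
      (\<forall>B\<in>\<P>. \<forall>g\<in>B \<inter> carrier G. \<forall>g'\<in>B \<inter> carrier G. \<forall>h\<in>carrier G.
        cmod (f (h \<otimes> g) - f (h \<otimes> g')) < e)"
  shows "almost_periodic G f"
proof -
  let ?F = "funspace (carrier G) (euclidean_metric :: complex metric)"
  let ?T = "\<lambda>g. \<lambda>h\<in>carrier G. f (h \<otimes> g)"
  interpret F: Metric_space "mspace ?F" "mdist ?F" by (rule Metric_space_mspace_mdist)
  have T_mem: "?T g \<in> mspace ?F" if "g \<in> carrier G" for g
  proof -
    have "bounded (?T g ` carrier G)"
      using that by (intro bounded_subset[OF bd]) auto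
    then show ?thesis
      by (simp add: Met_TC.fspace_def)
  qed
  have "F.mtotally_bounded (?T ` carrier G)"
    unfolding F.mtotally_bounded_def
  proof (intro allI impI)
    fix e :: real assume "e > 0"
    \<comment> \<open>Distance in the function space is a supremum, so strict pointwise bounds only
      give \<le>; halving restores the open ball.\<close>
    then have "e / 2 > 0" by simp
    from cover[OF this] obtain \<P> where P: "finite \<P>" "carrier G \<subseteq> \<Union>\<P>"
      "\<And>B g g' h. \<lbrakk>B \<in> \<P>; g \<in> B; g \<in> carrier G; g' \<in> B; g' \<in> carrier G; h \<in> carrier G\<rbrakk> \<Longrightarrow>
        cmod (f (h \<otimes> g) - f (h \<otimes> g')) < e / 2"
      by (fastforce simp: Ball_def)
    define r where "r B = (SOME g. g \<in> B \<inter> carrier G)" for B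
    have r: "r B \<in> B \<and> r B \<in> carrier G" if "g \<in> B" "g \<in> carrier G" for g B
      using someI[of "\<lambda>g. g \<in> B \<inter> carrier G" g] that by (auto simp: r_def)
    let ?K = "r ` {B \<in> \<P>. B \<inter> carrier G \<noteq> {}}"
    show "\<exists>K. finite K \<and> K \<subseteq> ?T ` carrier G \<and> ?T ` carrier G \<subseteq> (\<Union>x\<in>K. F.mball x e)"
    proof (intro exI[of _ "?T ` ?K"] conjI)
      show "finite (?T ` ?K)" using P(1) by simp
      show "?T ` ?K \<subseteq> ?T ` carrier G" using r by blast
      show "?T ` carrier G \<subseteq> (\<Union>x\<in>?T ` ?K. F.mball x e)"
      proof
        fix t assume "t \<in> ?T ` carrier G"
        then obtain g where g: "g \<in> carrier G" "t = ?T g" by blast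
        then obtain B where B: "B \<in> \<P>" "g \<in> B" using P(2) by blast
        have rB: "r B \<in> B" "r B \<in> carrier G" using r g(1) B(2) by auto
        have "mdist ?F (?T (r B)) (?T g) \<le> e / 2"
          using T_mem[OF rB(2)] T_mem[OF g(1)] \<open>e > 0\<close> P(3)[OF B(1) rB B(2) g(1)]
          by (subst funspace_mdist_le)
             (auto simp: dist_norm less_imp_le simp del: mspace_funspace mdist_funspace)
        then have "t \<in> F.mball (?T (r B)) e"
          using T_mem[OF rB(2)] T_mem[OF g(1)] \<open>e > 0\<close> g(2)
          by (simp del: mspace_funspace mdist_funspace)
        then show "t \<in> (\<Union>x\<in>?T ` ?K. F.mball x e)"
          using B g rB by blast
      qed
    qed
  qed
  then show ?thesis
    using bd by (simp add: almost_periodic_def)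
qed

lemma almost_periodic_cover:
  assumes "almost_periodic G f" "e > 0"
  shows "\<exists>\<P>. finite \<P> \<and> carrier G \<subseteq> \<Union>\<P> \<and>
      (\<forall>B\<in>\<P>. \<forall>g\<in>B \<inter> carrier G. \<forall>g'\<in>B \<inter> carrier G. \<forall>h\<in>carrier G.
        cmod (f (h \<otimes> g) - f (h \<otimes> g')) < e)"
proof -
  have "e / 2 > 0" using assms by simp
  from almost_periodicD(2)[OF assms(1) this] obtain K where K: "finite K"
    "\<And>g. g \<in> carrier G \<Longrightarrow> \<exists>k\<in>K. \<forall>h\<in>carrier G. cmod (f (h \<otimes> g) - f (h \<otimes> k)) < e / 2" by blast
  let ?B = "\<lambda>k. {g. \<forall>h\<in>carrier G. cmod (f (h \<otimes> g) - f (h \<otimes> k)) < e / 2}"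
  show ?thesis
  proof (intro exI[of _ "?B ` K"] conjI)
    show "carrier G \<subseteq> \<Union> (?B ` K)" using K(2) by blast
    show "\<forall>B\<in>?B ` K. \<forall>g\<in>B \<inter> carrier G. \<forall>g'\<in>B \<inter> carrier G. \<forall>h\<in>carrier G.
        cmod (f (h \<otimes> g) - f (h \<otimes> g')) < e"
    proof clarify
      fix k g g' h assume c: "h \<in> carrier G" "\<forall>h\<in>carrier G. cmod (f (h \<otimes> g) - f (h \<otimes> k)) < e / 2"
        "\<forall>h\<in>carrier G. cmod (f (h \<otimes> g') - f (h \<otimes> k)) < e / 2"
      then show "cmod (f (h \<otimes> g) - f (h \<otimes> g')) < e"
        by (blast intro: norm_triangle_half_l)
    qed
  qed (use K in simp)
qed

text \<open>Boundedness and small oscillation only involve differences of values, so control of the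
  differences of \<open>F\<close> by those of \<open>f1\<close> and \<open>f2\<close> suffices:
  compare with the value at \<one>, and intersect the two covers. Sums, multiples, real and
  imaginary parts all fall under this criterion.\<close>

lemma almost_periodic_combine:
  assumes f1: "almost_periodic G f1" and f2: "almost_periodic G f2"
    and F: "\<And>g g'. g \<in> carrier G \<Longrightarrow> g' \<in> carrier G \<Longrightarrow>
      cmod (F g - F g') \<le> C * cmod (f1 g - f1 g') + C * cmod (f2 g - f2 g')"
  shows "almost_periodic G F"
proof (rule almost_periodicI)
  obtain b1 b2 where b: "\<And>g. g \<in> carrier G \<Longrightarrow> cmod (f1 g) \<le> b1" "\<And>g. g \<in> carrier G \<Longrightarrow> cmod (f2 g) \<le> b2"
    using almost_periodicD(1)[OF f1] almost_periodicD(1)[OF f2] by (auto simp: bounded_iff)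
  have d: "cmod (f1 g - f1 \<one>) \<le> 2 * b1" "cmod (f2 g - f2 \<one>) \<le> 2 * b2" if "g \<in> carrier G" for g
    using b[OF that] b[OF one_closed] norm_triangle_ineq4[of "f1 g" "f1 \<one>"]
      norm_triangle_ineq4[of "f2 g" "f2 \<one>"] by auto
  have "cmod (F g) \<le> cmod (F \<one>) + (\<bar>C\<bar> * (2 * b1) + \<bar>C\<bar> * (2 * b2))" if "g \<in> carrier G" for g
  proof -
    have "C * cmod (f1 g - f1 \<one>) \<le> \<bar>C\<bar> * (2 * b1)" "C * cmod (f2 g - f2 \<one>) \<le> \<bar>C\<bar> * (2 * b2)"
      using d[OF that] by (intro mult_mono; simp)+
    then show ?thesis
      using F[OF that one_closed] norm_triangle_ineq2[of "F g" "F \<one>"] by linarith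
  qed
  then show "bounded (F ` carrier G)" by (auto simp: bounded_iff)
  fix e :: real assume "e > 0"
  \<comment> \<open>The sign of \<open>C\<close> is free, hence the absolute value; the added 1
    covers \<open>C = 0\<close> and makes the final inequality strict.\<close>
  define d where "d = e / (2 * (\<bar>C\<bar> + 1))"
  have "d > 0" using \<open>e > 0\<close> by (simp add: d_def)
  obtain \<P> where P: "finite \<P>" "carrier G \<subseteq> \<Union>\<P>"
      "\<forall>B\<in>\<P>. \<forall>g\<in>B \<inter> carrier G. \<forall>g'\<in>B \<inter> carrier G. \<forall>h\<in>carrier G.
        cmod (f1 (h \<otimes> g) - f1 (h \<otimes> g')) < d"
    using almost_periodic_cover[OF f1 \<open>d > 0\<close>] by blast
  obtain \<Q> where Q: "finite \<Q>" "carrier G \<subseteq> \<Union>\<Q>"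
      "\<forall>B\<in>\<Q>. \<forall>g\<in>B \<inter> carrier G. \<forall>g'\<in>B \<inter> carrier G. \<forall>h\<in>carrier G.
        cmod (f2 (h \<otimes> g) - f2 (h \<otimes> g')) < d"
    using almost_periodic_cover[OF f2 \<open>d > 0\<close>] by blast
  let ?R = "(\<lambda>(B, B'). B \<inter> B') ` (\<P> \<times> \<Q>)"
  have small: "cmod (F (h \<otimes> g) - F (h \<otimes> g')) < e"
    if "B \<in> \<P>" "B' \<in> \<Q>" "g \<in> B" "g \<in> B'" "g' \<in> B" "g' \<in> B'" and
      c: "g \<in> carrier G" "g' \<in> carrier G" "h \<in> carrier G" for B B' g g' h
  proof -
    have "cmod (f1 (h \<otimes> g) - f1 (h \<otimes> g')) < d" "cmod (f2 (h \<otimes> g) - f2 (h \<otimes> g')) < d"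
      using that P(3) Q(3) by auto
    then have "C * cmod (f1 (h \<otimes> g) - f1 (h \<otimes> g')) \<le> \<bar>C\<bar> * d"
      "C * cmod (f2 (h \<otimes> g) - f2 (h \<otimes> g')) \<le> \<bar>C\<bar> * d"
      by (intro mult_mono; simp)+
    moreover have "2 * (\<bar>C\<bar> * d) < e"
      using \<open>e > 0\<close> by (simp add: d_def field_simps)
    ultimately show ?thesis
      using F[of "h \<otimes> g" "h \<otimes> g'"] c by (simp add: m_closed)
  qed
  show "\<exists>\<P>. finite \<P> \<and> carrier G \<subseteq> \<Union>\<P> \<and>
      (\<forall>B\<in>\<P>. \<forall>g\<in>B \<inter> carrier G. \<forall>g'\<in>B \<inter> carrier G. \<forall>h\<in>carrier G.
        cmod (F (h \<otimes> g) - F (h \<otimes> g')) < e)"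
  proof (intro exI[of _ ?R] conjI)
    show "carrier G \<subseteq> \<Union> ?R" using P(2) Q(2) by fastforce
    show "\<forall>B\<in>?R. \<forall>g\<in>B \<inter> carrier G. \<forall>g'\<in>B \<inter> carrier G. \<forall>h\<in>carrier G.
        cmod (F (h \<otimes> g) - F (h \<otimes> g')) < e"
      using small by auto
  qed (use P Q in simp)
qed

section \<open>Closure properties of almost periodic functions\<close>

lemma almost_periodic_lipschitz:
  assumes "almost_periodic G f"
    and "\<And>g g'. g \<in> carrier G \<Longrightarrow> g' \<in> carrier G \<Longrightarrow> cmod (F g - F g') \<le> C * cmod (f g - f g')"
  shows "almost_periodic G F"
  using assms by (intro almost_periodic_combine[of f f F "C / 2"]) auto

lemma almost_periodic_add:
  assumes "almost_periodic G f1" "almost_periodic G f2"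
  shows "almost_periodic G (\<lambda>h. f1 h + f2 h)"
  using norm_triangle_ineq
  by (intro almost_periodic_combine[OF assms, of _ 1]) (simp add: add_diff_add)

lemma almost_periodic_scale:
  "almost_periodic G f \<Longrightarrow> almost_periodic G (\<lambda>h. c * f h)"
  by (rule almost_periodic_lipschitz[where C = "cmod c"])
     (auto simp: norm_mult simp flip: right_diff_distrib)

lemma almost_periodic_Re:
  "almost_periodic G f \<Longrightarrow> almost_periodic G (\<lambda>h. complex_of_real (Re (f h)))"
  by (rule almost_periodic_lipschitz[where C = 1])
     (auto simp: abs_Re_le_cmod simp flip: of_real_diff minus_complex.simps(1))

lemma almost_periodic_Im:
  "almost_periodic G f \<Longrightarrow> almost_periodic G (\<lambda>h. complex_of_real (Im (f h)))"
  by (rule almost_periodic_lipschitz[where C = 1])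
     (auto simp: abs_Im_le_cmod simp flip: of_real_diff minus_complex.simps(2))

lemma almost_periodic_const: "almost_periodic G (\<lambda>h. c)"
  by (rule almost_periodicI) (auto intro!: exI[of _ "{UNIV}"] boundedI[where B = "cmod c"])

lemma almost_periodic_translate:
  assumes f: "almost_periodic G f" and k: "k \<in> carrier G"
  shows "almost_periodic G (\<lambda>h. f (h \<otimes> k))"
proof (rule almost_periodicI)
  show "bounded ((\<lambda>h. f (h \<otimes> k)) ` carrier G)"
    using k by (intro bounded_subset[OF almost_periodicD(1)[OF f]]) auto
  fix e :: real assume "e > 0"
  obtain \<P> where P: "finite \<P>" "carrier G \<subseteq> \<Union>\<P>"
      "\<forall>B\<in>\<P>. \<forall>g\<in>B \<inter> carrier G. \<forall>g'\<in>B \<inter> carrier G. \<forall>h\<in>carrier G.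
        cmod (f (h \<otimes> g) - f (h \<otimes> g')) < e"
    using almost_periodic_cover[OF f \<open>e > 0\<close>] by blast
  show "\<exists>\<P>. finite \<P> \<and> carrier G \<subseteq> \<Union>\<P> \<and>
      (\<forall>B\<in>\<P>. \<forall>g\<in>B \<inter> carrier G. \<forall>g'\<in>B \<inter> carrier G. \<forall>h\<in>carrier G.
        cmod (f (h \<otimes> g \<otimes> k) - f (h \<otimes> g' \<otimes> k)) < e)"
  proof (intro exI[of _ "(\<lambda>B. {g. g \<otimes> k \<in> B}) ` \<P>"] conjI)
    show "carrier G \<subseteq> \<Union> ((\<lambda>B. {g. g \<otimes> k \<in> B}) ` \<P>)"
    proof
      fix g assume "g \<in> carrier G"
      then have "g \<otimes> k \<in> \<Union>\<P>" using P(2) k by blast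
      then show "g \<in> \<Union> ((\<lambda>B. {g. g \<otimes> k \<in> B}) ` \<P>)" by blast
    qed
  qed (use P k in \<open>auto simp: m_assoc\<close>)
qed

text \<open>Total boundedness passes from one side to the other. With a finite net \<open>R\<close>
  for the translates by g, the function \<open>f (h \<otimes> _)\<close> is known up to a fixed
  error once the finitely many values \<open>f (h \<otimes> r)\<close>, r in \<open>R\<close>, are
  known; these vectors lie in a bounded set of a finite-dimensional space, so finitely many h
  represent all of them.\<close>

lemma almost_periodic_left_net:
  assumes f: "almost_periodic G f" and e: "e > 0"
  shows "\<exists>K. finite K \<and> K \<subseteq> carrier G \<and>
    (\<forall>h\<in>carrier G. \<exists>k\<in>K. \<forall>g\<in>carrier G. cmod (f (h \<otimes> g) - f (k \<otimes> g)) \<le> e)"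
proof -
  have e3: "e / 3 > 0" using e by simp
  obtain R where R: "finite R" "R \<subseteq> carrier G"
      "\<And>g. g \<in> carrier G \<Longrightarrow> \<exists>k\<in>R. \<forall>h\<in>carrier G. cmod (f (h \<otimes> g) - f (h \<otimes> k)) < e / 3"
    using almost_periodicD(2)[OF f e3] by blast
  obtain b where b: "\<And>g. g \<in> carrier G \<Longrightarrow> cmod (f g) \<le> b"
    using almost_periodicD(1)[OF f] by (auto simp: bounded_iff)
  have fin: "\<exists>K. finite K \<and> K \<subseteq> carrier G \<and>
    (\<forall>h\<in>carrier G. \<exists>k\<in>K. \<forall>r\<in>R. cmod (f (h \<otimes> r) - f (k \<otimes> r)) < e / 3)"
  proof -
    have "\<exists>\<P>. finite \<P> \<and> carrier G \<subseteq> \<Union>\<P> \<and>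
      (\<forall>B\<in>\<P>. \<forall>h\<in>B. \<forall>h'\<in>B. \<forall>r\<in>R. cmod (f (h \<otimes> r) - f (h' \<otimes> r)) < e / 3)"
      using R(1,2)
    proof (induction R rule: finite_induct)
      case empty
      show ?case by (rule exI[of _ "{UNIV}"]) auto
    next
      case (insert r R)
      then obtain \<P> where P: "finite \<P>" "carrier G \<subseteq> \<Union>\<P>"
        "\<forall>B\<in>\<P>. \<forall>h\<in>B. \<forall>h'\<in>B. \<forall>r\<in>R. cmod (f (h \<otimes> r) - f (h' \<otimes> r)) < e / 3" by auto
      \<comment> \<open>Each new \<open>r\<close> refines the cover according to the disc of radius
        e/6 that contains \<open>f (h \<otimes> r)\<close>; two values in one disc are less than e/3
        apart.\<close>
      have "compact (cball (0::complex) b)" by simp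
      then obtain C where C: "finite C" "cball (0::complex) b \<subseteq> (\<Union>c\<in>C. ball c (e / 6))"
      proof (rule compactE_image[of _ UNIV "\<lambda>c. ball c (e / 6)"])
        show "cball (0::complex) b \<subseteq> (\<Union>c. ball c (e / 6))"
        proof
          fix z :: complex
          have "z \<in> ball z (e / 6)" using e by simp
          then show "z \<in> (\<Union>c. ball c (e / 6))" by blast
        qed
      qed auto
      let ?S = "\<lambda>(B, c). {h \<in> B. f (h \<otimes> r) \<in> ball c (e / 6)}"
      show ?case
      proof (intro exI[of _ "?S ` (\<P> \<times> C)"] conjI)
        show "finite (?S ` (\<P> \<times> C))" using P C by simp
        show "carrier G \<subseteq> \<Union> (?S ` (\<P> \<times> C))"
        proof
          fix h assume h: "h \<in> carrier G"
          obtain B where "B \<in> \<P>" "h \<in> B" using h P by blast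
          moreover have "f (h \<otimes> r) \<in> cball 0 b" using b h insert by simp
          then obtain c where "c \<in> C" "f (h \<otimes> r) \<in> ball c (e / 6)" using C by blast
          ultimately show "h \<in> \<Union> (?S ` (\<P> \<times> C))" by blast
        qed
        have "cmod (f (h \<otimes> r) - f (h' \<otimes> r)) < e / 3"
          if "f (h \<otimes> r) \<in> ball c (e / 6)" "f (h' \<otimes> r) \<in> ball c (e / 6)" for h h' c
          using that dist_triangle_half_r[of c "f (h \<otimes> r)" "e / 3" "f (h' \<otimes> r)"]
          by (simp add: dist_norm)
        then show "\<forall>B\<in>?S ` (\<P> \<times> C). \<forall>h\<in>B. \<forall>h'\<in>B. \<forall>r\<in>insert r R.
            cmod (f (h \<otimes> r) - f (h' \<otimes> r)) < e / 3"
          using P(3) by (auto simp del: mem_ball)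
      qed
    qed
    then obtain \<P> where P: "finite \<P>" "carrier G \<subseteq> \<Union>\<P>"
        "\<forall>B\<in>\<P>. \<forall>h\<in>B. \<forall>h'\<in>B. \<forall>r\<in>R. cmod (f (h \<otimes> r) - f (h' \<otimes> r)) < e / 3"
      by (elim exE conjE)
    define s where "s B = (SOME g. g \<in> B \<inter> carrier G)" for B
    have s: "s B \<in> B \<and> s B \<in> carrier G" if "g \<in> B" "g \<in> carrier G" for g B
      using someI[of "\<lambda>g. g \<in> B \<inter> carrier G" g] that by (auto simp: s_def)
    show ?thesis
    proof (intro exI[of _ "s ` {B \<in> \<P>. B \<inter> carrier G \<noteq> {}}"] conjI ballI)
      show "s ` {B \<in> \<P>. B \<inter> carrier G \<noteq> {}} \<subseteq> carrier G" using s by blast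
      fix h assume h: "h \<in> carrier G"
      then obtain B where B: "B \<in> \<P>" "h \<in> B" using P(2) by blast
      then show "\<exists>k\<in>s ` {B \<in> \<P>. B \<inter> carrier G \<noteq> {}}. \<forall>r\<in>R. cmod (f (h \<otimes> r) - f (k \<otimes> r)) < e / 3"
        using P(3) s[OF B(2) h] h by blast
    qed (use P in simp)
  qed
  then obtain K where K: "finite K" "K \<subseteq> carrier G"
    "\<And>h. h \<in> carrier G \<Longrightarrow> \<exists>k\<in>K. \<forall>r\<in>R. cmod (f (h \<otimes> r) - f (k \<otimes> r)) < e / 3" by blast
  show ?thesis
  proof (intro exI[of _ K] conjI ballI K)
    fix h assume h: "h \<in> carrier G"
    then obtain k where k: "k \<in> K" "\<And>r. r \<in> R \<Longrightarrow> cmod (f (h \<otimes> r) - f (k \<otimes> r)) < e / 3"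
      using K(3) by blast
    have "cmod (f (h \<otimes> g) - f (k \<otimes> g)) \<le> e" if g: "g \<in> carrier G" for g
    proof -
      obtain r where r: "r \<in> R" "\<And>h. h \<in> carrier G \<Longrightarrow> cmod (f (h \<otimes> g) - f (h \<otimes> r)) < e / 3"
        using R(3)[OF g] by blast
      have kc: "k \<in> carrier G" using k K by blast
      have "f (h \<otimes> g) - f (k \<otimes> g) = (f (h \<otimes> g) - f (h \<otimes> r)) + (f (h \<otimes> r) - f (k \<otimes> r))
          - (f (k \<otimes> g) - f (k \<otimes> r))" by simp
      also have "cmod \<dots> \<le> cmod (f (h \<otimes> g) - f (h \<otimes> r)) + cmod (f (h \<otimes> r) - f (k \<otimes> r))
          + cmod (f (k \<otimes> g) - f (k \<otimes> r))"
        by (meson add_right_mono norm_triangle_ineq norm_triangle_ineq4 order_trans)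
      also have "\<dots> \<le> e" using r(2)[OF h] r(2)[OF kc] k(2)[OF r(1)] by linarith
      finally show ?thesis .
    qed
    then show "\<exists>k\<in>K. \<forall>g\<in>carrier G. cmod (f (h \<otimes> g) - f (k \<otimes> g)) \<le> e" using k(1) by blast
  qed
qed

end

section \<open>Averages and the invariant mean\<close>

context group
begin

text \<open>Lists instead of finite sets: repetitions act as weights, and composing two averages is
  then simply the average over the list of all products.\<close>

definition right_average :: "'a list \<Rightarrow> ('a \<Rightarrow> 'v) \<Rightarrow> 'a \<Rightarrow> 'v::real_normed_vector" where
  "right_average xs f h = (1 / real (length xs)) *\<^sub>R (\<Sum>g\<leftarrow>xs. f (h \<otimes> g))"

definition mean_value :: "('a \<Rightarrow> 'v::real_normed_vector) \<Rightarrow> 'v \<Rightarrow> bool" where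
  "mean_value f c \<longleftrightarrow> (\<forall>e>0. \<exists>xs. xs \<noteq> [] \<and> set xs \<subseteq> carrier G \<and>
     (\<forall>h\<in>carrier G. norm (right_average xs f h - c) \<le> e))"

text \<open>The form of almost periodicity that the existence of a mean consumes. With norms in an
  arbitrary space it survives every contraction, in particular taking real and imaginary
  parts.\<close>

definition left_net :: "('a \<Rightarrow> 'v::real_normed_vector) \<Rightarrow> bool" where
  "left_net f \<longleftrightarrow> (\<forall>e>0. \<exists>K. finite K \<and> K \<subseteq> carrier G \<and>
     (\<forall>h\<in>carrier G. \<exists>k\<in>K. \<forall>g\<in>carrier G. norm (f (h \<otimes> g) - f (k \<otimes> g)) \<le> e))"

section \<open>Arithmetic of averages\<close>

lemma right_average_diff_le:
  assumes "xs \<noteq> []" "\<And>g. g \<in> set xs \<Longrightarrow> norm (f (h \<otimes> g) - f' (k \<otimes> g)) \<le> e"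
  shows "norm (right_average xs f h - right_average xs f' k) \<le> e"
proof -
  have "norm ((\<Sum>g\<leftarrow>xs. f (h \<otimes> g)) - (\<Sum>g\<leftarrow>xs. f' (k \<otimes> g))) \<le> real (length xs) * e"
    using assms(2)
  proof (induction xs)
    case (Cons x xs)
    then have "norm ((\<Sum>g\<leftarrow>xs. f (h \<otimes> g)) - (\<Sum>g\<leftarrow>xs. f' (k \<otimes> g))) \<le> real (length xs) * e"
      "norm (f (h \<otimes> x) - f' (k \<otimes> x)) \<le> e" by auto
    then have "norm ((f (h \<otimes> x) - f' (k \<otimes> x)) + ((\<Sum>g\<leftarrow>xs. f (h \<otimes> g)) - (\<Sum>g\<leftarrow>xs. f' (k \<otimes> g))))
        \<le> e + real (length xs) * e"
      by (intro norm_triangle_mono)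
    then show ?case by (simp add: algebra_simps)
  qed simp
  then have "norm ((\<Sum>g\<leftarrow>xs. f (h \<otimes> g)) - (\<Sum>g\<leftarrow>xs. f' (k \<otimes> g))) / real (length xs) \<le> e"
    using assms(1) by (simp add: divide_le_eq mult.commute)
  then show ?thesis
    by (simp add: right_average_def flip: scaleR_diff_right)
qed

lemma right_average_const: "xs \<noteq> [] \<Longrightarrow> right_average xs (\<lambda>g. c) h = c"
proof -
  have "(\<Sum>g\<leftarrow>xs. c) = real (length xs) *\<^sub>R c"
    by (induction xs) (auto simp: algebra_simps)
  then show "xs \<noteq> [] \<Longrightarrow> ?thesis" by (simp add: right_average_def)
qed

lemma right_average_bounded_linear:
  assumes "bounded_linear T"
  shows "right_average xs (\<lambda>g. T (f g)) h = T (right_average xs f h)"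
proof -
  interpret bounded_linear T by fact
  have "(\<Sum>g\<leftarrow>xs. T (f (h \<otimes> g))) = T (\<Sum>g\<leftarrow>xs. f (h \<otimes> g))"
    by (induction xs) (auto simp: add zero)
  then show ?thesis by (simp add: right_average_def scaleR)
qed

lemma right_average_add:
  "right_average xs (\<lambda>g. f g + f' g) h = right_average xs f h + right_average xs f' h"
  by (simp add: right_average_def sum_list_addf scaleR_add_right)

lemma right_average_right_average:
  fixes f :: "'a \<Rightarrow> 'v::real_normed_vector"
  assumes h: "h \<in> carrier G" and xs: "set xs \<subseteq> carrier G" and ys: "set ys \<subseteq> carrier G"
  shows "right_average xs (right_average ys f) h
    = right_average (concat (map (\<lambda>g. map (\<lambda>k. g \<otimes> k) ys) xs)) f h"
proof -
  have 1: "(\<Sum>g\<leftarrow>xs. \<Sum>k\<leftarrow>ys. f (h \<otimes> g \<otimes> k))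
    = (\<Sum>g\<leftarrow>concat (map (\<lambda>g. map (\<lambda>k. g \<otimes> k) ys) xs). f (h \<otimes> g))"
    using xs
  proof (induction xs)
    case (Cons x xs)
    have "map (\<lambda>k. f (h \<otimes> x \<otimes> k)) ys = map (\<lambda>k. f (h \<otimes> (x \<otimes> k))) ys"
      using Cons ys h by (intro map_cong) (auto simp: m_assoc)
    then have "(\<Sum>k\<leftarrow>ys. f (h \<otimes> x \<otimes> k)) = (\<Sum>k\<leftarrow>ys. f (h \<otimes> (x \<otimes> k)))"
      by (rule arg_cong)
    then show ?case using Cons by (simp add: o_def)
  qed simp
  have 2: "length (concat (map (\<lambda>g. map (\<lambda>k. g \<otimes> k) ys) xs)) = length xs * length ys"
    by (induction xs) auto
  have 3: "(\<Sum>g\<leftarrow>xs. r *\<^sub>R F g) = r *\<^sub>R (\<Sum>g\<leftarrow>xs. F g)" for F :: "'a \<Rightarrow> 'v" and r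
    by (induction xs) (auto simp: scaleR_add_right)
  show ?thesis
    by (simp add: right_average_def 1 2 3)
qed

text \<open>An average of averages is again an average. This lets one approximating list be refined
  by a second one while the mean value stays the same.\<close>

lemma mean_value_right_average:
  assumes m: "mean_value (right_average ys f) c" and ys: "ys \<noteq> []" "set ys \<subseteq> carrier G"
  shows "mean_value f c"
  unfolding mean_value_def
proof (intro allI impI)
  fix e :: real assume "e > 0"
  then obtain xs where xs: "xs \<noteq> []" "set xs \<subseteq> carrier G"
    "\<forall>h\<in>carrier G. norm (right_average xs (right_average ys f) h - c) \<le> e"
    using m unfolding mean_value_def by meson
  let ?zs = "concat (map (\<lambda>g. map (\<lambda>k. g \<otimes> k) ys) xs)"
  show "\<exists>xs. xs \<noteq> [] \<and> set xs \<subseteq> carrier G \<and> (\<forall>h\<in>carrier G. norm (right_average xs f h - c) \<le> e)"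
  proof (intro exI[of _ ?zs] conjI)
    show "?zs \<noteq> []" using xs(1) ys(1) by (cases xs) auto
    show "set ?zs \<subseteq> carrier G" using xs ys by (auto intro!: m_closed)
    show "\<forall>h\<in>carrier G. norm (right_average ?zs f h - c) \<le> e"
      using xs ys by (simp flip: right_average_right_average)
  qed
qed

lemma mean_value_bounded_linear:
  assumes T: "bounded_linear T" "\<And>x. norm (T x) \<le> norm x" and m: "mean_value f c"
  shows "mean_value (\<lambda>g. T (f g)) (T c)"
  unfolding mean_value_def
proof (intro allI impI)
  interpret bounded_linear T by fact
  fix e :: real assume "e > 0"
  then obtain xs where xs: "xs \<noteq> []" "set xs \<subseteq> carrier G"
    "\<And>h. h \<in> carrier G \<Longrightarrow> norm (right_average xs f h - c) \<le> e"
    using m unfolding mean_value_def by meson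
  have "norm (right_average xs (\<lambda>g. T (f g)) h - T c) \<le> e" if "h \<in> carrier G" for h
    using xs(3)[OF that] T(2)[of "right_average xs f h - c"]
    by (simp add: right_average_bounded_linear[OF T(1)] diff)
  then show "\<exists>xs. xs \<noteq> [] \<and> set xs \<subseteq> carrier G \<and>
      (\<forall>h\<in>carrier G. norm (right_average xs (\<lambda>g. T (f g)) h - T c) \<le> e)"
    using xs by blast
qed

text \<open>The mean is the infimum \<open>s\<close> of the upper bounds reachable by averaging. If
  an almost optimal average still dipped below \<open>s - e\<close> at some point, a further average
  would let every group element see a share of this dip, and an upper bound below \<open>s\<close>
  would result.\<close>

lemma ex_mean_value_real:
  fixes u :: "'a \<Rightarrow> real"
  assumes net: "left_net u" and bd: "\<And>g. g \<in> carrier G \<Longrightarrow> \<bar>u g\<bar> \<le> b"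
  shows "\<exists>c. mean_value u c"
proof -
  define S where "S = {B. \<exists>xs. xs \<noteq> [] \<and> set xs \<subseteq> carrier G \<and>
      (\<forall>h\<in>carrier G. right_average xs u h \<le> B)}"
  define s where "s = Inf S"
  have avb: "\<bar>right_average xs u h\<bar> \<le> b" if "xs \<noteq> []" "set xs \<subseteq> carrier G" "h \<in> carrier G" for xs h
    using right_average_diff_le[OF that(1), of u h "\<lambda>_. 0" \<one> b] that bd
    by (auto simp: right_average_const subset_iff)
  have "\<one> \<in> carrier G" by simp
  then have lower: "-b \<le> B" if "B \<in> S" for B
    using that avb unfolding S_def by (smt (verit, best) mem_Collect_eq)
  have bdd: "bdd_below S" using lower by (rule bdd_belowI)
  have "\<forall>h\<in>carrier G. right_average [\<one>] u h \<le> b"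
    using avb[of "[\<one>]"] by fastforce
  then have "b \<in> S"
    unfolding S_def by (intro CollectI exI[of _ "[\<one>]"]) auto
  have "mean_value u s"
    unfolding mean_value_def
  proof (intro allI impI)
    fix e :: real assume e: "e > 0"
    then have e2: "e / 2 > 0" by simp
    obtain K where K: "finite K" "K \<subseteq> carrier G"
      "\<And>h. h \<in> carrier G \<Longrightarrow> \<exists>k\<in>K. \<forall>g\<in>carrier G. norm (u (h \<otimes> g) - u (k \<otimes> g)) \<le> e / 2"
      using net e2 unfolding left_net_def by meson
    have "K \<noteq> {}" using K(3)[OF one_closed] by blast
    define n where "n = card K"
    have n: "n > 0" using K \<open>K \<noteq> {}\<close> by (simp add: n_def card_gt_0_iff)
    \<comment> \<open>Balance for the further average over \<open>n\<close> terms: one term is at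
      most s - e/2, the other n - 1 at most s + d. As n d = e/2, the sum is at most n s - d, which
      beats n s.\<close>
    define d where "d = e / (2 * real n)"
    have d: "d > 0" "d \<le> e" "real n * d = e / 2"
      using n e by (auto simp: d_def field_simps)
    have "Inf S < s + d" using d by (simp add: s_def)
    then obtain B where "B \<in> S" "B < s + d"
      using \<open>b \<in> S\<close> by (metis cInf_lessD empty_iff)
    then obtain xs where xs: "xs \<noteq> []" "set xs \<subseteq> carrier G"
      and upper: "\<And>h. h \<in> carrier G \<Longrightarrow> right_average xs u h \<le> s + d"
      unfolding S_def by fastforce
    let ?v = "right_average xs u"
    have "s - e \<le> ?v h0" if h0: "h0 \<in> carrier G" for h0
    proof (rule ccontr)
      assume neg: "\<not> s - e \<le> ?v h0"
      obtain ks where ks: "set ks = K" "distinct ks"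
        using finite_distinct_list[OF K(1)] by blast
      \<comment> \<open>These translates carry each net point \<open>k\<close> to the dip, since
        \<open>k \<otimes> (inv k \<otimes> h0) = h0\<close>; a general \<open>h\<close> is close to
        some \<open>k\<close> and so meets the dip in the corresponding term.\<close>
      let ?gs = "map (\<lambda>k. inv k \<otimes> h0) ks"
      have gs: "?gs \<noteq> []" "set ?gs \<subseteq> carrier G"
        using ks \<open>K \<noteq> {}\<close> K(2) h0 by auto
      have len: "length ks = n" using ks distinct_card n_def by metis
      have low: "right_average ?gs ?v h \<le> s - d / n" if h: "h \<in> carrier G" for h
      proof -
        obtain k where k: "k \<in> K" "\<And>g. g \<in> carrier G \<Longrightarrow> norm (u (h \<otimes> g) - u (k \<otimes> g)) \<le> e / 2"
          using K(3)[OF h] by blast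
        have kG: "k \<in> carrier G" using k K by blast
        have "norm (?v (h \<otimes> (inv k \<otimes> h0)) - ?v (k \<otimes> (inv k \<otimes> h0))) \<le> e / 2"
        proof (rule right_average_diff_le[OF xs(1)])
          fix x assume "x \<in> set xs"
          then have x: "x \<in> carrier G" using xs by blast
          show "norm (u (h \<otimes> (inv k \<otimes> h0) \<otimes> x) - u (k \<otimes> (inv k \<otimes> h0) \<otimes> x)) \<le> e / 2"
            using k(2)[of "inv k \<otimes> h0 \<otimes> x"] h kG h0 x by (simp add: m_assoc)
        qed
        moreover have "k \<otimes> (inv k \<otimes> h0) = h0"
          using kG h0 by (simp flip: m_assoc)
        ultimately have vk: "?v (h \<otimes> (inv k \<otimes> h0)) \<le> s - e / 2"
          using neg unfolding real_norm_def abs_le_iff by auto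
        have "(\<Sum>x\<in>K - {k}. ?v (h \<otimes> (inv x \<otimes> h0))) \<le> of_nat (card (K - {k})) * (s + d)"
          using K(2) h h0 by (intro sum_bounded_above upper) auto
        also have "card (K - {k}) = n - 1" using k K by (simp add: n_def)
        finally have "(\<Sum>x\<in>K. ?v (h \<otimes> (inv x \<otimes> h0))) \<le> (s - e / 2) + (real n - 1) * (s + d)"
          using vk n k K(1) by (simp add: sum.remove[of K k] of_nat_diff)
        also have "\<dots> = real n * s - d" using d(3) by (simp add: algebra_simps)
        finally have "(\<Sum>x\<leftarrow>ks. ?v (h \<otimes> (inv x \<otimes> h0))) \<le> real n * s - d"
          using ks by (simp add: sum_list_distinct_conv_sum_set)
        then have "(\<Sum>x\<leftarrow>ks. ?v (h \<otimes> (inv x \<otimes> h0))) / n \<le> (real n * s - d) / n"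
          by (rule divide_right_mono) simp
        then show ?thesis
          using n by (simp add: right_average_def len o_def diff_divide_distrib)
      qed
      let ?zs = "concat (map (\<lambda>g. map (\<lambda>k. g \<otimes> k) xs) ?gs)"
      have "s - d / n \<in> S"
        unfolding S_def
      proof (intro CollectI exI[of _ ?zs] conjI ballI)
        show "?zs \<noteq> []" using xs(1) gs(1) by (cases ks) auto
        show "set ?zs \<subseteq> carrier G" using xs(2) gs(2) K(2) ks(1) h0 by (auto intro!: m_closed)
        show "right_average ?zs u h \<le> s - d / n" if "h \<in> carrier G" for h
          using low[OF that] right_average_right_average[OF that gs(2) xs(2)] by metis
      qed
      then have "s \<le> s - d / n" unfolding s_def using bdd by (intro cInf_lower)
      then show False using d n by (simp add: field_simps)
    qed
    then have "\<forall>h\<in>carrier G. norm (?v h - s) \<le> e"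
      using upper d by (fastforce simp: abs_le_iff)
    then show "\<exists>xs. xs \<noteq> [] \<and> set xs \<subseteq> carrier G \<and>
        (\<forall>h\<in>carrier G. norm (right_average xs u h - s) \<le> e)"
      using xs by blast
  qed
  then show ?thesis by blast
qed

text \<open>Averages of left translates of \<open>f\<close> are the right averages of \<open>f \<circ> inv\<close>, and left and right
  averages commute.\<close>

lemma mean_value_inverse:
  fixes f :: "'a \<Rightarrow> 'v::real_normed_vector"
  assumes c: "mean_value f c" and d: "mean_value (\<lambda>g. f (inv g)) d"
  shows "c = d"
proof -
  have "norm (c - d) \<le> e" if "e > 0" for e
  proof -
    have e2: "e / 2 > 0" using that by simp
    obtain xs where xs: "xs \<noteq> []" "set xs \<subseteq> carrier G"
      "\<And>h. h \<in> carrier G \<Longrightarrow> norm (right_average xs f h - c) \<le> e / 2"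
      using c e2 unfolding mean_value_def by meson
    obtain ys where ys: "ys \<noteq> []" "set ys \<subseteq> carrier G"
      "\<And>h. h \<in> carrier G \<Longrightarrow> norm (right_average ys (\<lambda>g. f (inv g)) h - d) \<le> e / 2"
      using d e2 unfolding mean_value_def by meson
    have inv_prod: "inv (inv x \<otimes> y) = inv y \<otimes> x" if "x \<in> carrier G" "y \<in> carrier G" for x y
      using that by (simp add: inv_mult_group)
    \<comment> \<open>The common double average. Summing over \<open>xs\<close> inside gives
      averages of \<open>f\<close> at the points \<open>inv y\<close>, all near c; summing over
      \<open>ys\<close> inside gives averages of \<open>f \<circ> inv\<close> at the points
      \<open>inv x\<close>, all near d.\<close>
    let ?W = "(1 / real (length xs * length ys)) *\<^sub>R (\<Sum>y\<leftarrow>ys. \<Sum>x\<leftarrow>xs. f (inv y \<otimes> x))"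
    have pull: "(\<Sum>g\<leftarrow>zs. r *\<^sub>R F g) = r *\<^sub>R (\<Sum>g\<leftarrow>zs. F g)" for F :: "'a \<Rightarrow> 'v" and r zs
      by (induction zs) (auto simp: scaleR_add_right)
    have swap: "(\<Sum>y\<leftarrow>ys. \<Sum>x\<leftarrow>xs. F y x) = (\<Sum>x\<leftarrow>xs. \<Sum>y\<leftarrow>ys. F y x)" for F :: "'a \<Rightarrow> 'a \<Rightarrow> 'v"
      by (induction ys) (auto simp: sum_list_addf)
    let ?f' = "\<lambda>y. right_average xs f (inv (\<one> \<otimes> y))"
    have "norm (right_average ys ?f' \<one> - right_average ys (\<lambda>_. c) \<one>) \<le> e / 2"
    proof (rule right_average_diff_le[OF ys(1)])
      fix y assume "y \<in> set ys"
      then show "norm (right_average xs f (inv (\<one> \<otimes> (\<one> \<otimes> y))) - c) \<le> e / 2"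
        using xs(3) ys(2) by auto
    qed
    moreover have "right_average ys ?f' \<one> = ?W"
    proof -
      have "map (\<lambda>y. \<Sum>x\<leftarrow>xs. f (inv (\<one> \<otimes> (\<one> \<otimes> y)) \<otimes> x)) ys = map (\<lambda>y. \<Sum>x\<leftarrow>xs. f (inv y \<otimes> x)) ys"
        using ys(2) by (intro map_cong) auto
      then have "(\<Sum>y\<leftarrow>ys. \<Sum>x\<leftarrow>xs. f (inv (\<one> \<otimes> (\<one> \<otimes> y)) \<otimes> x)) = (\<Sum>y\<leftarrow>ys. \<Sum>x\<leftarrow>xs. f (inv y \<otimes> x))"
        by (rule arg_cong)
      then show ?thesis by (simp add: right_average_def pull mult.commute)
    qed
    ultimately have 1: "norm (?W - c) \<le> e / 2" using ys(1) by (simp add: right_average_const)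
    let ?h' = "\<lambda>x. right_average ys (\<lambda>g. f (inv g)) (inv (\<one> \<otimes> x))"
    have "norm (right_average xs ?h' \<one> - right_average xs (\<lambda>_. d) \<one>) \<le> e / 2"
    proof (rule right_average_diff_le[OF xs(1)])
      fix x assume "x \<in> set xs"
      then show "norm (right_average ys (\<lambda>g. f (inv g)) (inv (\<one> \<otimes> (\<one> \<otimes> x))) - d) \<le> e / 2"
        using ys(3) xs(2) by auto
    qed
    moreover have "right_average xs ?h' \<one> = ?W"
    proof -
      have "map (\<lambda>x. \<Sum>y\<leftarrow>ys. f (inv (inv (\<one> \<otimes> (\<one> \<otimes> x)) \<otimes> y))) xs
          = map (\<lambda>x. \<Sum>y\<leftarrow>ys. f (inv y \<otimes> x)) xs"
      proof (intro map_cong refl arg_cong[of _ _ sum_list])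
        fix x y assume "x \<in> set xs" "y \<in> set ys"
        then show "f (inv (inv (\<one> \<otimes> (\<one> \<otimes> x)) \<otimes> y)) = f (inv y \<otimes> x)"
          using xs(2) ys(2) inv_prod[of x y] by (simp add: subset_iff)
      qed
      then have "(\<Sum>x\<leftarrow>xs. \<Sum>y\<leftarrow>ys. f (inv (inv (\<one> \<otimes> (\<one> \<otimes> x)) \<otimes> y))) = (\<Sum>x\<leftarrow>xs. \<Sum>y\<leftarrow>ys. f (inv y \<otimes> x))"
        by (rule arg_cong)
      then show ?thesis by (simp add: right_average_def pull swap mult.commute)
    qed
    ultimately have 2: "norm (?W - d) \<le> e / 2" using xs(1) by (simp add: right_average_const)
    have "norm (c - d) \<le> norm (?W - d) + norm (?W - c)"
      using norm_triangle_ineq4[of "?W - d" "?W - c"] by simp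
    then show ?thesis using 1 2 by linarith
  qed
  then have "norm (c - d) \<le> 0" using field_le_epsilon[of "norm (c - d)" 0] by simp
  then show ?thesis by simp
qed

section \<open>Mean values of almost periodic functions\<close>

lemma left_net_contraction:
  assumes "left_net f" "\<And>x y. norm (T x - T y) \<le> norm (x - y)"
  shows "left_net (\<lambda>g. T (f g))"
  using assms unfolding left_net_def by (meson order_trans)

text \<open>For \<open>f \<circ> inv\<close> the left net is the inverse image of the net in the
  definition: inversion exchanges the two sides.\<close>

lemma almost_periodic_left_nets:
  assumes f: "almost_periodic G f"
  shows "left_net f" "left_net (\<lambda>g. f (inv g))"
proof -
  show "left_net f"
    unfolding left_net_def using almost_periodic_left_net[OF f] by blast
  show "left_net (\<lambda>g. f (inv g))"
    unfolding left_net_def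
  proof (intro allI impI)
    fix e :: real assume "e > 0"
    then obtain K where K: "finite K" "K \<subseteq> carrier G"
      "\<And>g. g \<in> carrier G \<Longrightarrow> \<exists>k\<in>K. \<forall>h\<in>carrier G. cmod (f (h \<otimes> g) - f (h \<otimes> k)) < e"
      using almost_periodicD(2)[OF f] by meson
    show "\<exists>K. finite K \<and> K \<subseteq> carrier G \<and> (\<forall>h\<in>carrier G. \<exists>k\<in>K. \<forall>g\<in>carrier G.
        cmod (f (inv (h \<otimes> g)) - f (inv (k \<otimes> g))) \<le> e)"
    proof (intro exI[of _ "(\<lambda>k. inv k) ` K"] conjI ballI)
      fix h assume h: "h \<in> carrier G"
      then obtain k where k: "k \<in> K" "\<forall>g\<in>carrier G. cmod (f (g \<otimes> inv h) - f (g \<otimes> k)) < e"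
        using K(3)[of "inv h"] by auto
      have kG: "k \<in> carrier G" using k K by blast
      have "cmod (f (inv (h \<otimes> g)) - f (inv (inv k \<otimes> g))) \<le> e" if "g \<in> carrier G" for g
        using k(2) that h kG by (simp add: inv_mult_group less_imp_le)
      then show "\<exists>k\<in>(\<lambda>k. inv k) ` K. \<forall>g\<in>carrier G. cmod (f (inv (h \<otimes> g)) - f (inv (k \<otimes> g))) \<le> e"
        using k(1) by blast
    qed (use K in auto)
  qed
qed

lemma almost_periodic_right_average:
  assumes f: "almost_periodic G f" and xs: "set xs \<subseteq> carrier G"
  shows "almost_periodic G (right_average xs f)"
proof -
  have "almost_periodic G (\<lambda>h. \<Sum>g\<leftarrow>xs. f (h \<otimes> g))"
    using xs
  proof (induction xs)
    case (Cons x xs)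
    then show ?case
      using almost_periodic_add[OF almost_periodic_translate[OF f, of x]] by simp
  qed (simp add: almost_periodic_const)
  from almost_periodic_scale[OF this, of "of_real (1 / real (length xs))"] show ?thesis
    by (simp add: right_average_def[abs_def] scaleR_conv_of_real)
qed

text \<open>Any mean value of \<open>T \<circ> f\<close> equals any mean value of
  \<open>T \<circ> f \<circ> inv\<close>, and one of the latter exists. \<open>T\<close> stands for
  the real or the imaginary part.\<close>

lemma mean_value_real_unique:
  fixes T :: "complex \<Rightarrow> real"
  assumes f: "almost_periodic G f" and T: "bounded_linear T" "\<And>z. norm (T z) \<le> cmod z"
    and c: "mean_value (\<lambda>g. T (f g)) c" and d: "mean_value (\<lambda>g. T (f g)) d"
  shows "c = d"
proof -
  interpret bounded_linear T by fact
  obtain b where b: "\<And>g. g \<in> carrier G \<Longrightarrow> cmod (f g) \<le> b"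
    using almost_periodicD(1)[OF f] by (auto simp: bounded_iff)
  have "left_net (\<lambda>g. T (f (inv g)))"
    by (rule left_net_contraction[OF almost_periodic_left_nets(2)[OF f]]) (metis T(2) diff)
  moreover have "\<bar>T (f (inv g))\<bar> \<le> b" if "g \<in> carrier G" for g
    using T(2)[of "f (inv g)"] b[of "inv g"] that by simp
  ultimately have "\<exists>c'. mean_value (\<lambda>g. T (f (inv g))) c'"
    by (rule ex_mean_value_real)
  then obtain c' where "mean_value (\<lambda>g. T (f (inv g))) c'" by (elim exE)
  then show ?thesis
    using mean_value_inverse[OF c] mean_value_inverse[OF d] by simp
qed

lemma ex_mean_value_part:
  fixes T :: "complex \<Rightarrow> real"
  assumes f: "almost_periodic G f" and T: "bounded_linear T" "\<And>z. norm (T z) \<le> cmod z"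
  shows "\<exists>c. mean_value (\<lambda>g. T (f g)) c"
proof -
  interpret bounded_linear T by fact
  obtain b where b: "\<And>g. g \<in> carrier G \<Longrightarrow> cmod (f g) \<le> b"
    using almost_periodicD(1)[OF f] by (auto simp: bounded_iff)
  have "left_net (\<lambda>g. T (f g))"
    by (rule left_net_contraction[OF almost_periodic_left_nets(1)[OF f]]) (metis T(2) diff)
  moreover have "\<bar>T (f g)\<bar> \<le> b" if "g \<in> carrier G" for g
    using T(2)[of "f g"] b[OF that] by simp
  ultimately show ?thesis
    by (rule ex_mean_value_real)
qed

lemma norm_Re_le: "norm (Re z) \<le> cmod z" and norm_Im_le: "norm (Im z) \<le> cmod z"
  by (simp_all add: abs_Re_le_cmod abs_Im_le_cmod)

lemma mean_value_unique:
  assumes f: "almost_periodic G f" and c: "mean_value f c" and d: "mean_value f d"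
  shows "c = d"
proof (rule complex_eqI)
  show "Re c = Re d"
    using mean_value_bounded_linear[OF bounded_linear_Re norm_Re_le] c d
    by (intro mean_value_real_unique[OF f bounded_linear_Re norm_Re_le])
  show "Im c = Im d"
    using mean_value_bounded_linear[OF bounded_linear_Im norm_Im_le] c d
    by (intro mean_value_real_unique[OF f bounded_linear_Im norm_Im_le])
qed

text \<open>The order argument treats real and imaginary parts separately and yields unrelated
  lists. They are applied in succession: after \<open>xs\<close> the real part is nearly constant
  and stays so under further averaging, while the imaginary part of the averaged function still has
  mean \<open>d\<close> by uniqueness, so some \<open>ys\<close> flattens it too.\<close>

lemma ex_mean_value:
  assumes f: "almost_periodic G f"
  shows "\<exists>c. mean_value f c"
proof -
  obtain c where c: "mean_value (\<lambda>g. Re (f g)) c"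
    using ex_mean_value_part[OF f bounded_linear_Re norm_Re_le] by blast
  obtain d where d: "mean_value (\<lambda>g. Im (f g)) d"
    using ex_mean_value_part[OF f bounded_linear_Im norm_Im_le] by blast
  have "mean_value f (Complex c d)"
    unfolding mean_value_def
  proof (intro allI impI)
    fix e :: real assume "e > 0"
    then have e2: "e / 2 > 0" by simp
    obtain xs where xs: "xs \<noteq> []" "set xs \<subseteq> carrier G"
      "\<And>h. h \<in> carrier G \<Longrightarrow> norm (right_average xs (\<lambda>g. Re (f g)) h - c) \<le> e / 2"
      using c e2 unfolding mean_value_def by meson
    let ?f = "right_average xs f"
    obtain d' where d': "mean_value (\<lambda>g. Im (?f g)) d'"
      using ex_mean_value_part[OF almost_periodic_right_average[OF f xs(2)] bounded_linear_Im norm_Im_le]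
      by blast
    moreover have "(\<lambda>g. Im (?f g)) = right_average xs (\<lambda>g. Im (f g))"
      by (rule ext) (rule right_average_bounded_linear[OF bounded_linear_Im, symmetric])
    ultimately have "mean_value (right_average xs (\<lambda>g. Im (f g))) d'" by simp
    then have "mean_value (\<lambda>g. Im (f g)) d'"
      by (rule mean_value_right_average[OF _ xs(1,2)])
    then have "d' = d"
      using mean_value_real_unique[OF f bounded_linear_Im norm_Im_le] d by blast
    then obtain ys where ys: "ys \<noteq> []" "set ys \<subseteq> carrier G"
      "\<And>h. h \<in> carrier G \<Longrightarrow> norm (right_average ys (\<lambda>g. Im (?f g)) h - d) \<le> e / 2"
      using d' e2 unfolding mean_value_def by meson
    let ?zs = "concat (map (\<lambda>g. map (\<lambda>k. g \<otimes> k) xs) ys)"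
    have "cmod (right_average ?zs f h - Complex c d) \<le> e" if h: "h \<in> carrier G" for h
    proof -
      let ?w = "right_average ys ?f h"
      have "(\<lambda>g. Re (?f g)) = right_average xs (\<lambda>g. Re (f g))"
        by (rule ext) (rule right_average_bounded_linear[OF bounded_linear_Re, symmetric])
      then have "Re ?w = right_average ys (right_average xs (\<lambda>g. Re (f g))) h"
        using right_average_bounded_linear[OF bounded_linear_Re, of ys ?f h] by metis
      moreover have "norm (right_average ys (right_average xs (\<lambda>g. Re (f g))) h
          - right_average ys (\<lambda>_. c) h) \<le> e / 2"
        using xs(3) ys(2) h by (intro right_average_diff_le[OF ys(1)]) auto
      ultimately have "\<bar>Re ?w - c\<bar> \<le> e / 2"
        using ys(1) by (simp add: right_average_const)
      moreover have "\<bar>Im ?w - d\<bar> \<le> e / 2"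
        using ys(3)[OF h] by (simp add: right_average_bounded_linear[OF bounded_linear_Im])
      ultimately have "cmod (?w - Complex c d) \<le> e"
        using cmod_le[of "?w - Complex c d"] by simp
      then show ?thesis
        using right_average_right_average[OF h ys(2) xs(2)] by metis
    qed
    moreover have "?zs \<noteq> []" using xs(1) ys(1) by (cases ys) auto
    moreover have "set ?zs \<subseteq> carrier G" using xs ys by (auto intro!: m_closed)
    ultimately show "\<exists>xs. xs \<noteq> [] \<and> set xs \<subseteq> carrier G \<and>
        (\<forall>h\<in>carrier G. cmod (right_average xs f h - Complex c d) \<le> e)"
      by blast
  qed
  then show ?thesis by blast
qed

text \<open>Averaging in two stages: \<open>xs\<close> settles \<open>f\<close>, then
  \<open>ys\<close> settles the averaged \<open>f'\<close>, whose mean is still \<open>d\<close> by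
  uniqueness. The concatenated products work for both summands.\<close>

lemma mean_value_add:
  assumes f: "almost_periodic G f" "mean_value f c" and f': "almost_periodic G f'" "mean_value f' d"
  shows "mean_value (\<lambda>h. f h + f' h) (c + d)"
  unfolding mean_value_def
proof (intro allI impI)
  fix e :: real assume "e > 0"
  then have e2: "e / 2 > 0" by simp
  obtain xs where xs: "xs \<noteq> []" "set xs \<subseteq> carrier G"
    "\<And>h. h \<in> carrier G \<Longrightarrow> norm (right_average xs f h - c) \<le> e / 2"
    using f(2) e2 unfolding mean_value_def by meson
  let ?f = "right_average xs f'"
  obtain d' where d': "mean_value ?f d'"
    using ex_mean_value[OF almost_periodic_right_average[OF f'(1) xs(2)]] by blast
  have "d' = d"
    using mean_value_unique[OF f'(1) mean_value_right_average[OF d' xs(1,2)] f'(2)] .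
  then obtain ys where ys: "ys \<noteq> []" "set ys \<subseteq> carrier G"
    "\<And>h. h \<in> carrier G \<Longrightarrow> norm (right_average ys ?f h - d) \<le> e / 2"
    using d' e2 unfolding mean_value_def by meson
  let ?zs = "concat (map (\<lambda>g. map (\<lambda>k. g \<otimes> k) xs) ys)"
  have "cmod (right_average ?zs (\<lambda>h. f h + f' h) h - (c + d)) \<le> e" if h: "h \<in> carrier G" for h
  proof -
    have "norm (right_average ys (right_average xs f) h - right_average ys (\<lambda>_. c) h) \<le> e / 2"
      using xs(3) ys(2) h by (intro right_average_diff_le[OF ys(1)]) auto
    then have "norm (right_average ?zs f h - c) \<le> e / 2"
      unfolding right_average_const[OF ys(1)] right_average_right_average[OF h ys(2) xs(2)] .
    moreover have "norm (right_average ?zs f' h - d) \<le> e / 2"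
      using ys(3)[OF h] right_average_right_average[OF h ys(2) xs(2)] by metis
    ultimately have "norm ((right_average ?zs f h - c) + (right_average ?zs f' h - d)) \<le> e / 2 + e / 2"
      by (rule norm_triangle_mono)
    then show ?thesis
      by (simp add: right_average_add algebra_simps)
  qed
  moreover have "?zs \<noteq> []" using xs(1) ys(1) by (cases ys) auto
  moreover have "set ?zs \<subseteq> carrier G" using xs ys by (auto intro!: m_closed)
  ultimately show "\<exists>xs. xs \<noteq> [] \<and> set xs \<subseteq> carrier G \<and>
      (\<forall>h\<in>carrier G. cmod (right_average xs (\<lambda>h. f h + f' h) h - (c + d)) \<le> e)"
    by blast
qed

lemma mean_value_scale:
  fixes f :: "'a \<Rightarrow> complex"
  assumes "mean_value f c"
  shows "mean_value (\<lambda>h. r * f h) (r * c)"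
  unfolding mean_value_def
proof (intro allI impI)
  fix e :: real assume "e > 0"
  then have "e / (cmod r + 1) > 0" by (simp add: add_nonneg_pos)
  then obtain xs where xs: "xs \<noteq> []" "set xs \<subseteq> carrier G"
    "\<And>h. h \<in> carrier G \<Longrightarrow> norm (right_average xs f h - c) \<le> e / (cmod r + 1)"
    using assms unfolding mean_value_def by meson
  have "norm (right_average xs (\<lambda>h. r * f h) h - r * c) \<le> e" if "h \<in> carrier G" for h
  proof -
    have "norm (right_average xs (\<lambda>h. r * f h) h - r * c) = cmod r * norm (right_average xs f h - c)"
      by (simp add: right_average_bounded_linear[OF bounded_linear_mult_right]
          flip: right_diff_distrib norm_mult)
    also have "\<dots> \<le> cmod r * (e / (cmod r + 1))"
      using xs(3)[OF that] by (intro mult_left_mono) auto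
    also have "\<dots> = e * (cmod r / (cmod r + 1))" by simp
    also have "\<dots> \<le> e * 1"
      using \<open>e > 0\<close> by (intro mult_left_mono) (auto simp: divide_le_eq_1 add_nonneg_pos)
    also have "\<dots> = e" by simp
    finally show ?thesis .
  qed
  then show "\<exists>xs. xs \<noteq> [] \<and> set xs \<subseteq> carrier G \<and>
      (\<forall>h\<in>carrier G. norm (right_average xs (\<lambda>h. r * f h) h - r * c) \<le> e)"
    using xs by blast
qed

lemma mean_value_translate:
  assumes "mean_value (\<lambda>h. f (h \<otimes> g)) c" and g: "g \<in> carrier G"
  shows "mean_value f c"
proof (rule mean_value_right_average[of "[g]"])
  show "mean_value (right_average [g] f) c"
    using assms by (simp add: right_average_def[abs_def])
qed (use g in auto)

lemma right_average_cong:
  assumes "set xs \<subseteq> carrier G" "h \<in> carrier G" "\<And>g. g \<in> carrier G \<Longrightarrow> f g = f' g"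
  shows "right_average xs f h = right_average xs f' h"
proof -
  have "map (\<lambda>g. f (h \<otimes> g)) xs = map (\<lambda>g. f' (h \<otimes> g)) xs"
    using assms by (intro map_cong) auto
  then have "(\<Sum>g\<leftarrow>xs. f (h \<otimes> g)) = (\<Sum>g\<leftarrow>xs. f' (h \<otimes> g))"
    by (rule arg_cong)
  then show ?thesis by (simp add: right_average_def)
qed

lemma mean_value_cong:
  assumes m: "mean_value f c" and "\<And>g. g \<in> carrier G \<Longrightarrow> f g = f' g"
  shows "mean_value f' c"
  unfolding mean_value_def
proof (intro allI impI)
  fix e :: real assume "e > 0"
  then obtain xs where xs: "xs \<noteq> []" "set xs \<subseteq> carrier G"
    "\<And>h. h \<in> carrier G \<Longrightarrow> norm (right_average xs f h - c) \<le> e"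
    using m unfolding mean_value_def by meson
  then show "\<exists>xs. xs \<noteq> [] \<and> set xs \<subseteq> carrier G \<and>
      (\<forall>h\<in>carrier G. norm (right_average xs f' h - c) \<le> e)"
    using right_average_cong[OF xs(2) _ assms(2)] by (intro exI[of _ xs]) simp
qed

lemma mean_value_const: "mean_value (\<lambda>h. c) c"
  unfolding mean_value_def by (auto simp: right_average_const intro!: exI[of _ "[\<one>]"])

text \<open>Averages of values in a convex set stay in it, and the mean is a limit of averages.
  Positivity, bounds in absolute value, vanishing and half-plane estimates are all
  instances.\<close>

lemma mean_value_in_closed_convex:
  assumes m: "mean_value f c" and S: "closed S" "convex S" and f: "\<And>g. g \<in> carrier G \<Longrightarrow> f g \<in> S"
  shows "c \<in> S"
proof -
  have av: "right_average xs f h \<in> S" if xs: "xs \<noteq> []" "set xs \<subseteq> carrier G" and h: "h \<in> carrier G" for xs h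
  proof -
    have "(\<Sum>i<length xs. (1 / real (length xs)) *\<^sub>R f (h \<otimes> xs ! i)) \<in> S"
    proof (rule convex_sum[OF _ S(2)])
      show "f (h \<otimes> xs ! i) \<in> S" if "i \<in> {..<length xs}" for i
        using that xs h by (intro f m_closed) auto
    qed (use xs(1) in auto)
    then show ?thesis
      by (simp add: right_average_def sum_list_sum_nth atLeast0LessThan scaleR_sum_right)
  qed
  have "c \<in> closure S"
    unfolding closure_approachable
  proof (intro allI impI)
    fix e :: real assume "e > 0"
    then have "e / 2 > 0" by simp
    then obtain xs where "xs \<noteq> []" "set xs \<subseteq> carrier G"
      "\<And>h. h \<in> carrier G \<Longrightarrow> norm (right_average xs f h - c) \<le> e / 2"
      using m unfolding mean_value_def by meson
    then have "right_average xs f \<one> \<in> S" "dist (right_average xs f \<one>) c < e"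
      using av[of xs \<one>] \<open>e > 0\<close> by (fastforce simp: dist_norm)+
    then show "\<exists>y\<in>S. dist y c < e" by blast
  qed
  then show ?thesis using S by simp
qed

text \<open>The default 0 off the almost periodic functions is harmless: the axioms of an invariant
  mean only constrain its values on almost periodic functions.\<close>

lemma ex_invariant_mean:
  "invariant_mean G (\<lambda>f. if almost_periodic G f then THE c. mean_value f c else 0)"
    (is "invariant_mean G ?m")
proof -
  have m: "?m f = c" if "almost_periodic G f" "mean_value f c" for f c
    using that mean_value_unique by (simp, blast)
  have m': "mean_value f (?m f)" if f: "almost_periodic G f" for f
    using ex_mean_value[OF f] m[OF f] by metis
  show ?thesis
    unfolding invariant_mean_def
  proof (intro conjI allI impI ballI)
    fix f f' assume f: "almost_periodic G f" "almost_periodic G f'"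
    show "?m (\<lambda>h. f h + f' h) = ?m f + ?m f'"
      by (rule m[OF almost_periodic_add[OF f] mean_value_add[OF f(1) m'[OF f(1)] f(2) m'[OF f(2)]]])
  next
    fix c f assume f: "almost_periodic G f"
    show "?m (\<lambda>h. c * f h) = c * ?m f"
      by (rule m[OF almost_periodic_scale[OF f] mean_value_scale[OF m'[OF f]]])
  next
    fix f assume f: "almost_periodic G f" "\<forall>h\<in>carrier G. f h \<in> \<real>\<^sub>\<ge>\<^sub>0"
    show "?m f \<in> \<real>\<^sub>\<ge>\<^sub>0"
      using f(2)
      by (intro mean_value_in_closed_convex[OF m'[OF f(1)] closed_nonneg_Reals_complex])
         (auto simp: convex_def complex_nonneg_Reals_iff)
  next
    show "?m (\<lambda>h. 1) = 1"
      by (rule m[OF almost_periodic_const mean_value_const])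
  next
    fix f g assume g: "g \<in> carrier G" and f: "almost_periodic G f"
    have f': "almost_periodic G (\<lambda>h. f (h \<otimes> g))" by (rule almost_periodic_translate[OF f g])
    show "?m (\<lambda>h. f (h \<otimes> g)) = ?m f"
      using m[OF f mean_value_translate[OF m'[OF f'] g]] by simp
  qed
qed

text \<open>Invariance gives a function and its averages the same mean; positivity bounds the mean
  by the supremum norm. Since some averages are uniformly close to the constant \<open>c\<close>,
  the mean can only be \<open>c\<close>.\<close>

lemma invariant_mean_eq:
  assumes m: "invariant_mean G m" and f: "almost_periodic G f" and c: "mean_value f c"
  shows "m f = c"
proof -
  have add: "m (\<lambda>h. f h + f' h) = m f + m f'"
    if "almost_periodic G f" "almost_periodic G f'" for f f'
    using m that unfolding invariant_mean_def by blast
  have scale: "m (\<lambda>h. c * f h) = c * m f" if "almost_periodic G f" for f c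
    using m that unfolding invariant_mean_def by blast
  have pos: "m f \<in> \<real>\<^sub>\<ge>\<^sub>0" if "almost_periodic G f" "\<forall>h\<in>carrier G. f h \<in> \<real>\<^sub>\<ge>\<^sub>0" for f
    using m that unfolding invariant_mean_def by blast
  have one: "m (\<lambda>h. 1) = 1"
    using m unfolding invariant_mean_def by blast
  have inv: "m (\<lambda>h. f (h \<otimes> g)) = m f" if "almost_periodic G f" "g \<in> carrier G" for f g
    using m that unfolding invariant_mean_def by blast
  have const: "m (\<lambda>h. c) = c" for c
    using scale[OF almost_periodic_const[of 1], of c] one by simp
  have real_bound: "cmod (m u) \<le> e"
    if u: "almost_periodic G u" and re: "\<And>g. g \<in> carrier G \<Longrightarrow> Im (u g) = 0 \<and> \<bar>Re (u g)\<bar> \<le> e" for u e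
  proof -
    have "m (\<lambda>h. of_real e + u h) \<in> \<real>\<^sub>\<ge>\<^sub>0"
      using re by (intro pos almost_periodic_add almost_periodic_const u)
        (fastforce simp: complex_nonneg_Reals_iff abs_le_iff)
    moreover have "m (\<lambda>h. of_real e + (-1) * u h) \<in> \<real>\<^sub>\<ge>\<^sub>0"
      using re by (intro pos almost_periodic_add almost_periodic_const almost_periodic_scale u)
        (fastforce simp: complex_nonneg_Reals_iff abs_le_iff)
    moreover have "m (\<lambda>h. of_real e + u h) = of_real e + m u"
      by (simp add: add[OF almost_periodic_const u] const)
    moreover have "m (\<lambda>h. of_real e + (-1) * u h) = of_real e + (-1) * m u"
      by (subst add[OF almost_periodic_const almost_periodic_scale[OF u]])
         (simp only: const scale[OF u])
    ultimately have "Im (m u) = 0" "\<bar>Re (m u)\<bar> \<le> e"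
      by (auto simp: complex_nonneg_Reals_iff)
    then show ?thesis using cmod_le[of "m u"] by simp
  qed
  \<comment> \<open>The factor 2 comes from treating real and imaginary part separately; any fixed
    constant serves.\<close>
  have bound: "cmod (m u) \<le> 2 * e"
    if u: "almost_periodic G u" and e: "\<And>g. g \<in> carrier G \<Longrightarrow> cmod (u g) \<le> e" for u e
  proof -
    have "u = (\<lambda>h. of_real (Re (u h)) + \<i> * of_real (Im (u h)))"
      using complex_eq by auto
    then have "m u = m (\<lambda>h. of_real (Re (u h))) + \<i> * m (\<lambda>h. of_real (Im (u h)))"
      using add[OF almost_periodic_Re[OF u] almost_periodic_scale[OF almost_periodic_Im[OF u]]]
        scale[OF almost_periodic_Im[OF u]] by metis
    moreover have "cmod (m (\<lambda>h. of_real (Re (u h)))) \<le> e" "cmod (m (\<lambda>h. of_real (Im (u h)))) \<le> e"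
      using order_trans[OF abs_Re_le_cmod e] order_trans[OF abs_Im_le_cmod e]
      by (auto intro!: real_bound almost_periodic_Re almost_periodic_Im u)
    ultimately show ?thesis
      using norm_triangle_ineq[of "m (\<lambda>h. of_real (Re (u h)))" "\<i> * m (\<lambda>h. of_real (Im (u h)))"]
      by (simp add: norm_mult)
  qed
  have average: "m (right_average xs f) = m f" if xs: "xs \<noteq> []" "set xs \<subseteq> carrier G" for xs
  proof -
    have "almost_periodic G (\<lambda>h. \<Sum>g\<leftarrow>xs. f (h \<otimes> g)) \<and>
        m (\<lambda>h. \<Sum>g\<leftarrow>xs. f (h \<otimes> g)) = of_nat (length xs) * m f"
      using xs(2)
    proof (induction xs)
      case (Cons x xs)
      then have "almost_periodic G (\<lambda>h. f (h \<otimes> x))"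
        by (intro almost_periodic_translate[OF f]) auto
      with Cons show ?case
        by (simp add: almost_periodic_add add inv[OF f] algebra_simps)
    qed (simp add: almost_periodic_const const)
    then have "m (\<lambda>h. of_real (1 / real (length xs)) * (\<Sum>g\<leftarrow>xs. f (h \<otimes> g))) = m f"
      using xs(1) by (subst scale) auto
    then show ?thesis
      by (simp add: right_average_def[abs_def] scaleR_conv_of_real)
  qed
  have "cmod (m f - c) \<le> e" if "e > 0" for e
  proof -
    have "e / 2 > 0" using that by simp
    then obtain xs where xs: "xs \<noteq> []" "set xs \<subseteq> carrier G"
      "\<And>h. h \<in> carrier G \<Longrightarrow> norm (right_average xs f h - c) \<le> e / 2"
      using c unfolding mean_value_def by meson
    have ap: "almost_periodic G (right_average xs f)" by (rule almost_periodic_right_average[OF f xs(2)])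
    have "cmod (m (\<lambda>h. right_average xs f h + (- c))) \<le> 2 * (e / 2)"
      using xs(3) by (intro bound almost_periodic_add[OF ap almost_periodic_const]) auto
    then show ?thesis
      by (subst (asm) add[OF ap almost_periodic_const]) (simp add: const average[OF xs(1,2)])
  qed
  then have "cmod (m f - c) \<le> 0" using field_le_epsilon[of "cmod (m f - c)" 0] by simp
  then show ?thesis by simp
qed

lemma ap_mean_eq:
  assumes f: "almost_periodic G f" and c: "mean_value f c"
  shows "ap_mean G f = c"
  unfolding ap_mean_def using ex_invariant_mean invariant_mean_eq[OF _ f c] by blast

lemma mean_value_ap_mean: "almost_periodic G f \<Longrightarrow> mean_value f (ap_mean G f)"
  using ex_mean_value ap_mean_eq by blast

end

section \<open>Orbit means and the function-valued inner product\<close>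

locale stable_action =
  fixes G :: "('g, 'b) monoid_scheme" (structure) and \<alpha> :: "'g \<Rightarrow> 'x::metric_space \<Rightarrow> 'x"
  assumes compact_UNIV: "compact (UNIV :: 'x set)"
    and action: "group_action G UNIV \<alpha>"
    and stable: "lyapunov_stable G \<alpha>"

sublocale stable_action \<subseteq> group G
  using action group_action.group_hom group_hom.axioms(1) by blast

context stable_action
begin

abbreviation "cont \<phi> \<equiv> continuous_on UNIV (\<phi> :: 'x \<Rightarrow> complex)"

abbreviation "A \<equiv> invariant_algebra G \<alpha>"

lemma action_mult: "g \<in> carrier G \<Longrightarrow> h \<in> carrier G \<Longrightarrow> \<alpha> (g \<otimes> h) x = \<alpha> g (\<alpha> h x)"
  using group_action.composition_rule[OF action, of x g h] by simp

lemma carrier_AI: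
  "cont a \<Longrightarrow> (\<And>g x. g \<in> carrier G \<Longrightarrow> a (\<alpha> g x) = a x) \<Longrightarrow> a \<in> carrier A"
  by (simp add: invariant_algebra_def)

lemma carrier_A_cont: "a \<in> carrier A \<Longrightarrow> cont a"
  and carrier_A_inv: "a \<in> carrier A \<Longrightarrow> g \<in> carrier G \<Longrightarrow> a (\<alpha> g x) = a x"
  by (simp_all add: invariant_algebra_def)

lemma cont_bounded: "cont \<phi> \<Longrightarrow> \<exists>B. \<forall>x. cmod (\<phi> x) \<le> B"
  using compact_imp_bounded[OF compact_continuous_image[OF _ compact_UNIV], of \<phi>]
  by (auto simp: bounded_iff)

text \<open>Stability makes \<open>\<alpha> g x\<close> and \<open>\<alpha> g y\<close> close for
  all g at once, and \<phi> is uniformly continuous by compactness. The radius depends on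
  \<open>x\<close> but not on g.\<close>

lemma equicontinuous:
  assumes \<phi>: "cont \<phi>" and e: "e > 0"
  shows "\<exists>d>0. \<forall>y. dist x y < d \<longrightarrow> (\<forall>g\<in>carrier G. cmod (\<phi> (\<alpha> g x) - \<phi> (\<alpha> g y)) < e)"
proof -
  have "uniformly_continuous_on UNIV \<phi>"
    using compact_uniformly_continuous[OF \<phi> compact_UNIV] .
  then obtain r where r: "r > 0" "\<And>x y. dist x y < r \<Longrightarrow> dist (\<phi> x) (\<phi> y) < e"
    unfolding uniformly_continuous_on_def using e by (metis UNIV_I)
  obtain d where "d > 0" "\<forall>y. dist x y < d \<longrightarrow> (\<forall>g\<in>carrier G. dist (\<alpha> g x) (\<alpha> g y) < r)"
    using stable r(1) unfolding lyapunov_stable_def by blast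
  then show ?thesis using r(2) unfolding dist_norm[of "\<phi> _"] by blast
qed

text \<open>Finitely many balls of equicontinuity cover the space. If g and g' move \<open>x\<close>
  into the same ball, then applying any h afterwards keeps the values of \<phi> close, because
  \<open>\<alpha> (h \<otimes> g) x = \<alpha> h (\<alpha> g x)\<close>; the pieces are therefore
  indexed by balls.\<close>

lemma orbit_almost_periodic:
  assumes \<phi>: "cont \<phi>"
  shows "almost_periodic G (\<lambda>g. \<phi> (\<alpha> g x))"
proof (rule almost_periodicI)
  show "bounded ((\<lambda>g. \<phi> (\<alpha> g x)) ` carrier G)"
    using cont_bounded[OF \<phi>] by (auto simp: bounded_iff)
  fix e :: real assume "e > 0"
  then have "e / 2 > 0" by simp
  then obtain d where d: "\<And>y. d y > 0" "\<And>y z g. dist y z < d y \<Longrightarrow> g \<in> carrier G \<Longrightarrow>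
      cmod (\<phi> (\<alpha> g y) - \<phi> (\<alpha> g z)) < e / 2"
    using equicontinuous[OF \<phi>] by metis
  have "UNIV \<subseteq> (\<Union>y\<in>UNIV. ball y (d y))"
  proof
    fix y show "y \<in> (\<Union>y\<in>UNIV. ball y (d y))"
      using d(1)[of y] by (intro UN_I[of y]) simp_all
  qed
  then obtain C where C: "finite C" "UNIV \<subseteq> (\<Union>y\<in>C. ball y (d y))"
    by (rule compactE_image[OF compact_UNIV, of UNIV "\<lambda>y. ball y (d y)", rotated]) auto
  let ?B = "\<lambda>y. {g. \<alpha> g x \<in> ball y (d y)}"
  show "\<exists>\<P>. finite \<P> \<and> carrier G \<subseteq> \<Union>\<P> \<and>
      (\<forall>B\<in>\<P>. \<forall>g\<in>B \<inter> carrier G. \<forall>g'\<in>B \<inter> carrier G. \<forall>h\<in>carrier G.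
        cmod (\<phi> (\<alpha> (h \<otimes> g) x) - \<phi> (\<alpha> (h \<otimes> g') x)) < e)"
  proof (intro exI[of _ "?B ` C"] conjI)
    show "carrier G \<subseteq> \<Union> (?B ` C)" using C(2) by blast
    show "\<forall>B\<in>?B ` C. \<forall>g\<in>B \<inter> carrier G. \<forall>g'\<in>B \<inter> carrier G. \<forall>h\<in>carrier G.
        cmod (\<phi> (\<alpha> (h \<otimes> g) x) - \<phi> (\<alpha> (h \<otimes> g') x)) < e"
    proof clarify
      fix y g g' h
      assume g: "g \<in> carrier G" "g' \<in> carrier G" "h \<in> carrier G"
        and "\<alpha> g x \<in> ball y (d y)" "\<alpha> g' x \<in> ball y (d y)"
      then have "cmod (\<phi> (\<alpha> h y) - \<phi> (\<alpha> h (\<alpha> g x))) < e / 2"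
        "cmod (\<phi> (\<alpha> h y) - \<phi> (\<alpha> h (\<alpha> g' x))) < e / 2"
        using d(2) by simp_all
      then show "cmod (\<phi> (\<alpha> (h \<otimes> g) x) - \<phi> (\<alpha> (h \<otimes> g') x)) < e"
        using g norm_triangle_half_r[of "\<phi> (\<alpha> h y)" "\<phi> (\<alpha> h (\<alpha> g x))" e "\<phi> (\<alpha> h (\<alpha> g' x))"]
        by (simp add: action_mult)
    qed
  qed (use C in simp)
qed

section \<open>The orbit mean, a map from C(X) to the invariant functions\<close>

definition orbit_mean :: "('x \<Rightarrow> complex) \<Rightarrow> 'x \<Rightarrow> complex" where
  "orbit_mean \<phi> x = ap_mean G (\<lambda>g. \<phi> (\<alpha> g x))"

lemma mean_value_orbit: "cont \<phi> \<Longrightarrow> mean_value (\<lambda>g. \<phi> (\<alpha> g x)) (orbit_mean \<phi> x)"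
  unfolding orbit_mean_def by (intro mean_value_ap_mean orbit_almost_periodic)

lemma orbit_mean_eq: "cont \<phi> \<Longrightarrow> mean_value (\<lambda>g. \<phi> (\<alpha> g x)) c \<Longrightarrow> orbit_mean \<phi> x = c"
  unfolding orbit_mean_def by (intro ap_mean_eq orbit_almost_periodic)

lemma orbit_mean_in_closed_convex:
  "cont \<phi> \<Longrightarrow> closed S \<Longrightarrow> convex S \<Longrightarrow> (\<And>g. g \<in> carrier G \<Longrightarrow> \<phi> (\<alpha> g x) \<in> S) \<Longrightarrow> orbit_mean \<phi> x \<in> S"
  by (rule mean_value_in_closed_convex[OF mean_value_orbit])

lemma orbit_mean_add:
  "cont \<phi> \<Longrightarrow> cont \<psi> \<Longrightarrow> orbit_mean (\<lambda>x. \<phi> x + \<psi> x) x = orbit_mean \<phi> x + orbit_mean \<psi> x"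
  by (intro orbit_mean_eq mean_value_add mean_value_orbit orbit_almost_periodic continuous_intros)

lemma orbit_mean_scale: "cont \<phi> \<Longrightarrow> orbit_mean (\<lambda>x. c * \<phi> x) x = c * orbit_mean \<phi> x"
  by (intro orbit_mean_eq mean_value_scale mean_value_orbit continuous_intros)

lemma orbit_mean_diff:
  "cont \<phi> \<Longrightarrow> cont \<psi> \<Longrightarrow> orbit_mean (\<lambda>x. \<phi> x - \<psi> x) x = orbit_mean \<phi> x - orbit_mean \<psi> x"
  using orbit_mean_add[of \<phi> "\<lambda>x. (-1) * \<psi> x" x] orbit_mean_scale[of \<psi> "-1" x]
  by (simp add: continuous_intros)

lemma orbit_mean_cnj: "cont \<phi> \<Longrightarrow> orbit_mean (\<lambda>x. cnj (\<phi> x)) x = cnj (orbit_mean \<phi> x)"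
  by (intro orbit_mean_eq mean_value_bounded_linear[OF bounded_linear_cnj] mean_value_orbit
      continuous_intros) simp_all

lemma orbit_mean_bound:
  assumes "cont \<phi>" "\<And>g. g \<in> carrier G \<Longrightarrow> cmod (\<phi> (\<alpha> g x)) \<le> B"
  shows "cmod (orbit_mean \<phi> x) \<le> B"
  using orbit_mean_in_closed_convex[of \<phi> "cball 0 B" x] assms by simp

text \<open>On the orbit of \<open>x\<close> the function \<open>a\<close> is the constant
  \<open>a x\<close>, so the difference of the two integrands vanishes there and its mean lies in
  the closed convex set {0}.\<close>

lemma orbit_mean_mult_invariant:
  assumes a: "a \<in> carrier A" and \<phi>: "cont \<phi>"
  shows "orbit_mean (\<lambda>x. a x * \<phi> x) x = a x * orbit_mean \<phi> x"
proof -
  have c: "cont (\<lambda>x. a x * \<phi> x)"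
    using carrier_A_cont[OF a] \<phi> by (intro continuous_intros)
  have "orbit_mean (\<lambda>y. a y * \<phi> y - a x * \<phi> y) x \<in> {0}"
    using c \<phi> carrier_A_inv[OF a]
    by (intro orbit_mean_in_closed_convex) (auto intro!: continuous_intros)
  then show ?thesis
    using orbit_mean_diff[OF c, of "\<lambda>y. a x * \<phi> y" x] orbit_mean_scale[OF \<phi>, of "a x" x] \<phi>
    by (simp add: continuous_intros)
qed

text \<open>Continuity is equicontinuity carried through the mean. Moving the base point by
  \<open>k\<close> is a right translation of the orbit function, which leaves the mean
  unchanged.\<close>

lemma orbit_mean_carrier:
  assumes \<phi>: "cont \<phi>"
  shows "orbit_mean \<phi> \<in> carrier A"
proof (rule carrier_AI)
  show "cont (orbit_mean \<phi>)"
    unfolding continuous_on_iff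
  proof (intro ballI allI impI)
    fix x :: 'x and e :: real assume "e > 0"
    then have "e / 4 > 0" by simp
    then obtain d where d: "d > 0" "\<And>y g. dist x y < d \<Longrightarrow> g \<in> carrier G \<Longrightarrow>
        cmod (\<phi> (\<alpha> g x) - \<phi> (\<alpha> g y)) < e / 4"
      using equicontinuous[OF \<phi>] by metis
    have "dist (orbit_mean \<phi> y) (orbit_mean \<phi> x) < e" if y: "dist y x < d" for y
    proof -
      have my: "mean_value (\<lambda>g. (-1) * \<phi> (\<alpha> g y)) (- orbit_mean \<phi> y)"
        using mean_value_scale[OF mean_value_orbit[OF \<phi>], of "-1"] by simp
      have "mean_value (\<lambda>g. \<phi> (\<alpha> g x) + (-1) * \<phi> (\<alpha> g y)) (orbit_mean \<phi> x + - orbit_mean \<phi> y)"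
        by (intro mean_value_add my mean_value_orbit[OF \<phi>] almost_periodic_scale orbit_almost_periodic \<phi>)
      then have "orbit_mean \<phi> x + - orbit_mean \<phi> y \<in> cball 0 (e / 4)"
        by (rule mean_value_in_closed_convex)
          (use d(2)[of y] y in \<open>auto simp: dist_commute less_imp_le\<close>)
      then show ?thesis using \<open>e > 0\<close> by (simp add: dist_norm norm_minus_commute)
    qed
    then show "\<exists>d>0. \<forall>x'\<in>UNIV. dist x' x < d \<longrightarrow> dist (orbit_mean \<phi> x') (orbit_mean \<phi> x) < e"
      using d(1) by blast
  qed
  fix k x assume k: "k \<in> carrier G"
  have "mean_value (\<lambda>h. \<phi> (\<alpha> (h \<otimes> k) x)) (orbit_mean \<phi> (\<alpha> k x))"
    by (rule mean_value_cong[OF mean_value_orbit[OF \<phi>, of "\<alpha> k x"]]) (simp add: action_mult k)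
  then have "mean_value (\<lambda>g. \<phi> (\<alpha> g x)) (orbit_mean \<phi> (\<alpha> k x))"
    by (rule mean_value_translate[OF _ k])
  then show "orbit_mean \<phi> (\<alpha> k x) = orbit_mean \<phi> x"
    using orbit_mean_eq[OF \<phi>] by simp
qed

section \<open>The form with values in the invariant functions and its fibre seminorms\<close>

definition ip :: "('x \<Rightarrow> complex) \<Rightarrow> ('x \<Rightarrow> complex) \<Rightarrow> 'x \<Rightarrow> complex" where
  "ip \<phi> \<psi> = orbit_mean (\<lambda>x. \<phi> x * cnj (\<psi> x))"

text \<open>The seminorm of the fibre over \<open>x\<close>. It only sees \<phi> along the orbit of
  \<open>x\<close>, and the module norm is its supremum over all points.\<close>

definition fnorm :: "'x \<Rightarrow> ('x \<Rightarrow> complex) \<Rightarrow> real" where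
  "fnorm x \<phi> = sqrt (Re (ip \<phi> \<phi> x))"

lemma ip_carrier: "cont \<phi> \<Longrightarrow> cont \<psi> \<Longrightarrow> ip \<phi> \<psi> \<in> carrier A"
  unfolding ip_def by (intro orbit_mean_carrier continuous_intros)

lemma ip_add_left:
  "cont \<phi> \<Longrightarrow> cont \<phi>' \<Longrightarrow> cont \<psi> \<Longrightarrow> ip (\<lambda>x. \<phi> x + \<phi>' x) \<psi> x = ip \<phi> \<psi> x + ip \<phi>' \<psi> x"
  unfolding ip_def by (simp add: distrib_left distrib_right left_diff_distrib right_diff_distrib orbit_mean_add continuous_intros)

lemma ip_diff_left:
  "cont \<phi> \<Longrightarrow> cont \<phi>' \<Longrightarrow> cont \<psi> \<Longrightarrow> ip (\<lambda>x. \<phi> x - \<phi>' x) \<psi> x = ip \<phi> \<psi> x - ip \<phi>' \<psi> x"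
  unfolding ip_def by (simp add: distrib_left distrib_right left_diff_distrib right_diff_distrib orbit_mean_diff continuous_intros)

lemma ip_scale_left: "cont \<phi> \<Longrightarrow> cont \<psi> \<Longrightarrow> ip (\<lambda>x. c * \<phi> x) \<psi> x = c * ip \<phi> \<psi> x"
  unfolding ip_def by (simp add: mult.assoc orbit_mean_scale continuous_intros)

lemma ip_mult_left:
  "a \<in> carrier A \<Longrightarrow> cont \<phi> \<Longrightarrow> cont \<psi> \<Longrightarrow> ip (\<lambda>x. \<phi> x * a x) \<psi> x = ip \<phi> \<psi> x * a x"
  using orbit_mean_mult_invariant[of a "\<lambda>x. \<phi> x * cnj (\<psi> x)" x]
  unfolding ip_def by (simp add: mult_ac continuous_intros)

lemma ip_cnj: "cont \<phi> \<Longrightarrow> cont \<psi> \<Longrightarrow> ip \<psi> \<phi> x = cnj (ip \<phi> \<psi> x)"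
  using orbit_mean_cnj[of "\<lambda>x. \<phi> x * cnj (\<psi> x)" x]
  unfolding ip_def by (simp add: mult_ac continuous_intros)

lemma ip_self: assumes "cont \<phi>" shows "ip \<phi> \<phi> x = of_real (Re (ip \<phi> \<phi> x))" "Re (ip \<phi> \<phi> x) \<ge> 0"
proof -
  have "ip \<phi> \<phi> x \<in> \<real>\<^sub>\<ge>\<^sub>0"
    unfolding ip_def
    by (intro orbit_mean_in_closed_convex closed_nonneg_Reals_complex continuous_intros assms)
       (auto simp: convex_def complex_nonneg_Reals_iff complex_mult_cnj simp flip: power2_eq_square)
  then show "ip \<phi> \<phi> x = of_real (Re (ip \<phi> \<phi> x))" "Re (ip \<phi> \<phi> x) \<ge> 0"
    by (auto simp: complex_nonneg_Reals_iff complex_eq_iff)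
qed

lemma fnorm_nonneg: "cont \<phi> \<Longrightarrow> 0 \<le> fnorm x \<phi>"
  by (simp add: fnorm_def ip_self(2))

lemma fnorm_sq: "cont \<phi> \<Longrightarrow> (fnorm x \<phi>)\<^sup>2 = Re (ip \<phi> \<phi> x)"
  by (simp add: fnorm_def ip_self(2))

lemma ip_self_fnorm: "cont \<phi> \<Longrightarrow> ip \<phi> \<phi> x = of_real ((fnorm x \<phi>)\<^sup>2)"
  using ip_self(1) by (simp add: fnorm_sq)

lemma ip_zero_left: "ip (\<lambda>x. 0) \<psi> x = 0" 
  using orbit_mean_scale[of "\<lambda>x. 0" 0 x] by (simp add: ip_def)

lemma ip_add_right:
  "cont \<phi> \<Longrightarrow> cont \<psi> \<Longrightarrow> cont \<psi>' \<Longrightarrow> ip \<phi> (\<lambda>x. \<psi> x + \<psi>' x) x = ip \<phi> \<psi> x + ip \<phi> \<psi>' x"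
  unfolding ip_def by (simp add: distrib_left distrib_right left_diff_distrib right_diff_distrib orbit_mean_add continuous_intros)

lemma ip_diff_right:
  "cont \<phi> \<Longrightarrow> cont \<psi> \<Longrightarrow> cont \<psi>' \<Longrightarrow> ip \<phi> (\<lambda>x. \<psi> x - \<psi>' x) x = ip \<phi> \<psi> x - ip \<phi> \<psi>' x"
  unfolding ip_def by (simp add: distrib_left distrib_right left_diff_distrib right_diff_distrib orbit_mean_diff continuous_intros)

lemma ip_scale_right: "cont \<phi> \<Longrightarrow> cont \<psi> \<Longrightarrow> ip \<phi> (\<lambda>x. c * \<psi> x) x = cnj c * ip \<phi> \<psi> x"
  using ip_cnj[of \<phi> "\<lambda>x. c * \<psi> x" x] ip_scale_left[of \<psi> \<phi> c x] ip_cnj[of \<psi> \<phi> x]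
  by (metis complex_cnj_cnj complex_cnj_mult continuous_on_mult_left)

lemma fnorm_scale: "cont \<phi> \<Longrightarrow> fnorm x (\<lambda>x. c * \<phi> x) = cmod c * fnorm x \<phi>"
proof -
  assume c: "cont \<phi>"
  have "ip (\<lambda>x. c * \<phi> x) (\<lambda>x. c * \<phi> x) x = of_real ((cmod c)\<^sup>2) * ip \<phi> \<phi> x"
    using c by (simp add: ip_scale_left ip_scale_right continuous_intros complex_norm_square mult_ac del: of_real_power)
  then show ?thesis by (simp add: fnorm_def real_sqrt_mult)
qed

lemma fnorm_mult: "a \<in> carrier A \<Longrightarrow> cont \<phi> \<Longrightarrow> fnorm x (\<lambda>x. \<phi> x * a x) = fnorm x \<phi> * cmod (a x)"
proof -
  assume a: "a \<in> carrier A" and c: "cont \<phi>"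
  have ca: "cont (\<lambda>x. \<phi> x * a x)" using carrier_A_cont[OF a] c by (intro continuous_intros)
  have "ip (\<lambda>x. \<phi> x * a x) (\<lambda>x. \<phi> x * a x) x = ip \<phi> (\<lambda>x. \<phi> x * a x) x * a x"
    using a c ca by (simp add: ip_mult_left)
  also have "ip \<phi> (\<lambda>x. \<phi> x * a x) x = cnj (ip \<phi> \<phi> x * a x)"
    using a c ca by (simp add: ip_cnj[OF ca c] ip_mult_left)
  also have "cnj (ip \<phi> \<phi> x * a x) * a x = of_real ((fnorm x \<phi>)\<^sup>2 * (cmod (a x))\<^sup>2)"
    using c by (simp add: ip_self_fnorm complex_norm_square mult_ac del: of_real_power)
  finally show ?thesis
    using c fnorm_nonneg[OF c, of x] by (simp add: fnorm_def[of x "\<lambda>x. \<phi> x * a x"] real_sqrt_mult)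
qed

lemma fnorm_sub_sq:
  assumes "cont \<phi>" "cont \<psi>"
  shows "(fnorm x (\<lambda>x. \<phi> x - \<psi> x))\<^sup>2 = (fnorm x \<phi>)\<^sup>2 - 2 * Re (ip \<phi> \<psi> x) + (fnorm x \<psi>)\<^sup>2"
  using assms ip_cnj[OF assms, of x]
  by (simp add: fnorm_sq continuous_intros ip_diff_left ip_diff_right)

lemma fnorm_add_sq:
  assumes "cont \<phi>" "cont \<psi>"
  shows "(fnorm x (\<lambda>x. \<phi> x + \<psi> x))\<^sup>2 = (fnorm x \<phi>)\<^sup>2 + 2 * Re (ip \<phi> \<psi> x) + (fnorm x \<psi>)\<^sup>2"
  using assms ip_cnj[OF assms, of x]
  by (simp add: fnorm_sq continuous_intros ip_add_left ip_add_right)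

text \<open>The usual expansion of the square of \<open>?t\<close> \<phi> - \<open>?s\<close>
  \<psi>, with the two norms as crossed coefficients. As a seminorm may vanish, both coefficients
  are raised by \<open>d > 0\<close>, so that their product can be cancelled, and \<open>d\<close>
  is chosen small against \<open>e\<close>.\<close>

lemma Re_ip_le:
  assumes "cont \<phi>" "cont \<psi>"
  shows "Re (ip \<phi> \<psi> x) \<le> fnorm x \<phi> * fnorm x \<psi>"
proof (rule field_le_epsilon)
  fix e :: real assume e: "e > 0"
  let ?p = "fnorm x \<phi>" and ?q = "fnorm x \<psi>"
  have pq: "?p \<ge> 0" "?q \<ge> 0" using assms by (auto simp: fnorm_nonneg)
  define d where "d = min 1 (e / (?p + ?q + 1))"
  have "?p + ?q + 1 > 0" using pq by simp
  moreover have "d \<le> e / (?p + ?q + 1)" by (simp add: d_def)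
  ultimately have d: "d > 0" "d \<le> 1" "d * (?p + ?q + 1) \<le> e"
    using e by (simp_all only: pos_le_divide_eq) (simp_all add: d_def)
  let ?s = "?p + d" and ?t = "?q + d"
  have st: "?s > 0" "?t > 0" using d pq by auto
  have expand: "(fnorm x (\<lambda>x. of_real t * \<phi> x - of_real s * \<psi> x))\<^sup>2
      = (t * ?p)\<^sup>2 - 2 * (s * t * Re (ip \<phi> \<psi> x)) + (s * ?q)\<^sup>2" for s t :: real
    using assms
    by (subst fnorm_sub_sq)
      (simp_all add: fnorm_scale ip_scale_left ip_scale_right continuous_intros power_mult_distrib)
  have "0 \<le> (fnorm x (\<lambda>x. of_real ?t * \<phi> x - of_real ?s * \<psi> x))\<^sup>2" by simp
  also note expand
  also have "(?t * ?p)\<^sup>2 \<le> (?s * ?t)\<^sup>2"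
    using pq d by (intro power_mono) (auto simp: mult.commute intro!: mult_right_mono)
  also have "(?s * ?q)\<^sup>2 \<le> (?s * ?t)\<^sup>2"
    using pq d by (intro power_mono) (auto intro!: mult_left_mono)
  finally have "(?s * ?t) * Re (ip \<phi> \<psi> x) \<le> (?s * ?t) * (?s * ?t)"
    unfolding power2_eq_square[of "?s * ?t"] by linarith
  then have "Re (ip \<phi> \<psi> x) \<le> ?s * ?t"
    using st by (simp add: mult_le_cancel_left_pos)
  also have "\<dots> = ?p * ?q + d * (?p + ?q + d)" by (simp add: algebra_simps)
  also have "\<dots> \<le> ?p * ?q + d * (?p + ?q + 1)"
    using d by (intro add_left_mono mult_left_mono) auto
  finally show "Re (ip \<phi> \<psi> x) \<le> ?p * ?q + e" using d by simp
qed

lemma Cauchy_Schwarz: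
  assumes "cont \<phi>" "cont \<psi>"
  shows "cmod (ip \<phi> \<psi> x) \<le> fnorm x \<phi> * fnorm x \<psi>"
proof (cases "ip \<phi> \<psi> x = 0")
  case False
  define w where "w = cnj (ip \<phi> \<psi> x) / of_real (cmod (ip \<phi> \<psi> x))"
  have w: "cmod w = 1" using False by (simp add: w_def norm_divide)
  have "w * ip \<phi> \<psi> x = of_real (cmod (ip \<phi> \<psi> x))"
    using False complex_norm_square[of "ip \<phi> \<psi> x"]
    by (simp add: w_def power2_eq_square field_simps)
  then have "cmod (ip \<phi> \<psi> x) = Re (ip (\<lambda>x. w * \<phi> x) \<psi> x)"
    using assms by (simp add: ip_scale_left)
  also have "\<dots> \<le> fnorm x (\<lambda>x. w * \<phi> x) * fnorm x \<psi>"
    using assms by (intro Re_ip_le continuous_intros)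
  finally show ?thesis using assms w by (simp add: fnorm_scale)
qed (use assms in \<open>simp add: fnorm_nonneg\<close>)

lemma fnorm_triangle:
  assumes "cont \<phi>" "cont \<psi>"
  shows "fnorm x (\<lambda>x. \<phi> x + \<psi> x) \<le> fnorm x \<phi> + fnorm x \<psi>"
proof (rule power2_le_imp_le)
  show "(fnorm x (\<lambda>x. \<phi> x + \<psi> x))\<^sup>2 \<le> (fnorm x \<phi> + fnorm x \<psi>)\<^sup>2"
    using Re_ip_le[OF assms, of x] by (simp add: fnorm_add_sq[OF assms] power2_sum)
qed (use assms in \<open>simp add: fnorm_nonneg\<close>)

lemma fnorm_minus: "cont \<phi> \<Longrightarrow> cont \<psi> \<Longrightarrow> fnorm x (\<lambda>x. \<phi> x - \<psi> x) = fnorm x (\<lambda>x. \<psi> x - \<phi> x)"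
  using fnorm_scale[of "\<lambda>x. \<psi> x - \<phi> x" x "-1"] by (simp add: continuous_intros)

lemma fnorm_triangle_diff:
  assumes "cont \<phi>" "cont \<psi>" "cont \<theta>"
  shows "fnorm x (\<lambda>x. \<phi> x - \<theta> x) \<le> fnorm x (\<lambda>x. \<phi> x - \<psi> x) + fnorm x (\<lambda>x. \<psi> x - \<theta> x)"
  using fnorm_triangle[of "\<lambda>x. \<phi> x - \<psi> x" "\<lambda>x. \<psi> x - \<theta> x" x] assms
  by (simp add: continuous_intros)

lemma fnorm_zero: "fnorm x (\<lambda>x. 0) = 0"
  by (simp add: fnorm_def ip_zero_left)

lemma fnorm_diff_le: "cont \<phi> \<Longrightarrow> cont \<psi> \<Longrightarrow> \<bar>fnorm x \<phi> - fnorm x \<psi>\<bar> \<le> fnorm x (\<lambda>x. \<phi> x - \<psi> x)"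
  using fnorm_triangle_diff[of \<phi> \<psi> "\<lambda>x. 0" x] fnorm_triangle_diff[of \<psi> \<phi> "\<lambda>x. 0" x]
    fnorm_minus[of \<phi> \<psi> x] by (simp add: abs_le_iff)

lemma fnorm_sum:
  assumes "finite I" "\<And>i. i \<in> I \<Longrightarrow> cont (f i)"
  shows "fnorm x (\<lambda>x. \<Sum>i\<in>I. f i x) \<le> (\<Sum>i\<in>I. fnorm x (f i))"
  using assms
proof (induction I rule: finite_induct)
  case (insert i I)
  then have "fnorm x (\<lambda>x. f i x + (\<Sum>i\<in>I. f i x)) \<le> fnorm x (f i) + fnorm x (\<lambda>x. \<Sum>i\<in>I. f i x)"
    by (intro fnorm_triangle continuous_intros) auto
  then show ?case using insert by simp
qed (simp add: fnorm_zero)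

lemma fnorm_bounded: "cont \<phi> \<Longrightarrow> \<exists>B. \<forall>x. fnorm x \<phi> \<le> B"
proof -
  assume c: "cont \<phi>"
  obtain B where B: "\<And>x. cmod (ip \<phi> \<phi> x) \<le> B"
    using cont_bounded[OF carrier_A_cont[OF ip_carrier[OF c c]]] by blast
  have "fnorm x \<phi> \<le> sqrt B" for x
    unfolding fnorm_def using B[of x] complex_Re_le_cmod order_trans by (intro real_sqrt_le_mono) blast
  then show ?thesis by blast
qed

section \<open>The supremum norm on the coefficient algebra\<close>

lemma anorm_eq: "anorm A a = (SUP x. cmod (a x))"
  by (simp add: invariant_algebra_def)

lemma anorm_ge: "cont a \<Longrightarrow> cmod (a x) \<le> anorm A a"
  unfolding anorm_eq using cont_bounded[of a] by (intro cSUP_upper) (auto simp: bdd_above_def)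

lemma anorm_le: "(\<And>x. cmod (a x) \<le> B) \<Longrightarrow> anorm A a \<le> B"
  unfolding anorm_eq by (intro cSUP_least) auto

end

section \<open>The completed module\<close>

lemma ex_small_multiple:
  fixes e C :: real
  assumes "0 < e" "0 \<le> C"
  shows "\<exists>d>0. C * (d + d) \<le> e"
proof (intro exI[of _ "e / (2 * C + 1)"] conjI)
  have "C * (e / (2 * C + 1) + e / (2 * C + 1)) = e * (2 * C / (2 * C + 1))"
    using assms by simp
  also have "\<dots> \<le> e * 1"
    using assms by (intro mult_left_mono) (auto simp: divide_le_eq_1)
  finally show "C * (e / (2 * C + 1) + e / (2 * C + 1)) \<le> e" by simp
qed (use assms in simp)

context stable_action
begin

abbreviation "P \<equiv> function_module G \<alpha>"
abbreviation "L \<equiv> L_module G \<alpha>"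

lemma P_simps [simp]:
  "carrier P = {\<phi>. cont \<phi>}"
  "madd P \<phi> \<psi> = (\<lambda>x. \<phi> x + \<psi> x)"
  "mscale P c \<phi> = (\<lambda>x. c * \<phi> x)"
  "mact P \<phi> a = (\<lambda>x. \<phi> x * a x)"
  "minner P \<phi> \<psi> = ip \<phi> \<psi>"
  "mdiff P \<phi> \<psi> = (\<lambda>x. \<phi> x - \<psi> x)"
  by (auto simp: function_module_def ip_def orbit_mean_def mdiff_def fun_eq_iff)

lemma fnorm_le_hilbert_norm: "cont \<phi> \<Longrightarrow> fnorm x \<phi> \<le> hilbert_norm A P \<phi>"
  unfolding hilbert_norm_def fnorm_def P_simps
  by (intro real_sqrt_le_mono order_trans[OF complex_Re_le_cmod anorm_ge])
     (simp add: carrier_A_cont ip_carrier)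

lemma hilbert_norm_le:
  assumes c: "cont \<phi>" and B: "0 \<le> B" "\<And>x. fnorm x \<phi> \<le> B"
  shows "hilbert_norm A P \<phi> \<le> B"
proof -
  have "cmod (ip \<phi> \<phi> x) \<le> B\<^sup>2" for x
    using c B(2)[of x] fnorm_nonneg[OF c, of x]
    by (simp add: ip_self_fnorm norm_power power_mono)
  then have "sqrt (anorm A (ip \<phi> \<phi>)) \<le> sqrt (B\<^sup>2)"
    by (intro real_sqrt_le_mono anorm_le)
  then show ?thesis using B(1) by (simp add: hilbert_norm_def)
qed

text \<open>The Cauchy condition of the completion with its norm unfolded into fibre seminorms,
  uniformly in the point. \<open>null_diff\<close> does the same for the equivalence; afterwards
  suprema and square roots can be avoided.\<close>

definition cauchy_fns :: "(nat \<Rightarrow> 'x \<Rightarrow> complex) \<Rightarrow> bool" where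
  "cauchy_fns s \<longleftrightarrow> (\<forall>n. cont (s n)) \<and>
     (\<forall>e>0. \<exists>N. \<forall>m\<ge>N. \<forall>n\<ge>N. \<forall>x. fnorm x (\<lambda>x. s m x - s n x) \<le> e)"

definition null_diff :: "(nat \<Rightarrow> 'x \<Rightarrow> complex) \<Rightarrow> (nat \<Rightarrow> 'x \<Rightarrow> complex) \<Rightarrow> bool" where
  "null_diff s t \<longleftrightarrow> (\<forall>e>0. \<exists>N. \<forall>n\<ge>N. \<forall>x. fnorm x (\<lambda>x. s n x - t n x) \<le> e)"

lemma cauchy_fns_cont: "cauchy_fns s \<Longrightarrow> cont (s n)"
  by (simp add: cauchy_fns_def)

lemma cauchy_seqs_eq: "cauchy_seqs A P = {s. cauchy_fns s}"
proof (rule equalityI; rule subsetI)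
  fix s assume "s \<in> cauchy_seqs A P"
  then have s: "\<And>n. cont (s n)" "\<And>e. e > 0 \<Longrightarrow> \<exists>N. \<forall>m\<ge>N. \<forall>n\<ge>N. hilbert_norm A P (\<lambda>x. s m x - s n x) < e"
    by (auto simp: cauchy_seqs_def)
  have "\<exists>N. \<forall>m\<ge>N. \<forall>n\<ge>N. \<forall>x. fnorm x (\<lambda>x. s m x - s n x) \<le> e" if e: "e > 0" for e
  proof -
    obtain N where N: "\<And>m n. m \<ge> N \<Longrightarrow> n \<ge> N \<Longrightarrow> hilbert_norm A P (\<lambda>x. s m x - s n x) < e"
      using s(2)[OF e] by blast
    have "fnorm x (\<lambda>x. s m x - s n x) \<le> e" if "m \<ge> N" "n \<ge> N" for m n x
      using fnorm_le_hilbert_norm[of "\<lambda>x. s m x - s n x" x] N[OF that] s(1)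
      by (fastforce intro: continuous_intros)
    then show ?thesis by blast
  qed
  then show "s \<in> Collect cauchy_fns" using s(1) by (simp add: cauchy_fns_def)
next
  fix s assume "s \<in> Collect cauchy_fns"
  then have s: "cauchy_fns s" by simp
  have "\<exists>N. \<forall>m\<ge>N. \<forall>n\<ge>N. hilbert_norm A P (\<lambda>x. s m x - s n x) < e" if "e > 0" for e
  proof -
    have "e / 2 > 0" using that by simp
    then obtain N where N: "\<And>m n x. m \<ge> N \<Longrightarrow> n \<ge> N \<Longrightarrow> fnorm x (\<lambda>x. s m x - s n x) \<le> e / 2"
      using s unfolding cauchy_fns_def by meson
    have "hilbert_norm A P (\<lambda>x. s m x - s n x) \<le> e / 2" if "m \<ge> N" "n \<ge> N" for m n
      using N[OF that] \<open>e / 2 > 0\<close> s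
      by (intro hilbert_norm_le continuous_intros cauchy_fns_cont) auto
    then show ?thesis using that by (intro exI[of _ N]) fastforce
  qed
  then show "s \<in> cauchy_seqs A P" using s by (simp add: cauchy_seqs_def cauchy_fns_cont)
qed

lemma null_rel_eq: "null_rel A P = {(s, t). cauchy_fns s \<and> cauchy_fns t \<and> null_diff s t}"
proof -
  have "(\<lambda>n. hilbert_norm A P (\<lambda>x. s n x - t n x)) \<longlonglongrightarrow> 0 \<longleftrightarrow> null_diff s t"
    if s: "cauchy_fns s" "cauchy_fns t" for s t
  proof
    have c: "cont (\<lambda>x. s n x - t n x)" for n
      using s by (intro continuous_intros cauchy_fns_cont)
    assume lim: "(\<lambda>n. hilbert_norm A P (\<lambda>x. s n x - t n x)) \<longlonglongrightarrow> 0"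
    show "null_diff s t"
      unfolding null_diff_def
    proof (intro allI impI)
      fix e :: real assume "e > 0"
      then obtain N where N: "\<And>n. n \<ge> N \<Longrightarrow> \<bar>hilbert_norm A P (\<lambda>x. s n x - t n x)\<bar> < e"
        using LIMSEQ_D[OF lim] by auto
      have "fnorm x (\<lambda>x. s n x - t n x) \<le> e" if "n \<ge> N" for n x
        using fnorm_le_hilbert_norm[OF c, of x n] N[OF that] by linarith
      then show "\<exists>N. \<forall>n\<ge>N. \<forall>x. fnorm x (\<lambda>x. s n x - t n x) \<le> e" by blast
    qed
  next
    have c: "cont (\<lambda>x. s n x - t n x)" for n
      using s by (intro continuous_intros cauchy_fns_cont)
    assume nd: "null_diff s t"
    show "(\<lambda>n. hilbert_norm A P (\<lambda>x. s n x - t n x)) \<longlonglongrightarrow> 0"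
    proof (rule LIMSEQ_I)
      fix e :: real assume "e > 0"
      then have "e / 2 > 0" by simp
      then obtain N where N: "\<And>n x. n \<ge> N \<Longrightarrow> fnorm x (\<lambda>x. s n x - t n x) \<le> e / 2"
        using nd unfolding null_diff_def by meson
      have "norm (hilbert_norm A P (\<lambda>x. s n x - t n x) - 0) < e" if "n \<ge> N" for n
        using hilbert_norm_le[OF c, of "e / 2" n] N[OF that] \<open>e / 2 > 0\<close>
          order_trans[OF fnorm_nonneg[OF c] fnorm_le_hilbert_norm[OF c], of n] by fastforce
      then show "\<exists>N. \<forall>n\<ge>N. norm (hilbert_norm A P (\<lambda>x. s n x - t n x) - 0) < e" by blast
    qed
  qed
  then show ?thesis by (auto simp: null_rel_def cauchy_seqs_eq)
qed

text \<open>Empty unless \<open>s\<close> is Cauchy, because the relation contains only pairs of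
  Cauchy sequences; hence the Cauchy hypotheses in the lemmas on representatives.\<close>

definition cls :: "(nat \<Rightarrow> 'x \<Rightarrow> complex) \<Rightarrow> (nat \<Rightarrow> 'x \<Rightarrow> complex) set" where
  "cls s = null_rel A P `` {s}"

lemma mem_cls: "t \<in> cls s \<longleftrightarrow> cauchy_fns s \<and> cauchy_fns t \<and> null_diff s t"
  by (auto simp: cls_def null_rel_eq)

lemma null_diff_refl: "null_diff s s"
  by (auto simp: null_diff_def fnorm_zero)

lemma null_diff_sym: "cauchy_fns s \<Longrightarrow> cauchy_fns t \<Longrightarrow> null_diff s t \<Longrightarrow> null_diff t s"
  unfolding null_diff_def by (simp add: fnorm_minus[of "t _" "s _"] cauchy_fns_cont)

text \<open>One estimate for all operations on representatives: a result that is Lipschitz in two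
  inputs respects the equivalence. Operations with a single input use it with both inputs
  equal.\<close>

lemma null_diff_dominated:
  assumes C: "C \<ge> 0" and nd: "null_diff s t" "null_diff s' t'"
    and le: "\<And>n x. fnorm x (\<lambda>x. S n x - T n x)
      \<le> C * (fnorm x (\<lambda>x. s n x - t n x) + fnorm x (\<lambda>x. s' n x - t' n x))"
  shows "null_diff S T"
  unfolding null_diff_def
proof (intro allI impI)
  fix e :: real assume "e > 0"
  obtain d where d: "d > 0" and dC: "C * (d + d) \<le> e"
    using ex_small_multiple[OF \<open>e > 0\<close> C] by blast
  obtain N N' where N: "\<And>n x. n \<ge> N \<Longrightarrow> fnorm x (\<lambda>x. s n x - t n x) \<le> d"
    "\<And>n x. n \<ge> N' \<Longrightarrow> fnorm x (\<lambda>x. s' n x - t' n x) \<le> d"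
    using nd d unfolding null_diff_def by meson
  have "fnorm x (\<lambda>x. S n x - T n x) \<le> e" if "n \<ge> max N N'" for n x
  proof -
    have "fnorm x (\<lambda>x. s n x - t n x) + fnorm x (\<lambda>x. s' n x - t' n x) \<le> d + d"
      using N that by (intro add_mono) auto
    then show ?thesis
      using mult_left_mono[OF _ C] le[of x n] dC by (meson order_trans)
  qed
  then show "\<exists>N. \<forall>n\<ge>N. \<forall>x. fnorm x (\<lambda>x. S n x - T n x) \<le> e" by blast
qed

lemma null_diff_trans:
  assumes "cauchy_fns s" "cauchy_fns t" "cauchy_fns u" "null_diff s t" "null_diff t u"
  shows "null_diff s u"
  by (rule null_diff_dominated[OF _ assms(4,5), of 1])
     (use assms in \<open>auto intro!: fnorm_triangle_diff cauchy_fns_cont\<close>)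

lemma cls_eqI:
  assumes "cauchy_fns s" "cauchy_fns t" "null_diff s t"
  shows "cls s = cls t"
proof -
  have "cls s \<subseteq> cls t" if "cauchy_fns s" "cauchy_fns t" "null_diff s t" for s t
  proof
    fix u assume "u \<in> cls s"
    then show "u \<in> cls t"
      using that null_diff_trans[OF that(2,1) _ null_diff_sym[OF that]] by (simp add: mem_cls)
  qed
  from this[OF assms] this[OF assms(2,1) null_diff_sym[OF assms]] show ?thesis by (rule equalityI)
qed

lemma cls_self: "cauchy_fns s \<Longrightarrow> s \<in> cls s"
  by (simp add: mem_cls null_diff_refl)

text \<open>Operations on the completion are unions over all representatives. Once the result is
  independent of the representative, the union of a constant nonempty family collapses to
  it.\<close>

lemma UN_cls_constant:
  assumes "cauchy_fns s" "\<And>s'. s' \<in> cls s \<Longrightarrow> f s' = U"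
  shows "(\<Union>s'\<in>cls s. f s') = U"
proof -
  have "(\<Union>s'\<in>cls s. f s') = (\<Union>s'\<in>cls s. U)" by (rule SUP_cong) (auto simp: assms)
  then show ?thesis using cls_self[OF assms(1)] by auto
qed

section \<open>Elements and operations of the completion\<close>

lemma carrier_L: "carrier L = cls ` {s. cauchy_fns s}"
  by (auto simp: L_module_def hilbert_completion_def quotient_def cauchy_seqs_eq cls_def)

lemma carrier_LE:
  assumes "U \<in> carrier L"
  obtains s where "cauchy_fns s" "U = cls s"
  using assms by (auto simp: carrier_L)

lemma cls_carrier: "cauchy_fns s \<Longrightarrow> cls s \<in> carrier L"
  by (auto simp: carrier_L)

lemma cauchy_fns_dominated:
  assumes C: "C \<ge> 0" and s: "cauchy_fns s" "cauchy_fns s'" and S: "\<And>n. cont (S n)"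
    and le: "\<And>m n x. fnorm x (\<lambda>x. S m x - S n x)
      \<le> C * (fnorm x (\<lambda>x. s m x - s n x) + fnorm x (\<lambda>x. s' m x - s' n x))"
  shows "cauchy_fns S"
  unfolding cauchy_fns_def
proof (intro conjI allI impI S)
  fix e :: real assume "e > 0"
  obtain d where d: "d > 0" and dC: "C * (d + d) \<le> e"
    using ex_small_multiple[OF \<open>e > 0\<close> C] by blast
  obtain N N' where N: "\<And>m n x. m \<ge> N \<Longrightarrow> n \<ge> N \<Longrightarrow> fnorm x (\<lambda>x. s m x - s n x) \<le> d"
    "\<And>m n x. m \<ge> N' \<Longrightarrow> n \<ge> N' \<Longrightarrow> fnorm x (\<lambda>x. s' m x - s' n x) \<le> d"
    using s d unfolding cauchy_fns_def by meson
  have "fnorm x (\<lambda>x. S m x - S n x) \<le> e" if "m \<ge> max N N'" "n \<ge> max N N'" for m n x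
  proof -
    have "fnorm x (\<lambda>x. s m x - s n x) + fnorm x (\<lambda>x. s' m x - s' n x) \<le> d + d"
      using N that by (intro add_mono) auto
    then show ?thesis
      using mult_left_mono[OF _ C] le[of x m n] dC by (meson order_trans)
  qed
  then show "\<exists>N. \<forall>m\<ge>N. \<forall>n\<ge>N. \<forall>x. fnorm x (\<lambda>x. S m x - S n x) \<le> e" by blast
qed

lemma fnorm_add_diff:
  assumes "cont \<phi>" "cont \<phi>'" "cont \<psi>" "cont \<psi>'"
  shows "fnorm x (\<lambda>x. \<phi> x + \<psi> x - (\<phi>' x + \<psi>' x)) \<le> fnorm x (\<lambda>x. \<phi> x - \<phi>' x) + fnorm x (\<lambda>x. \<psi> x - \<psi>' x)"
  using fnorm_triangle[of "\<lambda>x. \<phi> x - \<phi>' x" "\<lambda>x. \<psi> x - \<psi>' x" x] assms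
  by (simp add: continuous_intros add_diff_add)

lemma cauchy_fns_add:
  "cauchy_fns s \<Longrightarrow> cauchy_fns t \<Longrightarrow> cauchy_fns (\<lambda>n x. s n x + t n x)"
  using cauchy_fns_cont[of s] cauchy_fns_cont[of t]
  by (intro cauchy_fns_dominated[of 1 s t "\<lambda>n x. s n x + t n x"])
     (auto intro!: fnorm_add_diff continuous_intros)

lemma null_diff_add:
  "cauchy_fns s \<Longrightarrow> cauchy_fns t \<Longrightarrow> cauchy_fns s' \<Longrightarrow> cauchy_fns t' \<Longrightarrow>
   null_diff s s' \<Longrightarrow> null_diff t t' \<Longrightarrow> null_diff (\<lambda>n x. s n x + t n x) (\<lambda>n x. s' n x + t' n x)"
  using cauchy_fns_cont[of s] cauchy_fns_cont[of t] cauchy_fns_cont[of s'] cauchy_fns_cont[of t']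
  by (intro null_diff_dominated[of 1 s s' t t' "\<lambda>n x. s n x + t n x"]) (auto intro!: fnorm_add_diff)

text \<open>The repeated summand is deliberate: it gives the bound the two-input shape of the
  domination lemmas.\<close>

lemma fnorm_mult_diff_le:
  assumes a: "a \<in> carrier A" and B: "\<And>x. cmod (a x) \<le> B" and c: "cont \<phi>" "cont \<psi>"
  shows "fnorm x (\<lambda>x. \<phi> x * a x - \<psi> x * a x)
    \<le> B * (fnorm x (\<lambda>x. \<phi> x - \<psi> x) + fnorm x (\<lambda>x. \<phi> x - \<psi> x))"
proof -
  have c': "cont (\<lambda>x. \<phi> x - \<psi> x)" using c by (intro continuous_intros)
  have "fnorm x (\<lambda>x. \<phi> x * a x - \<psi> x * a x) = fnorm x (\<lambda>x. \<phi> x - \<psi> x) * cmod (a x)"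
    using fnorm_mult[OF a c', of x] by (simp only: left_diff_distrib)
  also have "\<dots> \<le> fnorm x (\<lambda>x. \<phi> x - \<psi> x) * B"
    by (intro mult_left_mono B fnorm_nonneg c')
  also have "\<dots> \<le> fnorm x (\<lambda>x. \<phi> x - \<psi> x) * B + B * fnorm x (\<lambda>x. \<phi> x - \<psi> x)"
    using fnorm_nonneg[OF c', of x] order_trans[OF norm_ge_zero B] by simp
  finally show ?thesis by (simp add: algebra_simps)
qed

lemma cauchy_fns_mult:
  assumes "a \<in> carrier A" "cauchy_fns s"
  shows "cauchy_fns (\<lambda>n x. s n x * a x)"
proof -
  obtain B where B: "\<And>x. cmod (a x) \<le> B" using cont_bounded[OF carrier_A_cont[OF assms(1)]] by blast
  have "B \<ge> 0" using B norm_ge_zero order_trans by blast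
  then show ?thesis
    using cauchy_fns_cont[OF assms(2)] carrier_A_cont[OF assms(1)]
    by (intro cauchy_fns_dominated[of B s s "\<lambda>n x. s n x * a x"] fnorm_mult_diff_le assms B
        continuous_intros)
qed

lemma null_diff_mult:
  assumes "a \<in> carrier A" "cauchy_fns s" "cauchy_fns t" "null_diff s t"
  shows "null_diff (\<lambda>n x. s n x * a x) (\<lambda>n x. t n x * a x)"
proof -
  obtain B where B: "\<And>x. cmod (a x) \<le> B" using cont_bounded[OF carrier_A_cont[OF assms(1)]] by blast
  have "B \<ge> 0" using B norm_ge_zero order_trans by blast
  then show ?thesis
    by (intro null_diff_dominated[of B s t s t "\<lambda>n x. s n x * a x"] fnorm_mult_diff_le assms B
        cauchy_fns_cont)
qed

lemma const_carrier_A: "(\<lambda>x. c) \<in> carrier A"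
  by (rule carrier_AI) auto

lemma madd_L:
  assumes "cauchy_fns s" "cauchy_fns t"
  shows "madd L (cls s) (cls t) = cls (\<lambda>n x. s n x + t n x)"
proof -
  have "madd L (cls s) (cls t) = (\<Union>s'\<in>cls s. \<Union>t'\<in>cls t. cls (\<lambda>n x. s' n x + t' n x))"
    by (simp add: L_module_def hilbert_completion_def cls_def)
  also have "\<dots> = cls (\<lambda>n x. s n x + t n x)"
  proof (intro UN_cls_constant assms)
    fix s' t' assume "s' \<in> cls s" "t' \<in> cls t"
    then show "cls (\<lambda>n x. s' n x + t' n x) = cls (\<lambda>n x. s n x + t n x)"
      by (intro cls_eqI[symmetric] null_diff_add cauchy_fns_add) (auto simp: mem_cls)
  qed
  finally show ?thesis .
qed

lemma mact_L:
  assumes "a \<in> carrier A" "cauchy_fns s"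
  shows "mact L (cls s) a = cls (\<lambda>n x. s n x * a x)"
proof -
  have "mact L (cls s) a = (\<Union>s'\<in>cls s. cls (\<lambda>n x. s' n x * a x))"
    by (simp add: L_module_def hilbert_completion_def cls_def)
  also have "\<dots> = cls (\<lambda>n x. s n x * a x)"
  proof (intro UN_cls_constant assms)
    fix s' assume "s' \<in> cls s"
    then show "cls (\<lambda>n x. s' n x * a x) = cls (\<lambda>n x. s n x * a x)"
      using assms by (intro cls_eqI[symmetric] null_diff_mult cauchy_fns_mult) (auto simp: mem_cls)
  qed
  finally show ?thesis .
qed

lemma mscale_L:
  assumes "cauchy_fns s"
  shows "mscale L c (cls s) = cls (\<lambda>n x. c * s n x)"
proof -
  have "mscale L c (cls s) = (\<Union>s'\<in>cls s. cls (\<lambda>n x. c * s' n x))"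
    by (simp add: L_module_def hilbert_completion_def cls_def)
  also have "\<dots> = cls (\<lambda>n x. c * s n x)"
  proof (intro UN_cls_constant assms)
    fix s' assume "s' \<in> cls s"
    then show "cls (\<lambda>n x. c * s' n x) = cls (\<lambda>n x. c * s n x)"
      using assms null_diff_mult[OF const_carrier_A, of s s' c] cauchy_fns_mult[OF const_carrier_A, of _ c]
      by (intro cls_eqI[symmetric]) (auto simp: mem_cls mult.commute)
  qed
  finally show ?thesis .
qed

section \<open>The inner product of the completion\<close>

lemma cauchy_fns_bounded:
  assumes s: "cauchy_fns s"
  shows "\<exists>B\<ge>0. \<forall>n x. fnorm x (s n) \<le> B"
proof -
  obtain N where N: "\<And>m n x. m \<ge> N \<Longrightarrow> n \<ge> N \<Longrightarrow> fnorm x (\<lambda>x. s m x - s n x) \<le> 1"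
    using s zero_less_one unfolding cauchy_fns_def by meson
  obtain b where b: "\<And>n x. fnorm x (s n) \<le> b n"
    using fnorm_bounded[OF cauchy_fns_cont[OF s]] by metis
  let ?B = "1 + (\<Sum>n\<le>N. \<bar>b n\<bar>)"
  have small: "fnorm x (s n) \<le> (\<Sum>n\<le>N. \<bar>b n\<bar>)" if "n \<le> N" for n x
    using b[of x n] member_le_sum[of n "{..N}" "\<lambda>n. \<bar>b n\<bar>"] that by simp
  have "fnorm x (s n) \<le> ?B" for n x
  proof (cases "n \<le> N")
    case False
    then show ?thesis
      using fnorm_diff_le[of "s n" "s N" x] N[of n N x] small[of N x] s
      by (simp add: cauchy_fns_cont)
  qed (use small[of n x] in simp)
  moreover have "?B \<ge> 0" by (simp add: sum_nonneg add_nonneg_nonneg)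
  ultimately show ?thesis by blast
qed

lemma ip_diff_bound:
  assumes "cont \<phi>" "cont \<phi>'" "cont \<psi>" "cont \<psi>'"
  shows "cmod (ip \<phi> \<psi> x - ip \<phi>' \<psi>' x) \<le>
    fnorm x (\<lambda>x. \<phi> x - \<phi>' x) * fnorm x \<psi> + fnorm x \<phi>' * fnorm x (\<lambda>x. \<psi> x - \<psi>' x)"
proof -
  have "ip \<phi> \<psi> x - ip \<phi>' \<psi>' x = ip (\<lambda>x. \<phi> x - \<phi>' x) \<psi> x + ip \<phi>' (\<lambda>x. \<psi> x - \<psi>' x) x"
    using assms by (simp add: ip_diff_left ip_diff_right)
  also have "cmod \<dots> \<le> cmod (ip (\<lambda>x. \<phi> x - \<phi>' x) \<psi> x) + cmod (ip \<phi>' (\<lambda>x. \<psi> x - \<psi>' x) x)"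
    by (rule norm_triangle_ineq)
  also have "\<dots> \<le> fnorm x (\<lambda>x. \<phi> x - \<phi>' x) * fnorm x \<psi> + fnorm x \<phi>' * fnorm x (\<lambda>x. \<psi> x - \<psi>' x)"
    using assms by (intro add_mono Cauchy_Schwarz continuous_intros)
  finally show ?thesis .
qed

text \<open>Well-definedness of the completed inner product. Uniform limits of invariant continuous
  functions are again such, and another choice of representatives changes the inner products by a
  uniformly null amount, so one limit serves for all of them.\<close>

lemma ip_uniform_limit:
  assumes s: "cauchy_fns s" and t: "cauchy_fns t"
  shows "\<exists>a\<in>carrier A. \<forall>s'\<in>cls s. \<forall>t'\<in>cls t. uniform_limit UNIV (\<lambda>n. ip (s' n) (t' n)) a sequentially"
proof -
  obtain B where B: "B \<ge> 0" "\<And>n x. fnorm x (s n) \<le> B" using cauchy_fns_bounded[OF s] by blast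
  obtain C where C: "C \<ge> 0" "\<And>n x. fnorm x (t n) \<le> C" using cauchy_fns_bounded[OF t] by blast
  have small: "\<exists>d>0. d * D + E * d < e" if "e > 0" "D \<ge> 0" "E \<ge> 0" for e D E :: real
  proof (intro exI[of _ "e / (D + E + 1)"] conjI)
    show "e / (D + E + 1) > 0" using that by simp
    have "e / (D + E + 1) * D + E * (e / (D + E + 1)) = e * ((D + E) / (D + E + 1))"
      by (simp add: add_divide_distrib distrib_left mult.commute)
    also have "\<dots> < e * 1" using that by (intro mult_strict_left_mono) (auto simp: divide_less_eq_1)
    finally show "e / (D + E + 1) * D + E * (e / (D + E + 1)) < e" by simp
  qed
  have cs: "cont (s n)" "cont (t n)" for n using s t by (auto simp: cauchy_fns_cont)
  have "uniformly_convergent_on UNIV (\<lambda>n. ip (s n) (t n))"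
  proof (intro Cauchy_uniformly_convergent uniformly_Cauchy_onI)
    fix e :: real assume "e > 0"
    obtain d where d: "d > 0" "d * C + B * d < e" using small[OF \<open>e > 0\<close> C(1) B(1)] by blast
    obtain N N' where N: "\<And>m n x. m \<ge> N \<Longrightarrow> n \<ge> N \<Longrightarrow> fnorm x (\<lambda>x. s m x - s n x) \<le> d"
      "\<And>m n x. m \<ge> N' \<Longrightarrow> n \<ge> N' \<Longrightarrow> fnorm x (\<lambda>x. t m x - t n x) \<le> d"
      using s t d(1) unfolding cauchy_fns_def by meson
    have "dist (ip (s m) (t m) x) (ip (s n) (t n) x) < e"
      if "m \<ge> max N N'" "n \<ge> max N N'" for m n x
    proof -
      have "fnorm x (\<lambda>x. s m x - s n x) * fnorm x (t m) + fnorm x (s n) * fnorm x (\<lambda>x. t m x - t n x)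
          \<le> d * C + B * d"
        using N that B C d cs by (intro add_mono mult_mono fnorm_nonneg continuous_intros) auto
      then show ?thesis
        using ip_diff_bound[OF cs(1)[of m] cs(1)[of n] cs(2)[of m] cs(2)[of n], of x] d(2)
        by (simp add: dist_norm)
    qed
    then show "\<exists>M. \<forall>x\<in>UNIV. \<forall>m\<ge>M. \<forall>n\<ge>M. dist (ip (s m) (t m) x) (ip (s n) (t n) x) < e" by blast
  qed
  then obtain a where a: "uniform_limit UNIV (\<lambda>n. ip (s n) (t n)) a sequentially"
    by (auto simp: uniformly_convergent_on_def)
  have pt: "(\<lambda>n. ip (s n) (t n) x) \<longlonglongrightarrow> a x" for x
    using tendsto_uniform_limitI[OF a, of x] by simp
  have "a \<in> carrier A"
  proof (rule carrier_AI)
    show "cont a"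
      by (rule uniform_limit_theorem[OF _ a]) (auto simp: carrier_A_cont ip_carrier cs)
    fix g x assume g: "g \<in> carrier G"
    have "(\<lambda>n. ip (s n) (t n) x) \<longlonglongrightarrow> a (\<alpha> g x)"
      using pt[of "\<alpha> g x"] g by (simp add: carrier_A_inv[OF ip_carrier[OF cs(1) cs(2)]])
    then show "a (\<alpha> g x) = a x" using pt[of x] LIMSEQ_unique by blast
  qed
  moreover have "uniform_limit UNIV (\<lambda>n. ip (s' n) (t' n)) a sequentially"
    if s': "s' \<in> cls s" and t': "t' \<in> cls t" for s' t'
  proof -
    have s'c: "cauchy_fns s'" "null_diff s s'" "cauchy_fns t'" "null_diff t t'"
      using s' t' by (auto simp: mem_cls)
    obtain C' where C': "C' \<ge> 0" "\<And>n x. fnorm x (t' n) \<le> C'"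
      using cauchy_fns_bounded[OF s'c(3)] by blast
    have cs': "cont (s' n)" "cont (t' n)" for n using s'c by (auto simp: cauchy_fns_cont)
    have diff: "uniform_limit UNIV (\<lambda>n x. ip (s n) (t n) x - ip (s' n) (t' n) x) (\<lambda>x. 0) sequentially"
    proof (rule uniform_limitI)
      fix e :: real assume "e > 0"
      obtain B' where B': "B' \<ge> 0" "\<And>n x. fnorm x (s' n) \<le> B'"
        using cauchy_fns_bounded[OF s'c(1)] by blast
      obtain d where d: "d > 0" "d * C + B' * d < e" using small[OF \<open>e > 0\<close> C(1) B'(1)] by blast
      obtain N N' where N: "\<And>n x. n \<ge> N \<Longrightarrow> fnorm x (\<lambda>x. s n x - s' n x) \<le> d"
        "\<And>n x. n \<ge> N' \<Longrightarrow> fnorm x (\<lambda>x. t n x - t' n x) \<le> d"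
        using s'c(2,4) d(1) unfolding null_diff_def by meson
      have "dist (ip (s n) (t n) x - ip (s' n) (t' n) x) 0 < e" if "n \<ge> max N N'" for n x
      proof -
        have "fnorm x (\<lambda>x. s n x - s' n x) * fnorm x (t n) + fnorm x (s' n) * fnorm x (\<lambda>x. t n x - t' n x)
            \<le> d * C + B' * d"
          using N that B' C d cs cs' by (intro add_mono mult_mono fnorm_nonneg continuous_intros) auto
        then show ?thesis
          using ip_diff_bound[OF cs(1)[of n] cs'(1)[of n] cs(2)[of n] cs'(2)[of n], of x] d(2)
          by (simp add: dist_norm)
      qed
      then show "\<forall>\<^sub>F n in sequentially. \<forall>x\<in>UNIV. dist (ip (s n) (t n) x - ip (s' n) (t' n) x) 0 < e"
        unfolding eventually_sequentially by blast
    qed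
    show ?thesis
      using uniform_limit_minus[OF a diff] by simp
  qed
  ultimately show ?thesis by blast
qed

text \<open>Subtraction in a ring record is defined through a description of the additive inverse;
  it is evaluated here directly on the concrete operations.\<close>

lemma a_minus_A:
  assumes "a \<in> carrier A"
  shows "b \<ominus>\<^bsub>A\<^esub> a = (\<lambda>x. b x - a x)"
proof -
  have "\<ominus>\<^bsub>A\<^esub> a = (\<lambda>x. - a x)"
    unfolding a_inv_def m_inv_def
  proof (rule the_equality)
    show "(\<lambda>x. - a x) \<in> carrier (add_monoid A) \<and> a \<otimes>\<^bsub>add_monoid A\<^esub> (\<lambda>x. - a x) = \<one>\<^bsub>add_monoid A\<^esub> \<and>
        (\<lambda>x. - a x) \<otimes>\<^bsub>add_monoid A\<^esub> a = \<one>\<^bsub>add_monoid A\<^esub>"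
      using assms by (auto simp: invariant_algebra_def intro!: continuous_intros)
    fix y assume "y \<in> carrier (add_monoid A) \<and> a \<otimes>\<^bsub>add_monoid A\<^esub> y = \<one>\<^bsub>add_monoid A\<^esub> \<and>
        y \<otimes>\<^bsub>add_monoid A\<^esub> a = \<one>\<^bsub>add_monoid A\<^esub>"
    then have "(\<lambda>x. a x + y x) = (\<lambda>x. 0)" by (simp add: invariant_algebra_def)
    then have "a x + y x = 0" for x by (rule fun_cong)
    then show "y = (\<lambda>x. - a x)" by (intro ext) (simp add: eq_neg_iff_add_eq_0 add.commute)
  qed
  then show ?thesis by (simp add: a_minus_def) (simp add: invariant_algebra_def)
qed

lemma minner_L:
  assumes s: "cauchy_fns s" and t: "cauchy_fns t"
  shows "minner L (cls s) (cls t) \<in> carrier A"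
    and "(\<lambda>n. ip (s n) (t n) x) \<longlonglongrightarrow> minner L (cls s) (cls t) x"
proof -
  obtain a where a: "a \<in> carrier A"
    "\<And>s' t'. s' \<in> cls s \<Longrightarrow> t' \<in> cls t \<Longrightarrow> uniform_limit UNIV (\<lambda>n. ip (s' n) (t' n)) a sequentially"
    using ip_uniform_limit[OF s t] by blast
  \<comment> \<open>Norm convergence in the algebra is uniform convergence on the space; this
    identifies the limit described in the completion with the uniform limit.\<close>
  have iff: "(\<lambda>n. anorm A (ip (s' n) (t' n) \<ominus>\<^bsub>A\<^esub> b)) \<longlonglongrightarrow> 0 \<longleftrightarrow>
      uniform_limit UNIV (\<lambda>n. ip (s' n) (t' n)) b sequentially"
    if b: "b \<in> carrier A" and c: "cauchy_fns s'" "cauchy_fns t'" for b s' t'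
  proof -
    have cc: "cont (\<lambda>x. ip (s' n) (t' n) x - b x)" for n
      using b c by (intro continuous_intros carrier_A_cont ip_carrier cauchy_fns_cont)
    show ?thesis
      unfolding a_minus_A[OF b]
    proof
      assume lim: "(\<lambda>n. anorm A (\<lambda>x. ip (s' n) (t' n) x - b x)) \<longlonglongrightarrow> 0"
      show "uniform_limit UNIV (\<lambda>n. ip (s' n) (t' n)) b sequentially"
      proof (rule uniform_limitI)
        fix e :: real assume "e > 0"
        with lim have "\<forall>\<^sub>F n in sequentially. anorm A (\<lambda>x. ip (s' n) (t' n) x - b x) < e"
          by (rule order_tendstoD)
        then show "\<forall>\<^sub>F n in sequentially. \<forall>x\<in>UNIV. dist (ip (s' n) (t' n) x) (b x) < e"
        proof eventually_elim
          case (elim n)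
          then show ?case using anorm_ge[OF cc[of n]] by (auto simp: dist_norm intro: le_less_trans)
        qed
      qed
    next
      assume lim: "uniform_limit UNIV (\<lambda>n. ip (s' n) (t' n)) b sequentially"
      show "(\<lambda>n. anorm A (\<lambda>x. ip (s' n) (t' n) x - b x)) \<longlonglongrightarrow> 0"
      proof (rule tendstoI)
        fix e :: real assume "e > 0"
        then have "e / 2 > 0" by simp
        from uniform_limitD[OF lim this]
        show "\<forall>\<^sub>F n in sequentially. dist (anorm A (\<lambda>x. ip (s' n) (t' n) x - b x)) 0 < e"
        proof eventually_elim
          case (elim n)
          then have "anorm A (\<lambda>x. ip (s' n) (t' n) x - b x) \<le> e / 2"
            by (intro anorm_le) (auto simp: dist_norm less_imp_le)
          moreover have "0 \<le> anorm A (\<lambda>x. ip (s' n) (t' n) x - b x)"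
            using order_trans[OF norm_ge_zero anorm_ge[OF cc[of n]]] .
          ultimately show ?case using \<open>e > 0\<close> by simp
        qed
      qed
    qed
  qed
  have "minner L (cls s) (cls t) = (THE a. a \<in> carrier A \<and>
      (\<forall>s'\<in>cls s. \<forall>t'\<in>cls t. (\<lambda>n. anorm A (ip (s' n) (t' n) \<ominus>\<^bsub>A\<^esub> a)) \<longlonglongrightarrow> 0))"
    by (simp add: L_module_def hilbert_completion_def)
  also have "\<dots> = a"
  proof (rule the_equality)
    show "a \<in> carrier A \<and> (\<forall>s'\<in>cls s. \<forall>t'\<in>cls t. (\<lambda>n. anorm A (ip (s' n) (t' n) \<ominus>\<^bsub>A\<^esub> a)) \<longlonglongrightarrow> 0)"
      using a iff by (simp add: mem_cls)
    fix b assume b: "b \<in> carrier A \<and>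
      (\<forall>s'\<in>cls s. \<forall>t'\<in>cls t. (\<lambda>n. anorm A (ip (s' n) (t' n) \<ominus>\<^bsub>A\<^esub> b)) \<longlonglongrightarrow> 0)"
    then have "uniform_limit UNIV (\<lambda>n. ip (s n) (t n)) b sequentially"
      using iff[OF _ s t] cls_self[OF s] cls_self[OF t] by blast
    then show "b = a"
      using a(2)[OF cls_self[OF s] cls_self[OF t]]
      by (intro ext LIMSEQ_unique[OF tendsto_uniform_limitI tendsto_uniform_limitI]) auto
  qed
  finally have eq: "minner L (cls s) (cls t) = a" .
  show "minner L (cls s) (cls t) \<in> carrier A" using a eq by simp
  show "(\<lambda>n. ip (s n) (t n) x) \<longlonglongrightarrow> minner L (cls s) (cls t) x"
    using tendsto_uniform_limitI[OF a(2)[OF cls_self[OF s] cls_self[OF t]], of x] eq by simp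
qed

end

section \<open>The dual and the bidual module\<close>

context stable_action
begin

abbreviation "N \<equiv> underlying_normed A L"
abbreviation "D \<equiv> dual_module A N"
abbreviation "DD \<equiv> dual_module A D"

lemma N_simps [simp]:
  "carrier N = carrier L" "madd N = madd L" "mscale N = mscale L" "mact N = mact L"
  "mnorm N = hilbert_norm A L"
  by (simp_all add: underlying_normed_def)

lemma A_simps [simp]:
  "a \<oplus>\<^bsub>A\<^esub> b = (\<lambda>x. a x + b x)" "a \<otimes>\<^bsub>A\<^esub> b = (\<lambda>x. a x * b x)"
  "ascale A c a = (\<lambda>x. c * a x)" "astar A a = (\<lambda>x. cnj (a x))"
  by (simp_all add: invariant_algebra_def)

lemma A_mult: "a \<in> carrier A \<Longrightarrow> b \<in> carrier A \<Longrightarrow> (\<lambda>x. a x * b x) \<in> carrier A"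
  by (intro carrier_AI continuous_intros) (auto simp: carrier_A_cont carrier_A_inv)

lemma A_add: "a \<in> carrier A \<Longrightarrow> b \<in> carrier A \<Longrightarrow> (\<lambda>x. a x + b x) \<in> carrier A"
  by (intro carrier_AI continuous_intros) (auto simp: carrier_A_cont carrier_A_inv)

lemma A_cnj: "a \<in> carrier A \<Longrightarrow> (\<lambda>x. cnj (a x)) \<in> carrier A"
  by (intro carrier_AI continuous_intros) (auto simp: carrier_A_cont carrier_A_inv)

lemma anorm_nonneg: "cont a \<Longrightarrow> 0 \<le> anorm A a"
  using order_trans[OF norm_ge_zero anorm_ge] .

section \<open>The image of C(X) and the module rules in the completion\<close>

definition iota :: "('x \<Rightarrow> complex) \<Rightarrow> (nat \<Rightarrow> 'x \<Rightarrow> complex) set" where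
  "iota \<phi> = cls (\<lambda>n. \<phi>)"

lemma cauchy_fns_const: "cont \<phi> \<Longrightarrow> cauchy_fns (\<lambda>n. \<phi>)"
  by (auto simp: cauchy_fns_def fnorm_zero)

lemma iota_carrier: "cont \<phi> \<Longrightarrow> iota \<phi> \<in> carrier L"
  unfolding iota_def by (intro cls_carrier cauchy_fns_const)

lemma madd_carrier: "U \<in> carrier L \<Longrightarrow> V \<in> carrier L \<Longrightarrow> madd L U V \<in> carrier L"
  by (auto elim!: carrier_LE simp: madd_L cauchy_fns_add cls_carrier)

lemma mact_carrier: "U \<in> carrier L \<Longrightarrow> a \<in> carrier A \<Longrightarrow> mact L U a \<in> carrier L"
  by (auto elim!: carrier_LE simp: mact_L cauchy_fns_mult cls_carrier)

lemma cauchy_fns_scale: "cauchy_fns s \<Longrightarrow> cauchy_fns (\<lambda>n x. c * s n x)"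
  using cauchy_fns_mult[OF const_carrier_A, of s c] by (simp add: mult.commute)

lemma mscale_carrier: "U \<in> carrier L \<Longrightarrow> mscale L c U \<in> carrier L"
  by (auto elim!: carrier_LE simp: mscale_L cauchy_fns_scale cls_carrier)

lemma minner_carrier: "U \<in> carrier L \<Longrightarrow> V \<in> carrier L \<Longrightarrow> minner L U V \<in> carrier A"
  by (auto elim!: carrier_LE simp: minner_L(1))

lemma minner_add_left:
  assumes "U \<in> carrier L" "U' \<in> carrier L" "V \<in> carrier L"
  shows "minner L (madd L U U') V x = minner L U V x + minner L U' V x"
proof -
  obtain s s' t where c: "cauchy_fns s" "cauchy_fns s'" "cauchy_fns t"
    and eq: "U = cls s" "U' = cls s'" "V = cls t"
    using assms by (auto elim!: carrier_LE)
  have "(\<lambda>n. ip (\<lambda>x. s n x + s' n x) (t n) x) \<longlonglongrightarrow> minner L (cls s) (cls t) x + minner L (cls s') (cls t) x"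
    using tendsto_add[OF minner_L(2)[OF c(1,3)] minner_L(2)[OF c(2,3)], of x x] c
    by (simp add: ip_add_left cauchy_fns_cont)
  then show ?thesis
    using LIMSEQ_unique[OF minner_L(2)[OF cauchy_fns_add[OF c(1,2)] c(3)]]
    by (simp add: eq madd_L c)
qed

lemma minner_act_left:
  assumes "U \<in> carrier L" "a \<in> carrier A" "V \<in> carrier L"
  shows "minner L (mact L U a) V x = minner L U V x * a x"
proof -
  obtain s t where c: "cauchy_fns s" "cauchy_fns t" and eq: "U = cls s" "V = cls t"
    using assms by (auto elim!: carrier_LE)
  have "(\<lambda>n. ip (\<lambda>x. s n x * a x) (t n) x) \<longlonglongrightarrow> minner L (cls s) (cls t) x * a x"
    using tendsto_mult_right[OF minner_L(2)[OF c], of x "a x"] c assms(2)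
    by (simp add: ip_mult_left cauchy_fns_cont)
  then show ?thesis
    using LIMSEQ_unique[OF minner_L(2)[OF cauchy_fns_mult[OF assms(2) c(1)] c(2)]]
    by (simp add: eq mact_L assms(2) c)
qed

lemma minner_scale_left:
  assumes "U \<in> carrier L" "V \<in> carrier L"
  shows "minner L (mscale L c U) V x = c * minner L U V x"
proof -
  obtain s t where c: "cauchy_fns s" "cauchy_fns t" and eq: "U = cls s" "V = cls t"
    using assms by (auto elim!: carrier_LE)
  have "mscale L c U = mact L U (\<lambda>x. c)"
    using c by (simp add: eq mscale_L mact_L const_carrier_A mult.commute)
  then show ?thesis
    using minner_act_left[OF assms(1) const_carrier_A assms(2)] by simp
qed

lemma minner_cnj:
  assumes "U \<in> carrier L" "V \<in> carrier L"
  shows "minner L V U x = cnj (minner L U V x)"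
proof -
  obtain s t where c: "cauchy_fns s" "cauchy_fns t" and eq: "U = cls s" "V = cls t"
    using assms by (auto elim!: carrier_LE)
  have "(\<lambda>n. cnj (ip (s n) (t n) x)) \<longlonglongrightarrow> cnj (minner L (cls s) (cls t) x)"
    using minner_L(2)[OF c] by (intro tendsto_cnj)
  moreover have "cnj (ip (s n) (t n) x) = ip (t n) (s n) x" for n
    using c by (intro ip_cnj[symmetric] cauchy_fns_cont)
  ultimately show ?thesis
    using LIMSEQ_unique[OF minner_L(2)[OF c(2,1), of x]] by (simp add: eq)
qed

lemma fnorm_limit:
  assumes "cauchy_fns s"
  shows "(\<lambda>n. fnorm x (s n)) \<longlonglongrightarrow> sqrt (Re (minner L (cls s) (cls s) x))"
  unfolding fnorm_def by (intro tendsto_intros minner_L(2) assms)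

lemma sqrt_minner_le_hilbert_norm:
  assumes "U \<in> carrier L"
  shows "sqrt (Re (minner L U U x)) \<le> hilbert_norm A L U"
  unfolding hilbert_norm_def
  by (intro real_sqrt_le_mono order_trans[OF complex_Re_le_cmod anorm_ge] carrier_A_cont
      minner_carrier assms)

lemma hilbert_norm_L_nonneg:
  assumes "U \<in> carrier L"
  shows "0 \<le> hilbert_norm A L U"
  unfolding hilbert_norm_def
  by (intro real_sqrt_ge_zero anorm_nonneg carrier_A_cont minner_carrier assms)

text \<open>Only a tail of the representative has to be bounded; this is what makes the difference
  between a class and a late term of its sequence small.\<close>

lemma hilbert_norm_L_le:
  assumes s: "cauchy_fns s" and B: "0 \<le> B" "\<And>n x. n \<ge> M \<Longrightarrow> fnorm x (s n) \<le> B"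
  shows "hilbert_norm A L (cls s) \<le> B"
proof -
  have "cmod (minner L (cls s) (cls s) x) \<le> B\<^sup>2" for x
  proof (rule LIMSEQ_le_const2[OF tendsto_norm[OF minner_L(2)[OF s s]]])
    have "cmod (ip (s n) (s n) x) \<le> B\<^sup>2" if "n \<ge> M" for n
      using B(2)[OF that, of x] fnorm_nonneg[OF cauchy_fns_cont[OF s], of x n]
      by (simp add: ip_self_fnorm cauchy_fns_cont[OF s] norm_power power_mono)
    then show "\<exists>M. \<forall>n\<ge>M. cmod (ip (s n) (s n) x) \<le> B\<^sup>2" by blast
  qed
  then have "sqrt (anorm A (minner L (cls s) (cls s))) \<le> sqrt (B\<^sup>2)"
    by (intro real_sqrt_le_mono anorm_le)
  then show ?thesis using B(1) by (simp add: hilbert_norm_def)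
qed

lemma cmod_minner_le:
  assumes "U \<in> carrier L" "V \<in> carrier L"
  shows "cmod (minner L U V x) \<le> hilbert_norm A L U * hilbert_norm A L V"
proof -
  obtain s t where c: "cauchy_fns s" "cauchy_fns t" and eq: "U = cls s" "V = cls t"
    using assms by (auto elim!: carrier_LE)
  have "cmod (minner L U V x) \<le> sqrt (Re (minner L U U x)) * sqrt (Re (minner L V V x))"
    unfolding eq
    by (rule LIMSEQ_le[OF tendsto_norm[OF minner_L(2)[OF c]] tendsto_mult[OF fnorm_limit[OF c(1)] fnorm_limit[OF c(2)]]])
       (use c in \<open>auto intro!: Cauchy_Schwarz cauchy_fns_cont\<close>)
  also have "\<dots> \<le> hilbert_norm A L U * hilbert_norm A L V"
  proof (intro mult_mono sqrt_minner_le_hilbert_norm hilbert_norm_L_nonneg assms)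
    show "0 \<le> sqrt (Re (minner L V V x))"
      unfolding eq by (rule LIMSEQ_le_const[OF fnorm_limit[OF c(2)]])
        (use c in \<open>auto intro!: fnorm_nonneg cauchy_fns_cont\<close>)
  qed
  finally show ?thesis .
qed

section \<open>Functionals on the module and on its dual\<close>

lemma dualD:
  assumes "f \<in> carrier D"
  shows "f \<in> extensional (carrier L)"
    and "\<And>U. U \<in> carrier L \<Longrightarrow> f U \<in> carrier A"
    and "\<And>U V. U \<in> carrier L \<Longrightarrow> V \<in> carrier L \<Longrightarrow> f (madd L U V) = (\<lambda>x. f U x + f V x)"
    and "\<And>c U. U \<in> carrier L \<Longrightarrow> f (mscale L c U) = (\<lambda>x. c * f U x)"
    and "\<And>U a. U \<in> carrier L \<Longrightarrow> a \<in> carrier A \<Longrightarrow> f (mact L U a) = (\<lambda>x. f U x * a x)"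
  using assms by (auto simp: dual_module_def PiE_def)

text \<open>Passes to values at points and normalises the constant, which the definition of the dual
  allows to be any real number.\<close>

lemma dual_bound:
  assumes f: "f \<in> carrier D"
  shows "\<exists>C\<ge>0. \<forall>U\<in>carrier L. \<forall>x. cmod (f U x) \<le> C * hilbert_norm A L U"
proof -
  have "\<exists>C. \<forall>U\<in>carrier L. anorm A (f U) \<le> C * hilbert_norm A L U"
    using f by (simp add: dual_module_def)
  then obtain C where C: "\<And>U. U \<in> carrier L \<Longrightarrow> anorm A (f U) \<le> C * hilbert_norm A L U"
    by blast
  have "cmod (f U x) \<le> \<bar>C\<bar> * hilbert_norm A L U" if U: "U \<in> carrier L" for U x
  proof -
    have "cmod (f U x) \<le> anorm A (f U)"
      by (intro anorm_ge carrier_A_cont dualD(2)[OF f U])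
    also have "\<dots> \<le> C * hilbert_norm A L U" by (rule C[OF U])
    also have "\<dots> \<le> \<bar>C\<bar> * hilbert_norm A L U"
      by (intro mult_right_mono hilbert_norm_L_nonneg U) simp
    finally show ?thesis .
  qed
  then show ?thesis by (intro exI[of _ "\<bar>C\<bar>"]) simp
qed

lemma dualI:
  assumes "\<And>U. U \<in> carrier L \<Longrightarrow> f U \<in> carrier A"
    and "\<And>U V x. U \<in> carrier L \<Longrightarrow> V \<in> carrier L \<Longrightarrow> f (madd L U V) x = f U x + f V x"
    and "\<And>c U x. U \<in> carrier L \<Longrightarrow> f (mscale L c U) x = c * f U x"
    and "\<And>U a x. U \<in> carrier L \<Longrightarrow> a \<in> carrier A \<Longrightarrow> f (mact L U a) x = f U x * a x"
    and "\<And>U x. U \<in> carrier L \<Longrightarrow> cmod (f U x) \<le> C * hilbert_norm A L U"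
  shows "restrict f (carrier L) \<in> carrier D"
proof -
  have "\<forall>U\<in>carrier L. anorm A (f U) \<le> C * hilbert_norm A L U"
    using assms(5) by (intro ballI anorm_le)
  then show ?thesis
    using assms(1-4)
    by (auto simp: dual_module_def madd_carrier mscale_carrier mact_carrier fun_eq_iff)
qed

lemma D_simps [simp]:
  "madd D f f' = (\<lambda>U\<in>carrier L. \<lambda>x. f U x + f' U x)"
  "mscale D c f = (\<lambda>U\<in>carrier L. \<lambda>x. cnj c * f U x)"
  "mact D f a = (\<lambda>U\<in>carrier L. \<lambda>x. cnj (a x) * f U x)"
  by (simp_all add: dual_module_def)

lemma mnorm_D: "mnorm D f = (SUP U\<in>{U \<in> carrier L. hilbert_norm A L U \<le> 1}. anorm A (f U))"
  by (simp add: dual_module_def)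

text \<open>A witness that the unit ball is nonempty, as the suprema in the dual norm
  require.\<close>

lemma iota_zero_unit_ball: "iota (\<lambda>x. 0) \<in> {U \<in> carrier L. hilbert_norm A L U \<le> 1}"
  using hilbert_norm_L_le[OF cauchy_fns_const, of "\<lambda>x. 0" 1]
  by (auto simp: iota_carrier fnorm_zero) (simp add: iota_def)

lemma anorm_le_mnorm_D:
  assumes f: "f \<in> carrier D" and U: "U \<in> carrier L" "hilbert_norm A L U \<le> 1"
  shows "anorm A (f U) \<le> mnorm D f"
proof -
  obtain C where C: "C \<ge> 0" "\<And>U x. U \<in> carrier L \<Longrightarrow> cmod (f U x) \<le> C * hilbert_norm A L U"
    using dual_bound[OF f] by blast
  have "anorm A (f U) \<le> C" if "U \<in> carrier L" "hilbert_norm A L U \<le> 1" for U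
  proof (rule anorm_le)
    fix x
    have "cmod (f U x) \<le> C * 1"
      by (rule order_trans[OF C(2)[OF that(1)] mult_left_mono[OF that(2) C(1)]])
    then show "cmod (f U x) \<le> C" by simp
  qed
  then have "bdd_above ((\<lambda>U. anorm A (f U)) ` {U \<in> carrier L. hilbert_norm A L U \<le> 1})"
    by (intro bdd_aboveI2[where M = C]) auto
  then show ?thesis
    unfolding mnorm_D using U by (intro cSUP_upper) auto
qed

lemma mnorm_D_nonneg:
  assumes f: "f \<in> carrier D" shows "0 \<le> mnorm D f"
  using iota_zero_unit_ball
  by (intro order_trans[OF anorm_nonneg anorm_le_mnorm_D[OF f]] carrier_A_cont dualD(2)[OF f]) auto

text \<open>Scalars and algebra elements act on the dual through their conjugates. With respect to
  plain pointwise multiplication of \<open>f\<close>, the map \<open>F\<close> is therefore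
  conjugate linear.\<close>

lemma bidualD:
  assumes "F \<in> carrier DD"
  shows "F \<in> extensional (carrier D)"
    and "\<And>f. f \<in> carrier D \<Longrightarrow> F f \<in> carrier A"
    and "\<And>f f'. f \<in> carrier D \<Longrightarrow> f' \<in> carrier D \<Longrightarrow>
      F (\<lambda>U\<in>carrier L. \<lambda>x. f U x + f' U x) = (\<lambda>x. F f x + F f' x)"
    and "\<And>c f. f \<in> carrier D \<Longrightarrow> F (\<lambda>U\<in>carrier L. \<lambda>x. cnj c * f U x) = (\<lambda>x. c * F f x)"
    and "\<And>f a. f \<in> carrier D \<Longrightarrow> a \<in> carrier A \<Longrightarrow>
      F (\<lambda>U\<in>carrier L. \<lambda>x. cnj (a x) * f U x) = (\<lambda>x. F f x * a x)"
  using assms unfolding dual_module_def[of A D] by (auto simp: PiE_def)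

lemma bidual_bound:
  assumes F: "F \<in> carrier DD"
  shows "\<exists>C\<ge>0. \<forall>f\<in>carrier D. \<forall>x. cmod (F f x) \<le> C * mnorm D f"
proof -
  have "\<exists>C. \<forall>f\<in>carrier D. anorm A (F f) \<le> C * mnorm D f"
    using F unfolding dual_module_def[of A D] by simp
  then obtain C where C: "\<And>f. f \<in> carrier D \<Longrightarrow> anorm A (F f) \<le> C * mnorm D f"
    by blast
  have "cmod (F f x) \<le> \<bar>C\<bar> * mnorm D f" if f: "f \<in> carrier D" for f x
  proof -
    have "cmod (F f x) \<le> anorm A (F f)"
      by (intro anorm_ge carrier_A_cont bidualD(2)[OF F f])
    also have "\<dots> \<le> C * mnorm D f" by (rule C[OF f])
    also have "\<dots> \<le> \<bar>C\<bar> * mnorm D f"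
      by (intro mult_right_mono mnorm_D_nonneg f) simp
    finally show ?thesis .
  qed
  then show ?thesis by (intro exI[of _ "\<bar>C\<bar>"]) simp
qed

text \<open>The multiplier \<open>h\<close> itself may be discontinuous; only its products with the
  values of \<open>f\<close> must be continuous and invariant. This is the door through which
  oscillating multipliers enter the dual.\<close>

lemma dual_multiplier:
  assumes f: "f \<in> carrier D" and h: "\<And>x. cmod (h x) \<le> B"
    and hf: "\<And>U. U \<in> carrier L \<Longrightarrow> (\<lambda>x. h x * f U x) \<in> carrier A"
  shows "(\<lambda>U\<in>carrier L. \<lambda>x. h x * f U x) \<in> carrier D"
proof -
  obtain C where C: "C \<ge> 0" "\<And>U x. U \<in> carrier L \<Longrightarrow> cmod (f U x) \<le> C * hilbert_norm A L U"
    using dual_bound[OF f] by blast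
  have "0 \<le> B" using order_trans[OF norm_ge_zero h] .
  then have "cmod (h x * f U x) \<le> (B * C) * hilbert_norm A L U" if "U \<in> carrier L" for U x
    using mult_mono[OF h[of x] C(2)[OF that, of x]] by (simp add: norm_mult mult.assoc)
  then show ?thesis
    by (intro dualI[where C = "B * C"] hf) (auto simp: dualD[OF f] algebra_simps)
qed

lemma dual_mult:
  assumes f: "f \<in> carrier D" and a: "a \<in> carrier A"
  shows "(\<lambda>U\<in>carrier L. \<lambda>x. a x * f U x) \<in> carrier D"
proof -
  obtain B where "\<And>x. cmod (a x) \<le> B" using cont_bounded[OF carrier_A_cont[OF a]] by blast
  then show ?thesis by (intro dual_multiplier[OF f] A_mult a dualD(2)[OF f])
qed

lemma dual_add:
  assumes f: "f \<in> carrier D" and f': "f' \<in> carrier D"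
  shows "(\<lambda>U\<in>carrier L. \<lambda>x. f U x + f' U x) \<in> carrier D"
proof -
  obtain C where C: "\<And>U x. U \<in> carrier L \<Longrightarrow> cmod (f U x) \<le> C * hilbert_norm A L U"
    using dual_bound[OF f] by blast
  obtain C' where C': "\<And>U x. U \<in> carrier L \<Longrightarrow> cmod (f' U x) \<le> C' * hilbert_norm A L U"
    using dual_bound[OF f'] by blast
  have "cmod (f U x + f' U x) \<le> (C + C') * hilbert_norm A L U" if "U \<in> carrier L" for U x
    using norm_triangle_mono[OF C[OF that] C'[OF that]] by (simp add: distrib_right)
  then show ?thesis
    by (intro dualI[where C = "C + C'"]) (auto simp: dualD[OF f] dualD[OF f'] A_add distrib_left distrib_right)
qed

lemma bidual_mult:
  assumes F: "F \<in> carrier DD" and f: "f \<in> carrier D" and a: "a \<in> carrier A"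
  shows "F (\<lambda>U\<in>carrier L. \<lambda>x. a x * f U x) x = F f x * cnj (a x)"
  using bidualD(5)[OF F f A_cnj[OF a]] by simp

section \<open>Functionals given by inner products\<close>

definition riesz :: "(nat \<Rightarrow> 'x \<Rightarrow> complex) set \<Rightarrow> (nat \<Rightarrow> 'x \<Rightarrow> complex) set \<Rightarrow> 'x \<Rightarrow> complex" where
  "riesz V = (\<lambda>U\<in>carrier L. minner L U V)"

lemma riesz_dual:
  assumes V: "V \<in> carrier L"
  shows "riesz V \<in> carrier D"
  unfolding riesz_def
proof (rule dualI)
  show "cmod (minner L U V x) \<le> hilbert_norm A L V * hilbert_norm A L U" if "U \<in> carrier L" for U x
    using cmod_minner_le[OF that V] by (simp add: mult.commute)
qed (use V in \<open>simp_all add: minner_carrier minner_add_left minner_scale_left minner_act_left\<close>)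

lemma mnorm_riesz_le:
  assumes V: "V \<in> carrier L"
  shows "mnorm D (riesz V) \<le> hilbert_norm A L V"
  unfolding mnorm_D
proof (rule cSUP_least)
  show "{U \<in> carrier L. hilbert_norm A L U \<le> 1} \<noteq> {}" using iota_zero_unit_ball by blast
  fix U assume "U \<in> {U \<in> carrier L. hilbert_norm A L U \<le> 1}"
  then have U: "U \<in> carrier L" "hilbert_norm A L U \<le> 1" by auto
  have "cmod (minner L U V x) \<le> hilbert_norm A L V" for x
    using cmod_minner_le[OF U(1) V, of x] mult_right_mono[OF U(2) hilbert_norm_L_nonneg[OF V]]
    by linarith
  then show "anorm A (riesz V U) \<le> hilbert_norm A L V"
    using U(1) by (simp add: riesz_def anorm_le)
qed

text \<open>Linear because both \<open>riesz\<close> and bidual functionals (as functions of pointwise scalars) are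
  conjugate linear.\<close>

lemma bidual_riesz_dual:
  assumes F: "F \<in> carrier DD"
  shows "(\<lambda>V\<in>carrier L. F (riesz V)) \<in> carrier D"
proof -
  obtain C where C: "C \<ge> 0" "\<And>f x. f \<in> carrier D \<Longrightarrow> cmod (F f x) \<le> C * mnorm D f"
    using bidual_bound[OF F] by blast
  have add: "riesz (madd L U V) = (\<lambda>W\<in>carrier L. \<lambda>x. riesz U W x + riesz V W x)"
    if "U \<in> carrier L" "V \<in> carrier L" for U V
    unfolding riesz_def
  proof (rule restrict_ext, rule ext)
    fix W x assume W: "W \<in> carrier L"
    show "minner L W (madd L U V) x = (\<lambda>W\<in>carrier L. minner L W U) W x + (\<lambda>W\<in>carrier L. minner L W V) W x"
      using W that minner_add_left[OF that W, of x] minner_cnj[OF madd_carrier[OF that] W, of x]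
        minner_cnj[OF that(1) W, of x] minner_cnj[OF that(2) W, of x] by simp
  qed
  have scale: "riesz (mscale L c U) = (\<lambda>W\<in>carrier L. \<lambda>x. cnj c * riesz U W x)"
    if "U \<in> carrier L" for U c
    unfolding riesz_def
  proof (rule restrict_ext, rule ext)
    fix W x assume W: "W \<in> carrier L"
    show "minner L W (mscale L c U) x = cnj c * (\<lambda>W\<in>carrier L. minner L W U) W x"
      using W that minner_scale_left[OF that W, of c x] minner_cnj[OF mscale_carrier[OF that] W, of c x]
        minner_cnj[OF that(1) W, of x] by simp
  qed
  have act: "riesz (mact L U a) = (\<lambda>W\<in>carrier L. \<lambda>x. cnj (a x) * riesz U W x)"
    if "U \<in> carrier L" "a \<in> carrier A" for U a
    unfolding riesz_def
  proof (rule restrict_ext, rule ext)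
    fix W x assume W: "W \<in> carrier L"
    show "minner L W (mact L U a) x = cnj (a x) * (\<lambda>W\<in>carrier L. minner L W U) W x"
      using W that minner_act_left[OF that W, of x] minner_cnj[OF mact_carrier[OF that] W, of x]
        minner_cnj[OF that(1) W, of x] by simp
  qed
  show ?thesis
  proof (rule dualI)
    fix V x assume V: "V \<in> carrier L"
    show "cmod (F (riesz V) x) \<le> C * hilbert_norm A L V"
      using C(2)[OF riesz_dual[OF V], of x] mult_left_mono[OF mnorm_riesz_le[OF V] C(1)]
      by linarith
  qed (simp_all add: add scale act bidualD[OF F] riesz_dual)
qed

section \<open>Localisation by invariant cutoffs\<close>

lemma fnorm_invariant: "cont \<phi> \<Longrightarrow> (\<lambda>x. complex_of_real (fnorm x \<phi>)) \<in> carrier A"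
proof (rule carrier_AI)
  assume \<phi>: "cont \<phi>"
  have a: "ip \<phi> \<phi> \<in> carrier A" by (rule ip_carrier[OF \<phi> \<phi>])
  show "cont (\<lambda>x. complex_of_real (fnorm x \<phi>))"
    unfolding fnorm_def
    by (rule continuous_on_of_real[OF continuous_on_real_sqrt[OF continuous_on_Re[OF carrier_A_cont[OF a]]]])
  show "complex_of_real (fnorm (\<alpha> g x) \<phi>) = complex_of_real (fnorm x \<phi>)" if "g \<in> carrier G" for g x
    by (simp add: fnorm_def carrier_A_inv[OF a that])
qed

text \<open>The factor \<open>e / max e (fnorm y \<phi>)\<close> truncates the fibre norm at level
  \<open>e\<close>. It is invariant and continuous since the fibre norm is and the denominator is at
  least \<open>e\<close>, and it equals 1 wherever the fibre norm does not exceed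
  \<open>e\<close>.\<close>

lemma cutoff:
  assumes \<phi>: "cont \<phi>" and e: "0 < e" "fnorm x \<phi> \<le> e"
  obtains b where "b \<in> carrier A" "b x = 1" "\<And>y. fnorm y (\<lambda>x. \<phi> x * b x) \<le> e"
proof
  let ?b = "\<lambda>y. complex_of_real (e / max e (fnorm y \<phi>))"
  have pos: "max e (fnorm y \<phi>) > 0" for y using e by simp
  have c: "continuous_on UNIV (\<lambda>y. fnorm y \<phi>)"
    using continuous_on_Re[OF carrier_A_cont[OF fnorm_invariant[OF \<phi>]]] by simp
  have inv: "fnorm (\<alpha> g y) \<phi> = fnorm y \<phi>" if "g \<in> carrier G" for g y
    using carrier_A_inv[OF fnorm_invariant[OF \<phi>] that, of y] by simp
  show b: "?b \<in> carrier A"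
  proof (rule carrier_AI)
    show "cont ?b"
      by (intro continuous_intros c) (use pos in \<open>auto simp: less_imp_neq[symmetric]\<close>)
  qed (simp add: inv)
  show "?b x = 1" using e by simp
  fix y
  have "fnorm y (\<lambda>x. \<phi> x * ?b x) = fnorm y \<phi> * (e / max e (fnorm y \<phi>))"
    using fnorm_mult[OF b \<phi>, of y] pos[of y] e by (simp add: norm_divide)
  also have "\<dots> \<le> e"
    using pos[of y] e fnorm_nonneg[OF \<phi>, of y] by (simp add: divide_le_eq mult.commute mult_left_mono)
  finally show "fnorm y (\<lambda>x. \<phi> x * ?b x) \<le> e" .
qed

text \<open>A cutoff with value 1 at \<open>x\<close> does not change
  \<open>f (iota \<phi>) x\<close>, by linearity over the algebra, but reduces the global norm of
  \<phi> to nearly its fibre norm at \<open>x\<close>. The margin \<open>d\<close> keeps the cutoff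
  level positive when that fibre norm is 0.\<close>

lemma dual_fnorm_bound:
  assumes f: "f \<in> carrier D"
  shows "\<exists>C\<ge>0. \<forall>\<phi>. cont \<phi> \<longrightarrow> (\<forall>x. cmod (f (iota \<phi>) x) \<le> C * fnorm x \<phi>)"
proof -
  obtain C where C: "C \<ge> 0" "\<And>U x. U \<in> carrier L \<Longrightarrow> cmod (f U x) \<le> C * hilbert_norm A L U"
    using dual_bound[OF f] by blast
  have "cmod (f (iota \<phi>) x) \<le> C * fnorm x \<phi>" if \<phi>: "cont \<phi>" for \<phi> x
  proof (rule field_le_epsilon)
    fix e :: real assume "e > 0"
    then obtain d where d: "d > 0" "C * (d + d) \<le> e" using ex_small_multiple C(1) by blast
    have dp: "fnorm x \<phi> + d > 0" using d fnorm_nonneg[OF \<phi>, of x] by simp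
    obtain b where b: "b \<in> carrier A" "b x = 1" "\<And>y. fnorm y (\<lambda>x. \<phi> x * b x) \<le> fnorm x \<phi> + d"
      using cutoff[OF \<phi> dp, of x] d(1) by auto
    have act: "mact L (iota \<phi>) b = iota (\<lambda>x. \<phi> x * b x)"
      unfolding iota_def by (rule mact_L[OF b(1) cauchy_fns_const[OF \<phi>]])
    have cb: "cont (\<lambda>x. \<phi> x * b x)"
      by (intro continuous_intros \<phi> carrier_A_cont b(1))
    have "f (iota (\<lambda>x. \<phi> x * b x)) x = f (iota \<phi>) x"
      using dualD(5)[OF f iota_carrier[OF \<phi>] b(1)] b(2) by (simp add: act)
    then have "cmod (f (iota \<phi>) x) \<le> C * hilbert_norm A L (iota (\<lambda>x. \<phi> x * b x))"
      using C(2)[OF iota_carrier[OF cb], of x] by simp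
    also have "\<dots> \<le> C * (fnorm x \<phi> + d)"
      unfolding iota_def
      by (intro mult_left_mono C(1) hilbert_norm_L_le[OF cauchy_fns_const[OF cb]] b(3) less_imp_le[OF dp])
    also have "\<dots> \<le> C * fnorm x \<phi> + e"
      using d mult_nonneg_nonneg[OF C(1), of d] by (simp add: distrib_left)
    finally show "cmod (f (iota \<phi>) x) \<le> C * fnorm x \<phi> + e" .
  qed
  then show ?thesis using C(1) by blast
qed

text \<open>Bounded functionals are continuous, so their values at a point are determined by the
  dense image of C(X).\<close>

lemma dual_limit:
  assumes f: "f \<in> carrier D" and s: "cauchy_fns s"
  shows "(\<lambda>n. f (iota (s n)) x) \<longlonglongrightarrow> f (cls s) x"
proof (rule LIMSEQ_I)
  fix e :: real assume "e > 0"
  obtain C where C: "C \<ge> 0" "\<And>U x. U \<in> carrier L \<Longrightarrow> cmod (f U x) \<le> C * hilbert_norm A L U"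
    using dual_bound[OF f] by blast
  have "e / 2 > 0" using \<open>e > 0\<close> by simp
  then obtain d where d: "d > 0" "C * (d + d) \<le> e / 2" using ex_small_multiple C(1) by blast
  obtain M where M: "\<And>m n x. m \<ge> M \<Longrightarrow> n \<ge> M \<Longrightarrow> fnorm x (\<lambda>x. s m x - s n x) \<le> d"
    using s d(1) unfolding cauchy_fns_def by meson
  have "cmod (f (iota (s n)) x - f (cls s) x) < e" if n: "n \<ge> M" for n
  proof -
    have cn: "cauchy_fns (\<lambda>k. s n)" by (intro cauchy_fns_const cauchy_fns_cont s)
    let ?t = "\<lambda>k x. s k x + (-1) * s n x"
    have t: "cauchy_fns ?t"
      by (intro cauchy_fns_add cauchy_fns_scale s cn)
    have "madd L (cls s) (mscale L (-1) (iota (s n))) = cls ?t"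
      unfolding iota_def by (subst mscale_L[OF cn], subst madd_L[OF s cauchy_fns_scale[OF cn]]) simp
    then have "f (cls ?t) x = f (cls s) x - f (iota (s n)) x"
      using dualD(3)[OF f cls_carrier[OF s] mscale_carrier[OF cls_carrier[OF cn]], of "-1"]
        dualD(4)[OF f cls_carrier[OF cn], of "-1"] by (simp add: iota_def)
    moreover have "cmod (f (cls ?t) x) \<le> C * hilbert_norm A L (cls ?t)"
      by (rule C(2)[OF cls_carrier[OF t]])
    moreover have "hilbert_norm A L (cls ?t) \<le> d"
      using M n d(1) by (intro hilbert_norm_L_le[OF t, where M = M]) auto
    ultimately have "cmod (f (cls s) x - f (iota (s n)) x) \<le> C * d"
      using mult_left_mono[OF _ C(1), of "hilbert_norm A L (cls ?t)" d] by simp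
    also have "\<dots> \<le> C * (d + d)" using d C(1) by (intro mult_left_mono) auto
    also have "\<dots> < e" using d \<open>e > 0\<close> by simp
    finally show ?thesis by (simp add: norm_minus_commute)
  qed
  then show "\<exists>M. \<forall>n\<ge>M. cmod (f (iota (s n)) x - f (cls s) x) < e" by blast
qed

end

section \<open>Locality of bidual functionals\<close>

context stable_action
begin

text \<open>The gauge is the orbit mean of the distance to the orbit of \<open>x0\<close>.\<close>

lemma invariant_gauge:
  obtains d :: "'x \<Rightarrow> real" where "(\<lambda>x. complex_of_real (d x)) \<in> carrier A"
    "\<And>x. 0 \<le> d x" "d x0 = 0"
    "\<And>a e. a \<in> carrier A \<Longrightarrow> 0 < e \<Longrightarrow> \<exists>r>0. \<forall>y. d y < r \<longrightarrow> cmod (a y - a x0) < e"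
proof
  define S where "S = (\<lambda>g. \<alpha> g x0) ` carrier G"
  have S: "S \<noteq> {}" using one_closed by (auto simp: S_def)
  define \<phi> where "\<phi> x = complex_of_real (infdist x S)" for x
  have \<phi>: "cont \<phi>" unfolding \<phi>_def by (intro continuous_intros)
  let ?d = "\<lambda>x. Re (orbit_mean \<phi> x)"
  have m: "orbit_mean \<phi> x \<in> \<real>\<^sub>\<ge>\<^sub>0" for x
    by (intro orbit_mean_in_closed_convex closed_nonneg_Reals_complex \<phi>)
      (auto simp: convex_def complex_nonneg_Reals_iff \<phi>_def infdist_nonneg)
  then have eq: "complex_of_real (?d x) = orbit_mean \<phi> x" for x
    by (simp add: complex_nonneg_Reals_iff complex_eq_iff)
  show "(\<lambda>x. complex_of_real (?d x)) \<in> carrier A"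
    unfolding eq by (rule orbit_mean_carrier[OF \<phi>])
  show "0 \<le> ?d x" for x using m[of x] by (simp add: complex_nonneg_Reals_iff)
  have "cmod (orbit_mean \<phi> x0) \<le> 0"
    by (intro orbit_mean_bound \<phi>) (auto simp: \<phi>_def S_def)
  then show "?d x0 = 0" by simp
  fix a and e :: real assume a: "a \<in> carrier A" and e: "e > 0"
  have "uniformly_continuous_on UNIV a"
    using compact_uniformly_continuous[OF carrier_A_cont[OF a] compact_UNIV] .
  then obtain r where r: "r > 0" "\<And>x y. dist x y < r \<Longrightarrow> dist (a x) (a y) < e"
    unfolding uniformly_continuous_on_def using e by (metis UNIV_I)
  have "cmod (a y - a x0) < e" if y: "?d y < r" for y
  proof -
    \<comment> \<open>A mean below \<open>r\<close> cannot come from values that are all at least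
      \<open>r\<close>, by the half-plane instance of the convexity principle. So the orbits of
      \<open>y\<close> and \<open>x0\<close> come within \<open>r\<close>, and an invariant function
      cannot tell \<open>y\<close> from such a nearby pair of orbit points.\<close>
    have "\<exists>g\<in>carrier G. infdist (\<alpha> g y) S < r"
    proof (rule ccontr)
      assume "\<not> (\<exists>g\<in>carrier G. infdist (\<alpha> g y) S < r)"
      then have "orbit_mean \<phi> y \<in> {z. Re z \<ge> r}"
        by (intro orbit_mean_in_closed_convex \<phi> closed_halfspace_Re_ge convex_halfspace_Re_ge)
          (auto simp: \<phi>_def not_less)
      then show False using y by simp
    qed
    then obtain g where g: "g \<in> carrier G" "infdist (\<alpha> g y) S < r" by blast
    then have "\<exists>z\<in>S. dist (\<alpha> g y) z < r"
      using cINF_less_iff[of S "dist (\<alpha> g y)" r] S by (auto simp: infdist_notempty bdd_below_def intro: zero_le_dist)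
    then obtain h where h: "h \<in> carrier G" "dist (\<alpha> g y) (\<alpha> h x0) < r"
      by (auto simp: S_def)
    then show ?thesis
      using r(2)[OF h(2)] by (simp add: carrier_A_inv[OF a] g(1) dist_norm)
  qed
  then show "\<exists>r>0. \<forall>y. ?d y < r \<longrightarrow> cmod (a y - a x0) < e" using r(1) by blast
qed

end

text \<open>A Urysohn quotient for the even-indexed and the odd-indexed terms. Adding 0 to both sets
  makes them closed; strict decrease leaves 0 as their only common point, which is why continuity is
  claimed only for positive arguments.\<close>

lemma oscillating_function:
  fixes r :: "nat \<Rightarrow> real"
  assumes pos: "\<And>n. 0 < r n" and dec: "\<And>n. r (Suc n) < r n" and lim: "r \<longlonglongrightarrow> 0"
  obtains h :: "real \<Rightarrow> real" where "\<And>x. 0 \<le> h x" "\<And>x. h x \<le> 1"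
    "\<And>x. 0 < x \<Longrightarrow> isCont h x" "\<And>n. h (r (2 * n)) = 1" "\<And>n. h (r (2 * n + 1)) = 0"
proof
  define E where "E = insert 0 (range (\<lambda>n. r (2 * n)))"
  define F where "F = insert 0 (range (\<lambda>n. r (2 * n + 1)))"
  let ?h = "\<lambda>x. infdist x F / (infdist x E + infdist x F)"
  have "strict_mono (\<lambda>n. - r n)"
    using dec by (simp add: strict_mono_Suc_iff)
  then have inj: "r m = r n \<longleftrightarrow> m = n" for m n
    using strict_mono_eq[of "\<lambda>n. - r n" m n] by simp
  have "(\<lambda>n. r (2 * n)) \<longlonglongrightarrow> 0"
    by (rule filterlim_compose[OF lim]) (rule filterlim_subseq, simp add: strict_mono_def)
  then have "closed E"
    unfolding E_def by (intro compact_imp_closed compact_sequence_with_limit)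
  have "(\<lambda>n. r (2 * n + 1)) \<longlonglongrightarrow> 0"
    by (rule filterlim_compose[OF lim]) (rule filterlim_subseq, simp add: strict_mono_def)
  then have "closed F"
    unfolding F_def by (intro compact_imp_closed compact_sequence_with_limit)
  have E0: "infdist x E = 0 \<longleftrightarrow> x \<in> E" and F0: "infdist x F = 0 \<longleftrightarrow> x \<in> F" for x
    using in_closed_iff_infdist_zero[OF \<open>closed E\<close>] in_closed_iff_infdist_zero[OF \<open>closed F\<close>]
    by (auto simp: E_def F_def)
  have disj: "x = 0" if mem: "x \<in> E" "x \<in> F" for x
  proof (rule ccontr)
    assume "x \<noteq> 0"
    then obtain m n where "r (2 * m) = r (2 * n + 1)" using mem by (auto simp: E_def F_def)
    then have "2 * m = 2 * n + 1" unfolding inj .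
    then show False by presburger
  qed
  have den: "infdist x E + infdist x F \<noteq> 0" if "x \<noteq> 0" for x
    using that disj E0[of x] F0[of x] infdist_nonneg[of x E] infdist_nonneg[of x F]
    by (auto simp: add_nonneg_eq_0_iff)
  show "0 \<le> ?h x" for x by (simp add: infdist_nonneg)
  show "?h x \<le> 1" for x
    using infdist_nonneg[of x E] infdist_nonneg[of x F] by (simp add: divide_le_eq_1) linarith
  show "isCont ?h x" if "0 < x" for x
    using den[of x] that by (intro continuous_intros) auto
  fix n
  have "infdist (r (2 * n)) E = 0" unfolding E0 by (simp add: E_def)
  then show "?h (r (2 * n)) = 1" using den[of "r (2 * n)"] pos[of "2 * n"] by simp
  have "infdist (r (2 * n + 1)) F = 0" unfolding F0 by (simp add: F_def)
  then show "?h (r (2 * n + 1)) = 0" by simp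
qed

context stable_action
begin

text \<open>If the orbit closure of \<open>x0\<close> is not isolated, the vanishing functional \<open>f\<close> may be multiplied
  by a function oscillating near \<open>x0\<close> without leaving the dual; continuity of the values of \<open>F\<close>
  then forces \<open>F f x0 = 0\<close>.\<close>

lemma bidual_local:
  assumes F: "F \<in> carrier DD" and f: "f \<in> carrier D"
    and zero: "\<And>\<phi>. cont \<phi> \<Longrightarrow> f (iota \<phi>) x0 = 0"
  shows "F f x0 = 0"
proof -
  have zero': "f U x0 = 0" if U: "U \<in> carrier L" for U
  proof -
    obtain s where s: "cauchy_fns s" "U = cls s" using U by (rule carrier_LE)
    then show ?thesis
      using dual_limit[OF f s(1), of x0] zero[OF cauchy_fns_cont[OF s(1)]]
      by (simp add: LIMSEQ_const_iff)
  qed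
  obtain d :: "'x \<Rightarrow> real" where dA: "(\<lambda>x. complex_of_real (d x)) \<in> carrier A"
    and d0: "\<And>x. 0 \<le> d x" "d x0 = 0"
    and d: "\<And>a e. a \<in> carrier A \<Longrightarrow> 0 < e \<Longrightarrow> \<exists>r>0. \<forall>y. d y < r \<longrightarrow> cmod (a y - a x0) < e"
    using invariant_gauge[of x0] by metis
  have dc: "continuous_on UNIV d"
    using continuous_on_Re[OF carrier_A_cont[OF dA]] by simp
  have dinv: "d (\<alpha> g x) = d x" if "g \<in> carrier G" for g x
    using carrier_A_inv[OF dA that, of x] by simp
  \<comment> \<open>The zero set of the gauge consists of points that the algebra cannot separate
    from \<open>x0\<close>.\<close>
  have same: "a y = a x0" if "a \<in> carrier A" "d y = 0" for a y
  proof (rule ccontr)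
    assume "a y \<noteq> a x0"
    then have "0 < cmod (a y - a x0)" by simp
    from d[OF that(1) this] obtain r where r: "r > 0" "\<forall>z. d z < r \<longrightarrow> cmod (a z - a x0) < cmod (a y - a x0)"
      by blast
    show False using r(2)[rule_format, of y] r(1) that(2) by simp
  qed
  show ?thesis
  proof (cases "\<exists>r>0. \<forall>x. d x = 0 \<or> r \<le> d x")
    case True
    then obtain r where r: "r > 0" "\<And>x. d x = 0 \<or> r \<le> d x" by blast
    \<comment> \<open>Since the gauge has no values strictly between 0 and \<open>r\<close>, this is
      the indicator function of its zero set. It annihilates \<open>f\<close>, which vanishes there,
      while its value at \<open>x0\<close> is 1.\<close>
    let ?e = "\<lambda>x. complex_of_real (max 0 (1 - d x / r))"
    have e: "?e \<in> carrier A"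
    proof (rule carrier_AI)
      show "cont ?e" by (intro continuous_intros dc) (use r in auto)
    qed (simp add: dinv)
    have "(\<lambda>U\<in>carrier L. \<lambda>x. ?e x * f U x) = (\<lambda>U\<in>carrier L. \<lambda>x. cnj 0 * f U x)"
    proof (rule restrict_ext, rule ext)
      fix U x assume U: "U \<in> carrier L"
      show "?e x * f U x = cnj 0 * f U x"
        using r(2)[of x] r(1) same[OF dualD(2)[OF f U], of x] zero'[OF U]
        by (auto simp: le_divide_eq_1)
    qed
    then have "F f x0 * cnj (?e x0) = 0"
      using bidual_mult[OF F f e, of x0] bidualD(4)[OF F f, of 0] by simp
    then show ?thesis using d0 by simp
  next
    case False
    then have near: "\<exists>x. 0 < d x \<and> d x < r" if "r > 0" for r
      using that d0(1) by (metis less_eq_real_def not_le)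
    \<comment> \<open>Strict decrease of the gauge values keeps the even and odd terms apart for the
      oscillating function.\<close>
    have "\<exists>x. \<forall>n. (0 < d (x n) \<and> d (x n) < 1 / real (Suc n)) \<and> d (x (Suc n)) < d (x n)"
    proof (rule dependent_nat_choice)
      show "\<exists>x. 0 < d x \<and> d x < 1 / real (Suc 0)" using near[of 1] by simp
      fix x n assume "0 < d x \<and> d x < 1 / real (Suc n)"
      then show "\<exists>y. (0 < d y \<and> d y < 1 / real (Suc (Suc n))) \<and> d y < d x"
        using near[of "min (d x) (1 / real (Suc (Suc n)))"] by auto
    qed
    then obtain x where x: "\<And>n. 0 < d (x n)" "\<And>n. d (x n) < 1 / real (Suc n)"
      "\<And>n. d (x (Suc n)) < d (x n)" by blast
    have lim: "(\<lambda>n. d (x n)) \<longlonglongrightarrow> 0"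
    proof (rule real_tendsto_sandwich[OF _ _ tendsto_const LIMSEQ_Suc[OF lim_inverse_n']])
      show "\<forall>\<^sub>F n in sequentially. 0 \<le> d (x n)" using d0 by simp
      show "\<forall>\<^sub>F n in sequentially. d (x n) \<le> 1 / real (Suc n)" using x(2) by (simp add: less_imp_le)
    qed
    obtain h :: "real \<Rightarrow> real" where h: "\<And>t. 0 \<le> h t" "\<And>t. h t \<le> 1" "\<And>t. 0 < t \<Longrightarrow> isCont h t"
      "\<And>n. h (d (x (2 * n))) = 1" "\<And>n. h (d (x (2 * n + 1))) = 0"
      using oscillating_function[of "\<lambda>n. d (x n)", OF x(1,3) lim] by blast
    let ?h = "\<lambda>y. complex_of_real (h (d y))"
    have hb: "cmod (?h y) \<le> 1" for y using h(1,2) by simp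
    \<comment> \<open>On the zero set of the gauge the factor \<open>a\<close> vanishes and the
      bounded \<open>?h\<close> does no harm; off this set \<open>?h\<close> is continuous.\<close>
    have osc: "(\<lambda>y. ?h y * a y) \<in> carrier A" if a: "a \<in> carrier A" "a x0 = 0" for a
    proof (rule carrier_AI)
      have ac: "isCont a y" for y
        using carrier_A_cont[OF a(1)] by (simp add: continuous_on_eq_continuous_at)
      have dcy: "isCont d y" for y
        using dc by (simp add: continuous_on_eq_continuous_at)
      have "isCont (\<lambda>y. ?h y * a y) y" for y
      proof (cases "d y = 0")
        case True
        then have a0: "a y = 0" using same[OF a(1)] a(2) by simp
        have "(\<lambda>y. ?h y * a y) \<midarrow>y\<rightarrow> 0"
        proof (rule Lim_null_comparison)
          show "\<forall>\<^sub>F z in at y. cmod (?h z * a z) \<le> cmod (a z)"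
            using hb by (simp add: norm_mult mult_left_le_one_le)
          show "(\<lambda>z. cmod (a z)) \<midarrow>y\<rightarrow> 0"
            using ac[of y] a0 by (simp add: isCont_def tendsto_norm_zero)
        qed
        then show ?thesis by (simp add: isCont_def a0)
      next
        case False
        then have "isCont h (d y)" using h(3) d0(1)[of y] by simp
        then have "isCont (\<lambda>y. h (d y)) y" using isCont_o2[OF dcy] by blast
        then show ?thesis by (intro continuous_intros ac)
      qed
      then show "cont (\<lambda>y. ?h y * a y)" by (simp add: continuous_at_imp_continuous_on)
    qed (simp add: dinv carrier_A_inv[OF a(1)])
    let ?g = "\<lambda>U\<in>carrier L. \<lambda>y. ?h y * f U y"
    have g: "?g \<in> carrier D"
      by (rule dual_multiplier[OF f hb]) (intro osc dualD(2)[OF f] zero')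
    \<comment> \<open>\<open>?h\<close> need not lie in the algebra, but its product with the gauge
      does. Linearity applied to d \<open>?g\<close> = (\<open>?h\<close> d) f gives the identity
      multiplied by the gauge, which cancels where it is positive.\<close>
    have Fg: "F ?g y = ?h y * F f y" if "0 < d y" for y
    proof -
      have dh: "(\<lambda>y. ?h y * complex_of_real (d y)) \<in> carrier A"
        by (rule osc[OF dA]) (simp add: d0)
      have "(\<lambda>U\<in>carrier L. \<lambda>y. complex_of_real (d y) * ?g U y) = (\<lambda>U\<in>carrier L. \<lambda>y. (?h y * complex_of_real (d y)) * f U y)"
        by (rule restrict_ext) (simp add: mult_ac)
      then have "F ?g y * complex_of_real (d y) = F f y * (?h y * complex_of_real (d y))"
        using bidual_mult[OF F g dA, of y] bidual_mult[OF F f dh, of y]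
        by (simp only: complex_cnj_mult complex_cnj_complex_of_real)
      then show ?thesis using that by (auto simp: mult.commute)
    qed
    \<comment> \<open>The points are not claimed to converge in the space; small gauge values only
      force convergence of every invariant function.\<close>
    have conv: "(\<lambda>n. a (x (k n))) \<longlonglongrightarrow> a x0" if a: "a \<in> carrier A" and k: "strict_mono k" for a k
    proof (rule LIMSEQ_I)
      fix e :: real assume "e > 0"
      then obtain r where r: "r > 0" "\<And>y. d y < r \<Longrightarrow> cmod (a y - a x0) < e" using d[OF a] by blast
      have "(\<lambda>n. d (x (k n))) \<longlonglongrightarrow> 0" using LIMSEQ_subseq_LIMSEQ[OF lim k] by (simp add: o_def)
      then obtain M where "\<And>n. n \<ge> M \<Longrightarrow> d (x (k n)) < r"
        using LIMSEQ_D[OF _ r(1), of "\<lambda>n. d (x (k n))" 0] d0 by auto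
      then show "\<exists>M. \<forall>n\<ge>M. cmod (a (x (k n)) - a x0) < e" using r(2) by blast
    qed
    have k: "strict_mono (\<lambda>n::nat. 2 * n)" "strict_mono (\<lambda>n::nat. 2 * n + 1)"
      by (auto simp: strict_mono_def)
    \<comment> \<open>The value of \<open>F ?g\<close> at \<open>x0\<close> is computed twice: the
      odd points give 0, the even points give \<open>F f x0\<close>.\<close>
    have "F ?g (x (2 * n + 1)) = 0" for n
      using Fg[OF x(1)[of "2 * n + 1"]] h(5)[of n] by simp
    then have "F ?g x0 = 0"
      using conv[OF bidualD(2)[OF F g] k(2)] by (simp add: LIMSEQ_const_iff)
    moreover have "F ?g (x (2 * n)) = F f (x (2 * n))" for n
      using Fg[OF x(1)[of "2 * n"]] h(4)[of n] by simp
    then have "F ?g x0 = F f x0"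
      using conv[OF bidualD(2)[OF F g] k(1)] conv[OF bidualD(2)[OF F f] k(1)]
      by (simp add: LIMSEQ_unique)
    ultimately show ?thesis by simp
  qed
qed

end

section \<open>Representation at a point\<close>

text \<open>The parallelogram law as real arithmetic: \<open>p\<close> and \<open>q\<close> are the
  squared norms of sum and difference, \<open>A\<close> and \<open>B\<close> those of the two
  vectors, \<open>a\<close> and \<open>b\<close> the real parts of the functional, and the first
  assumption says that the midpoint does not go below the infimum \<open>m\<close>.\<close>

lemma parallelogram_bound:
  fixes m p q :: real
  assumes "m \<le> p / 4 - a - b" "p = A + 2 * r + B" "q = A - 2 * r + B"
  shows "q \<le> 2 * (A - 2 * a - m) + 2 * (B - 2 * b - m)"
  using assms by (simp add: field_simps)

context stable_action
begin

lemma iota_add: "cont \<phi> \<Longrightarrow> cont \<psi> \<Longrightarrow> iota (\<lambda>x. \<phi> x + \<psi> x) = madd L (iota \<phi>) (iota \<psi>)"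
  unfolding iota_def by (rule madd_L[symmetric]) (rule cauchy_fns_const, assumption)+

lemma iota_scale: "cont \<phi> \<Longrightarrow> iota (\<lambda>x. c * \<phi> x) = mscale L c (iota \<phi>)"
  unfolding iota_def by (rule mscale_L[symmetric]) (rule cauchy_fns_const)

lemma dual_iota_add:
  "f \<in> carrier D \<Longrightarrow> cont \<phi> \<Longrightarrow> cont \<psi> \<Longrightarrow> f (iota (\<lambda>x. \<phi> x + \<psi> x)) x = f (iota \<phi>) x + f (iota \<psi>) x"
  by (simp add: iota_add dualD(3) iota_carrier)

lemma dual_iota_scale:
  "f \<in> carrier D \<Longrightarrow> cont \<phi> \<Longrightarrow> f (iota (\<lambda>x. c * \<phi> x)) x = c * f (iota \<phi>) x"
  by (simp add: iota_scale dualD(4) iota_carrier)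

lemma dual_iota_diff:
  assumes "f \<in> carrier D" "cont \<phi>" "cont \<psi>"
  shows "f (iota (\<lambda>x. \<phi> x - \<psi> x)) x = f (iota \<phi>) x - f (iota \<psi>) x"
  using dual_iota_add[of f \<phi> "\<lambda>x. (-1) * \<psi> x" x] dual_iota_scale[of f \<psi> "-1" x] assms
  by (simp add: continuous_intros)

lemma ip_mult_right:
  assumes a: "a \<in> carrier A" and c: "cont \<phi>" "cont \<psi>"
  shows "ip \<phi> (\<lambda>x. \<psi> x * a x) x = ip \<phi> \<psi> x * cnj (a x)"
proof -
  have "ip \<phi> (\<lambda>x. \<psi> x * a x) x = cnj (ip (\<lambda>x. \<psi> x * a x) \<phi> x)"
    by (intro ip_cnj continuous_intros c carrier_A_cont[OF a])
  also have "\<dots> = cnj (ip \<psi> \<phi> x) * cnj (a x)" by (simp add: ip_mult_left[OF a c(2,1)])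
  also have "cnj (ip \<psi> \<phi> x) = ip \<phi> \<psi> x" by (rule ip_cnj[OF c(2,1), symmetric])
  finally show ?thesis .
qed

text \<open>The sequence minimises \<open>\<parallel>\<phi>\<parallel>\<^sup>2 - 2 Re f(\<phi>)\<close>, both terms taken at \<open>x0\<close>.\<close>

lemma riesz_minimising_sequence:
  assumes f: "f \<in> carrier D"
  obtains \<Phi> where "\<And>n. cont (\<Phi> n)"
    "\<And>n. fnorm x0 (\<lambda>x. \<Phi> (Suc n) x - \<Phi> n x) \<le> 2 * (1 / 2) ^ n"
    "\<And>\<psi>. cont \<psi> \<Longrightarrow> (\<lambda>n. ip \<psi> (\<Phi> n) x0) \<longlonglongrightarrow> f (iota \<psi>) x0"
proof -
  define T where "T \<phi> = f (iota \<phi>) x0" for \<phi>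
  have Tadd: "T (\<lambda>x. \<phi> x + \<psi> x) = T \<phi> + T \<psi>" if "cont \<phi>" "cont \<psi>" for \<phi> \<psi>
    unfolding T_def by (rule dual_iota_add[OF f that])
  have Tscale: "T (\<lambda>x. c * \<phi> x) = c * T \<phi>" if "cont \<phi>" for \<phi> c
    unfolding T_def by (rule dual_iota_scale[OF f that])
  obtain C where C: "C \<ge> 0" "\<And>\<phi>. cont \<phi> \<Longrightarrow> cmod (T \<phi>) \<le> C * fnorm x0 \<phi>"
    using dual_fnorm_bound[OF f] unfolding T_def by blast
  define Q where "Q \<phi> = (fnorm x0 \<phi>)\<^sup>2 - 2 * Re (T \<phi>)" for \<phi>
  define m where "m = Inf (Q ` {\<phi>. cont \<phi>})"
  have "- (C\<^sup>2) \<le> Q \<phi>" if "cont \<phi>" for \<phi>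
  proof -
    have "0 \<le> (fnorm x0 \<phi> - C)\<^sup>2" by simp
    then have "2 * (C * fnorm x0 \<phi>) \<le> (fnorm x0 \<phi>)\<^sup>2 + C\<^sup>2" by (simp add: power2_diff algebra_simps)
    then show ?thesis
      using C(2)[OF that] complex_Re_le_cmod[of "T \<phi>"] unfolding Q_def by linarith
  qed
  then have bdd: "bdd_below (Q ` {\<phi>. cont \<phi>})" by (auto intro!: bdd_belowI2)
  have m: "m \<le> Q \<phi>" if "cont \<phi>" for \<phi>
    unfolding m_def using that bdd by (intro cInf_lower) auto
  \<comment> \<open>The tolerance is the square of 1/2^n, so that successive differences are
    summable in the fibre seminorm.\<close>
  have "\<exists>\<phi>. cont \<phi> \<and> Q \<phi> < m + (1 / 4) ^ n" for n
  proof -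
    have ne: "Q ` {\<phi>. cont \<phi>} \<noteq> {}" by (auto intro: continuous_on_const)
    have "Inf (Q ` {\<phi>. cont \<phi>}) < m + (1 / 4) ^ n" by (simp add: m_def)
    from cInf_lessD[OF ne this] show ?thesis by auto
  qed
  then have "\<exists>\<Phi>. \<forall>n. cont (\<Phi> n) \<and> Q (\<Phi> n) < m + (1 / 4) ^ n"
    by (intro choice allI)
  then obtain \<Phi> where \<Phi>: "\<And>n. cont (\<Phi> n)" "\<And>n. Q (\<Phi> n) < m + (1 / 4) ^ n" by blast
  have pow: "((1 / 2) ^ n)\<^sup>2 = (1 / 4 :: real) ^ n" for n
    by (simp add: power2_eq_square flip: power_mult_distrib)
  show thesis
  proof
    show "cont (\<Phi> n)" for n by (rule \<Phi>)
    show "fnorm x0 (\<lambda>x. \<Phi> (Suc n) x - \<Phi> n x) \<le> 2 * (1 / 2) ^ n" for n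
    proof -
      let ?a = "\<Phi> (Suc n)" and ?b = "\<Phi> n"
      have cab: "cont (\<lambda>x. ?a x + ?b x)" "cont (\<lambda>x. (1/2) * (?a x + ?b x))"
        by (intro continuous_intros \<Phi>)+
      have T2: "T (\<lambda>x. (1/2) * (?a x + ?b x)) = (1/2) * (T ?a + T ?b)"
        by (simp only: Tscale[OF cab(1)] Tadd[OF \<Phi>(1) \<Phi>(1)])
      have n2: "fnorm x0 (\<lambda>x. (1/2) * (?a x + ?b x)) = 1/2 * fnorm x0 (\<lambda>x. ?a x + ?b x)"
        by (subst fnorm_scale[OF cab(1)]) simp
      have "Q (\<lambda>x. (1/2) * (?a x + ?b x))
          = (fnorm x0 (\<lambda>x. ?a x + ?b x))\<^sup>2 / 4 - Re (T ?a) - Re (T ?b)"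
        unfolding Q_def T2 n2 by (simp add: power2_eq_square add_divide_distrib)
      then have "m \<le> (fnorm x0 (\<lambda>x. ?a x + ?b x))\<^sup>2 / 4 - Re (T ?a) - Re (T ?b)"
        using m[OF cab(2)] by simp
      then have "(fnorm x0 (\<lambda>x. ?a x - ?b x))\<^sup>2 \<le> 2 * (Q ?a - m) + 2 * (Q ?b - m)"
        unfolding Q_def
        by (rule parallelogram_bound[OF _ fnorm_add_sq[OF \<Phi>(1) \<Phi>(1)] fnorm_sub_sq[OF \<Phi>(1) \<Phi>(1)]])
      also have "\<dots> \<le> 2 * (1 / 4) ^ n + 2 * (1 / 4) ^ n"
      proof (intro add_mono mult_left_mono)
        have "(1 / 4 :: real) ^ Suc n \<le> (1 / 4) ^ n" by (rule power_decreasing) auto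
        then show "Q ?a - m \<le> (1 / 4) ^ n" using \<Phi>(2)[of "Suc n"] by linarith
        show "Q ?b - m \<le> (1 / 4) ^ n" using \<Phi>(2)[of n] by linarith
      qed auto
      also have "\<dots> = 4 * (1 / 4) ^ n" by simp
      also have "\<dots> = (2 * (1 / 2) ^ n)\<^sup>2" by (simp add: power_mult_distrib pow)
      finally show ?thesis by (rule power2_le_imp_le) simp
    qed
    fix \<psi> assume \<psi>: "cont \<psi>"
    \<comment> \<open>The added 1 permits division by \<open>K\<close>, as the seminorm of \<psi> at
      \<open>x0\<close> may be 0.\<close>
    define K where "K = fnorm x0 \<psi> + 1"
    have K: "K > 0" "fnorm x0 \<psi> \<le> K" using fnorm_nonneg[OF \<psi>, of x0] by (auto simp: K_def)
    have "cmod (ip \<psi> (\<Phi> n) x0 - T \<psi>) \<le> K * (1 / 2) ^ n" for n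
    proof -
      define z where "z = ip \<psi> (\<Phi> n) x0 - T \<psi>"
      \<comment> \<open>Optimal step in the direction \<psi>: with w = -s cnj(z), \<open>Q\<close>
        changes by at most -2 s |z|^2 + s^2 |z|^2 K^2 = -s |z|^2. Near-minimality of
        \<open>Q\<close> therefore bounds the defect \<open>z\<close>.\<close>
      define s where "s = 1 / K\<^sup>2"
      define w where "w = - (complex_of_real s * cnj z)"
      have wz: "w * z = complex_of_real (- (s * (cmod z)\<^sup>2))"
        unfolding w_def by (simp add: complex_norm_square mult_ac del: of_real_power)
      have s: "s > 0" "s * K\<^sup>2 = 1" using K by (auto simp: s_def)
      have c: "cont (\<lambda>x. w * \<psi> x)" "cont (\<lambda>x. \<Phi> n x + w * \<psi> x)"
        by (intro continuous_intros \<Phi> \<psi>)+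
      have "Re (ip (\<Phi> n) (\<lambda>x. w * \<psi> x) x0) = Re (w * ip \<psi> (\<Phi> n) x0)"
        using ip_cnj[OF c(1) \<Phi>(1), of n x0] ip_scale_left[OF \<psi> \<Phi>(1), of w n x0] by simp
      then have "Q (\<lambda>x. \<Phi> n x + w * \<psi> x)
          = Q (\<Phi> n) + 2 * Re (w * z) + (cmod w * fnorm x0 \<psi>)\<^sup>2"
        unfolding Q_def fnorm_add_sq[OF \<Phi>(1) c(1)] Tadd[OF \<Phi>(1) c(1)] Tscale[OF \<psi>]
          fnorm_scale[OF \<psi>] z_def by (simp add: right_diff_distrib)
      also have "Re (w * z) = - (s * (cmod z)\<^sup>2)" unfolding wz by simp
      also have "(cmod w * fnorm x0 \<psi>)\<^sup>2 \<le> (cmod w * K)\<^sup>2"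
        using K fnorm_nonneg[OF \<psi>, of x0] by (intro power_mono mult_left_mono) auto
      also have "(cmod w * K)\<^sup>2 = (s * (cmod z)\<^sup>2) * (s * K\<^sup>2)"
        using s(1) by (simp add: w_def norm_mult power2_eq_square mult_ac)
      finally have "m \<le> Q (\<Phi> n) - s * (cmod z)\<^sup>2"
        using m[OF c(2)] s(2) by simp
      then have "s * (cmod z)\<^sup>2 * K\<^sup>2 \<le> (1 / 4) ^ n * K\<^sup>2"
        using \<Phi>(2)[of n] by (intro mult_right_mono) auto
      also have "\<dots> = (K * (1 / 2) ^ n)\<^sup>2"
        by (simp only: power_mult_distrib pow mult.commute)
      also have "s * (cmod z)\<^sup>2 * K\<^sup>2 = (s * K\<^sup>2) * (cmod z)\<^sup>2" by (simp only: mult_ac)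
      also have "\<dots> = (cmod z)\<^sup>2" using s(2) by simp
      finally have "(cmod z)\<^sup>2 \<le> (K * (1 / 2) ^ n)\<^sup>2" .
      then have "cmod z \<le> K * (1 / 2) ^ n"
        by (rule power2_le_imp_le) (use K(1) in simp)
      then show ?thesis by (simp only: z_def)
    qed
    note le = this
    have "(\<lambda>n. K * (1 / 2) ^ n) \<longlonglongrightarrow> 0"
      by (intro tendsto_mult_right_zero LIMSEQ_realpow_zero) auto
    then have "(\<lambda>n. ip \<psi> (\<Phi> n) x0 - T \<psi>) \<longlonglongrightarrow> 0"
      by (rule Lim_null_comparison[OF always_eventually[OF allI[OF le]]])
    then show "(\<lambda>n. ip \<psi> (\<Phi> n) x0) \<longlonglongrightarrow> f (iota \<psi>) x0"
      unfolding T_def by (simp add: LIM_zero_iff)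
  qed
qed

text \<open>The minimising sequence is controlled only in the fibre over \<open>x0\<close>. To
  obtain an element of the completion, each increment is multiplied by a cutoff that equals 1 at
  \<open>x0\<close> and carries the bound on the increment to all fibres; the modified series then
  converges uniformly and has the same inner products at \<open>x0\<close>.\<close>

lemma pointwise_riesz:
  assumes f: "f \<in> carrier D"
  shows "\<exists>V\<in>carrier L. \<forall>U\<in>carrier L. f U x0 = minner L U V x0"
proof -
  obtain \<Phi> where \<Phi>: "\<And>n. cont (\<Phi> n)"
    "\<And>n. fnorm x0 (\<lambda>x. \<Phi> (Suc n) x - \<Phi> n x) \<le> 2 * (1 / 2) ^ n"
    "\<And>\<psi>. cont \<psi> \<Longrightarrow> (\<lambda>n. ip \<psi> (\<Phi> n) x0) \<longlonglongrightarrow> f (iota \<psi>) x0"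
    using riesz_minimising_sequence[OF f, of x0] by blast
  define \<Psi> where "\<Psi> n = (\<lambda>x. \<Phi> (Suc n) x - \<Phi> n x)" for n
  have \<Psi>: "cont (\<Psi> n)" for n unfolding \<Psi>_def by (intro continuous_intros \<Phi>)
  have "\<exists>b. b \<in> carrier A \<and> b x0 = 1 \<and> (\<forall>y. fnorm y (\<lambda>x. \<Psi> n x * b x) \<le> 2 * (1 / 2) ^ n)" for n
  proof -
    have small: "0 < 2 * (1 / 2 :: real) ^ n" "fnorm x0 (\<Psi> n) \<le> 2 * (1 / 2) ^ n"
      using \<Phi>(2)[of n] by (simp_all add: \<Psi>_def)
    show ?thesis
    proof (rule cutoff[OF \<Psi> small])
      fix b assume b: "b \<in> carrier A" "b x0 = 1"
        "\<And>y. fnorm y (\<lambda>x. \<Psi> n x * b x) \<le> 2 * (1 / 2) ^ n"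
      show ?thesis by (intro exI[of _ b] conjI allI b)
    qed
  qed
  then have "\<exists>b. \<forall>n. b n \<in> carrier A \<and> b n x0 = 1 \<and> (\<forall>y. fnorm y (\<lambda>x. \<Psi> n x * b n x) \<le> 2 * (1 / 2) ^ n)"
    by (intro choice allI)
  then obtain b where b_all: "\<forall>n. b n \<in> carrier A \<and> b n x0 = 1 \<and>
      (\<forall>y. fnorm y (\<lambda>x. \<Psi> n x * b n x) \<le> 2 * (1 / 2) ^ n)" by (rule exE)
  then have b: "\<And>n. b n \<in> carrier A" "\<And>n. b n x0 = 1"
    "\<And>n y. fnorm y (\<lambda>x. \<Psi> n x * b n x) \<le> 2 * (1 / 2) ^ n" by simp_all
  have cb: "cont (\<lambda>x. \<Psi> n x * b n x)" for n
    by (intro continuous_intros \<Psi> carrier_A_cont b(1))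
  define s where "s = (\<lambda>n x. \<Phi> 0 x + (\<Sum>i<n. \<Psi> i x * b i x))"
  have sc: "cont (s n)" for n unfolding s_def by (intro continuous_intros \<Phi> cb)
  have tail: "fnorm y (\<lambda>x. s m x - s k x) \<le> 4 * (1 / 2) ^ k" if "k \<le> m" for y m k
  proof -
    have "s m x - s k x = (\<Sum>i\<in>{k..<m}. \<Psi> i x * b i x)" for x
      using that sum_diff_nat_ivl[of 0 k m "\<lambda>i. \<Psi> i x * b i x"] by (simp add: s_def lessThan_atLeast0)
    then have "fnorm y (\<lambda>x. s m x - s k x) \<le> (\<Sum>i\<in>{k..<m}. fnorm y (\<lambda>x. \<Psi> i x * b i x))"
      using fnorm_sum[of "{k..<m}" "\<lambda>i x. \<Psi> i x * b i x" y] cb by simp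
    also have "\<dots> \<le> (\<Sum>i\<in>{k..<m}. 2 * (1 / 2) ^ i)" by (intro sum_mono b(3))
    also have "\<dots> = 4 * (1 / 2) ^ k - 4 * (1 / 2) ^ m"
      using that by (induction m rule: dec_induct) auto
    also have "\<dots> \<le> 4 * (1 / 2) ^ k" by simp
    finally show ?thesis .
  qed
  have s: "cauchy_fns s"
    unfolding cauchy_fns_def
  proof (intro conjI allI impI sc)
    fix e :: real assume "e > 0"
    then obtain M where M: "(1 / 2 :: real) ^ M < e / 4"
      using real_arch_pow_inv[of "e / 4" "1 / 2"] by auto
    have "fnorm y (\<lambda>x. s m x - s n x) \<le> e" if "m \<ge> M" "n \<ge> M" for m n y
    proof -
      have "4 * (1 / 2 :: real) ^ k \<le> e" if "k \<ge> M" for k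
      proof -
        have "(1 / 2 :: real) ^ k \<le> (1 / 2) ^ M" by (rule power_decreasing[OF that]) auto
        then show ?thesis using M by linarith
      qed
      then show ?thesis
        using tail[of n m y] tail[of m n y] that fnorm_minus[OF sc sc, of y m n]
        by (cases "n \<le> m") (fastforce intro: order_trans)+
    qed
    then show "\<exists>M. \<forall>m\<ge>M. \<forall>n\<ge>M. \<forall>y. fnorm y (\<lambda>x. s m x - s n x) \<le> e" by blast
  qed
  have ip_s: "ip \<psi> (s n) x0 = ip \<psi> (\<Phi> n) x0" if \<psi>: "cont \<psi>" for \<psi> n
  proof (induction n)
    case (Suc n)
    have "s (Suc n) = (\<lambda>x. s n x + \<Psi> n x * b n x)" by (simp add: s_def fun_eq_iff)
    then have "ip \<psi> (s (Suc n)) x0 = ip \<psi> (s n) x0 + ip \<psi> (\<Psi> n) x0"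
      using ip_add_right[OF \<psi> sc cb, of n n x0] ip_mult_right[OF b(1) \<psi> \<Psi>, of n n x0] by (simp add: b(2))
    then show ?case
      using Suc ip_diff_right[OF \<psi> \<Phi>(1) \<Phi>(1), of "Suc n" n x0] by (simp add: \<Psi>_def)
  qed (simp add: s_def)
  have V: "cls s \<in> carrier L" by (rule cls_carrier[OF s])
  have eq: "f (iota \<psi>) x0 = riesz (cls s) (iota \<psi>) x0" if \<psi>: "cont \<psi>" for \<psi>
  proof -
    have "(\<lambda>n. ip \<psi> (s n) x0) \<longlonglongrightarrow> minner L (iota \<psi>) (cls s) x0"
      using minner_L(2)[OF cauchy_fns_const[OF \<psi>] s] by (simp add: iota_def)
    then show ?thesis
      using LIMSEQ_unique \<Phi>(3)[OF \<psi>] unfolding ip_s[OF \<psi>] riesz_def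
      by (simp add: iota_carrier[OF \<psi>])
  qed
  have "f U x0 = minner L U (cls s) x0" if U: "U \<in> carrier L" for U
  proof -
    obtain t where t: "cauchy_fns t" "U = cls t" using U by (rule carrier_LE)
    have "f U x0 = riesz (cls s) U x0"
      using dual_limit[OF f t(1), of x0] dual_limit[OF riesz_dual[OF V] t(1), of x0] LIMSEQ_unique
      by (simp add: t(2) eq[OF cauchy_fns_cont[OF t(1)]])
    then show ?thesis using U by (simp add: riesz_def)
  qed
  then show ?thesis using V by blast
qed

lemma bidual_pointwise:
  assumes F: "F \<in> carrier DD"
  shows "\<exists>V\<in>carrier L. (\<forall>U\<in>carrier L. F (riesz U) x0 = minner L U V x0) \<and>
    (\<forall>f\<in>carrier D. F f x0 = cnj (f V x0))"
proof -
  let ?u = "\<lambda>V\<in>carrier L. F (riesz V)"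
  obtain V where V: "V \<in> carrier L" "\<And>U. U \<in> carrier L \<Longrightarrow> ?u U x0 = minner L U V x0"
    using pointwise_riesz[OF bidual_riesz_dual[OF F], of x0] by blast
  have "F f x0 = cnj (f V x0)" if f: "f \<in> carrier D" for f
  proof -
    obtain W where W: "W \<in> carrier L" "\<And>U. U \<in> carrier L \<Longrightarrow> f U x0 = minner L U W x0"
      using pointwise_riesz[OF f, of x0] by blast
    \<comment> \<open>The negative of the inner product functional, with \<open>cnj (-1)\<close> so
      that it has the form of the scalar action on the dual.\<close>
    let ?r = "\<lambda>U\<in>carrier L. \<lambda>x. cnj (-1) * riesz W U x"
    have r: "?r \<in> carrier D"
      using dual_mult[OF riesz_dual[OF W(1)] const_carrier_A, of "cnj (-1)"] .
    have "F (\<lambda>U\<in>carrier L. \<lambda>x. f U x + ?r U x) x0 = 0"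
    proof (rule bidual_local[OF F dual_add[OF f r]])
      fix \<phi> assume "cont \<phi>"
      then have "iota \<phi> \<in> carrier L" by (rule iota_carrier)
      then show "(\<lambda>U\<in>carrier L. \<lambda>x. f U x + ?r U x) (iota \<phi>) x0 = 0"
        using W(2) by (simp add: riesz_def)
    qed
    moreover have "F ?r = (\<lambda>x. -1 * F (riesz W) x)"
      by (rule bidualD(4)[OF F riesz_dual[OF W(1)]])
    ultimately have "F f x0 = F (riesz W) x0"
      unfolding bidualD(3)[OF F f r] by simp
    also have "\<dots> = minner L W V x0" using V(2)[OF W(1)] W(1) by simp
    also have "\<dots> = cnj (f V x0)" using W(2)[OF V(1)] minner_cnj[OF V(1) W(1), of x0] by simp
    finally show ?thesis .
  qed
  then show ?thesis using V by auto
qed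

end

section \<open>Reflexivity\<close>

context stable_action
begin

lemma bidual_evaluation:
  assumes F: "F \<in> carrier DD"
  shows "\<exists>U\<in>carrier L. \<forall>f\<in>carrier D. F f = (\<lambda>x. cnj (f U x))"
proof -
  define u where "u = (\<lambda>V\<in>carrier L. F (riesz V))"
  have u: "u \<in> carrier D" unfolding u_def by (rule bidual_riesz_dual[OF F])
  have "\<exists>s. cauchy_fns s \<and> (\<forall>U\<in>carrier L. u U x = minner L U (cls s) x) \<and>
      (\<forall>f\<in>carrier D. F f x = cnj (f (cls s) x))" for x
    using bidual_pointwise[OF F, of x] by (auto simp: carrier_L u_def)
  \<comment> \<open>The representatives are chosen independently for different points; only the
    behaviour of \<open>s x\<close> in the fibre over \<open>x\<close> carries meaning.\<close>
  then obtain s where s: "\<And>x. cauchy_fns (s x)"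
    and us: "\<And>x U. U \<in> carrier L \<Longrightarrow> u U x = minner L U (cls (s x)) x"
    and Fs: "\<And>x f. f \<in> carrier D \<Longrightarrow> F f x = cnj (f (cls (s x)) x)" by metis
  have sc: "cont (s x n)" for x n by (rule cauchy_fns_cont[OF s])
  have sL: "cls (s x) \<in> carrier L" for x by (rule cls_carrier[OF s])
  text \<open>The squared distance at \<open>x\<close> between \<open>\<phi>\<close> and the vector representing \<open>F\<close> there; it depends
    continuously on \<open>x\<close> because \<open>F u\<close> supplies the squared norm of that vector.\<close>
  define W where "W \<phi> x = (fnorm x \<phi>)\<^sup>2 - 2 * Re (u (iota \<phi>) x) + Re (F u x)" for \<phi> x
  have W_lim: "(\<lambda>n. (fnorm x (\<lambda>y. \<phi> y - s x n y))\<^sup>2) \<longlonglongrightarrow> W \<phi> x" if \<phi>: "cont \<phi>" for \<phi> x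
  proof -
    have 1: "(\<lambda>n. ip \<phi> (s x n) x) \<longlonglongrightarrow> u (iota \<phi>) x"
      using minner_L(2)[OF cauchy_fns_const[OF \<phi>] s, of x x] us[OF iota_carrier[OF \<phi>], of x]
      by (simp add: iota_def)
    have 2: "(\<lambda>n. ip (s x n) (s x n) x) \<longlonglongrightarrow> u (cls (s x)) x"
      using minner_L(2)[OF s s, of x x x] us[OF sL, of x x] by simp
    have "(\<lambda>n. (fnorm x \<phi>)\<^sup>2 - 2 * Re (ip \<phi> (s x n) x) + Re (ip (s x n) (s x n) x)) \<longlonglongrightarrow>
        (fnorm x \<phi>)\<^sup>2 - 2 * Re (u (iota \<phi>) x) + Re (u (cls (s x)) x)"
      by (intro tendsto_intros 1 2)
    then show ?thesis
      unfolding W_def Fs[OF u] fnorm_sub_sq[OF \<phi> sc] fnorm_sq[OF sc] by simp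
  qed
  have W_nonneg: "0 \<le> W \<phi> x" if "cont \<phi>" for \<phi> x
    by (rule LIMSEQ_le_const[OF W_lim[OF that]]) simp
  have W_sqrt: "(\<lambda>n. fnorm x (\<lambda>y. \<phi> y - s x n y)) \<longlonglongrightarrow> sqrt (W \<phi> x)" if \<phi>: "cont \<phi>" for \<phi> x
    using tendsto_real_sqrt[OF W_lim[OF \<phi>], of x] fnorm_nonneg[OF continuous_on_diff[OF \<phi> sc], of x x]
    by simp
  have W_A: "(\<lambda>x. complex_of_real (W \<phi> x)) \<in> carrier A" if \<phi>: "cont \<phi>" for \<phi>
  proof (rule carrier_AI)
    have A: "ip \<phi> \<phi> \<in> carrier A" "u (iota \<phi>) \<in> carrier A" "F u \<in> carrier A"
      by (intro ip_carrier \<phi> dualD(2)[OF u] iota_carrier bidualD(2)[OF F u])+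
    have eq: "W \<phi> x = Re (ip \<phi> \<phi> x) - 2 * Re (u (iota \<phi>) x) + Re (F u x)" for x
      by (simp add: W_def fnorm_sq[OF \<phi>])
    show "cont (\<lambda>x. complex_of_real (W \<phi> x))"
      unfolding eq using A[THEN carrier_A_cont] by (intro continuous_intros)
    show "complex_of_real (W \<phi> (\<alpha> g x)) = complex_of_real (W \<phi> x)" if "g \<in> carrier G" for g x
      unfolding eq using A[THEN carrier_A_inv, OF that] by simp
  qed
  have W_cont: "continuous_on UNIV (W \<phi>)" if "cont \<phi>" for \<phi>
    using continuous_on_Re[OF carrier_A_cont[OF W_A[OF that]]] by simp
  have W_inv: "W \<phi> (\<alpha> g x) = W \<phi> x" if "cont \<phi>" "g \<in> carrier G" for \<phi> g x
    using carrier_A_inv[OF W_A[OF that(1)] that(2), of x] by simp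
  \<comment> \<open>A late term of \<open>s x\<close> is already close to the vector it represents
    at \<open>x\<close>. The tolerance \<open>e / 4\<close> bounds a squared norm, hence the square
    root in the Cauchy estimate.\<close>
  have local: "\<exists>\<phi>. cont \<phi> \<and> W \<phi> x < e" if e: "e > 0" for e x
  proof -
    have "sqrt (e / 4) > 0" using e by simp
    then obtain M where M: "\<And>m n y. m \<ge> M \<Longrightarrow> n \<ge> M \<Longrightarrow> fnorm y (\<lambda>z. s x m z - s x n z) \<le> sqrt (e / 4)"
      using s[of x] unfolding cauchy_fns_def by meson
    have "(fnorm x (\<lambda>z. s x M z - s x n z))\<^sup>2 \<le> e / 4" if "n \<ge> M" for n
      using power_mono[OF M[of M n x] fnorm_nonneg[OF continuous_on_diff[OF sc sc]], of 2] that e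
      by simp
    then have "W (s x M) x \<le> e / 4"
      by (intro LIMSEQ_le_const2[OF W_lim[OF sc]]) blast
    then show ?thesis using sc e by (intro exI[of _ "s x M"]) auto
  qed
  have global: "\<exists>\<Phi>. cont \<Phi> \<and> (\<forall>x. sqrt (W \<Phi> x) \<le> sqrt e)" if e: "e > 0" for e
  proof -
    have "\<exists>\<phi>. \<forall>x. cont (\<phi> x) \<and> W (\<phi> x) x < e"
      using local[OF e] by (intro choice allI)
    then obtain \<phi> where \<phi>: "\<And>x. cont (\<phi> x)" "\<And>x. W (\<phi> x) x < e" by blast
    have op: "open {y. W (\<phi> x) y < e}" for x
      using open_Collect_less[OF W_cont[OF \<phi>(1)] continuous_on_const] .
    have cover: "UNIV \<subseteq> (\<Union>x\<in>UNIV. {y. W (\<phi> x) y < e})"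
    proof
      fix y show "y \<in> (\<Union>x\<in>UNIV. {y. W (\<phi> x) y < e})" using \<phi>(2)[of y] by blast
    qed
    obtain C where C: "finite C" "UNIV \<subseteq> (\<Union>x\<in>C. {y. W (\<phi> x) y < e})"
      by (rule compactE_image[OF compact_UNIV, of UNIV "\<lambda>x. {y. W (\<phi> x) y < e}"])
         (use op cover in auto)
    \<comment> \<open>An invariant bump supported where \<open>\<phi> x\<close> is a good
      approximation; the finite cover makes the sum of the bumps positive, so dividing by it gives
      the partition of unity.\<close>
    define b where "b x y = max 0 (e - W (\<phi> x) y)" for x y
    define B where "B y = (\<Sum>x\<in>C. b x y)" for y
    have b0: "0 \<le> b x y" for x y by (simp add: b_def)
    have B: "0 < B y" for y
    proof -
      obtain x where x: "x \<in> C" "W (\<phi> x) y < e" using C(2) by blast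
      then show ?thesis
        unfolding B_def using C(1) b0 by (intro sum_pos2[of C x]) (auto simp: b_def)
    qed
    have bc: "continuous_on UNIV (b x)" for x
      unfolding b_def by (intro continuous_intros W_cont[OF \<phi>(1)])
    have Bc: "continuous_on UNIV B"
      unfolding B_def by (intro continuous_intros bc)
    define c where "c x y = complex_of_real (b x y / B y)" for x y
    have cA: "c x \<in> carrier A" for x
    proof (rule carrier_AI)
      show "cont (c x)"
        unfolding c_def using B by (intro continuous_intros bc Bc) (auto simp: less_imp_neq[symmetric])
      show "c x (\<alpha> g y) = c x y" if "g \<in> carrier G" for g y
        using that by (simp add: c_def b_def B_def W_inv[OF \<phi>(1)])
    qed
    have c1: "(\<Sum>x\<in>C. c x y) = 1" for y
      using B[of y] by (simp add: c_def B_def flip: of_real_sum sum_divide_distrib)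
    have cn: "cmod (c x y) = b x y / B y" for x y
      using b0[of x y] B[of y] by (simp add: c_def norm_divide del: of_real_divide)
    define \<Phi> where "\<Phi> = (\<lambda>y. \<Sum>x\<in>C. \<phi> x y * c x y)"
    have \<Phi>: "cont \<Phi>"
      unfolding \<Phi>_def by (intro continuous_intros \<phi> carrier_A_cont cA)
    have "sqrt (W \<Phi> y) \<le> sqrt e" for y
    proof -
      \<comment> \<open>As the weights sum to 1, the error of the combination is the same
        combination of errors, and weights are nonzero only where the error is below the tolerance.
        The limit in \<open>n\<close> replaces \<open>s y n\<close> by the vector it
        approaches.\<close>
      have "fnorm y (\<lambda>z. \<Phi> z - s y n z) \<le> (\<Sum>x\<in>C. fnorm y (\<lambda>z. \<phi> x z - s y n z) * (b x y / B y))" for n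
      proof -
        have "\<Phi> z - s y n z = (\<Sum>x\<in>C. (\<phi> x z - s y n z) * c x z)" for z
          using c1[of z] by (simp add: \<Phi>_def left_diff_distrib sum_subtractf flip: sum_distrib_left)
        then have "fnorm y (\<lambda>z. \<Phi> z - s y n z) \<le> (\<Sum>x\<in>C. fnorm y (\<lambda>z. (\<phi> x z - s y n z) * c x z))"
          using fnorm_sum[OF C(1), of "\<lambda>x z. (\<phi> x z - s y n z) * c x z" y] \<phi>(1) sc carrier_A_cont[OF cA]
          by (simp add: continuous_intros)
        also have "\<dots> = (\<Sum>x\<in>C. fnorm y (\<lambda>z. \<phi> x z - s y n z) * (b x y / B y))"
          by (simp add: fnorm_mult[OF cA] continuous_intros \<phi>(1) sc cn)
        finally show ?thesis .
      qed
      moreover have "(\<lambda>n. \<Sum>x\<in>C. fnorm y (\<lambda>z. \<phi> x z - s y n z) * (b x y / B y)) \<longlonglongrightarrow>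
          (\<Sum>x\<in>C. sqrt (W (\<phi> x) y) * (b x y / B y))"
        by (intro tendsto_sum tendsto_mult W_sqrt \<phi>(1) tendsto_const)
      ultimately have "sqrt (W \<Phi> y) \<le> (\<Sum>x\<in>C. sqrt (W (\<phi> x) y) * (b x y / B y))"
        using LIMSEQ_le[OF W_sqrt[OF \<Phi>]] by blast
      also have "\<dots> \<le> (\<Sum>x\<in>C. sqrt e * (b x y / B y))"
      proof (rule sum_mono)
        fix x assume "x \<in> C"
        show "sqrt (W (\<phi> x) y) * (b x y / B y) \<le> sqrt e * (b x y / B y)"
        proof (cases "W (\<phi> x) y < e")
          case True
          then show ?thesis
            using b0[of x y] B[of y] by (intro mult_right_mono divide_nonneg_pos) auto
        qed (simp add: b_def)
      qed
      also have "\<dots> = sqrt e"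
        using B[of y] by (simp add: B_def flip: sum_distrib_left sum_divide_distrib)
      finally show ?thesis .
    qed
    then show ?thesis using \<Phi> by blast
  qed
  have "\<exists>\<Phi>. cont \<Phi> \<and> (\<forall>x. sqrt (W \<Phi> x) \<le> 1 / real (Suc n))" for n
    \<comment> \<open>\<open>W\<close> is a squared distance, so the tolerance is squared as
      well.\<close>
    using global[of "(1 / real (Suc n))\<^sup>2"] by (simp add: real_sqrt_abs)
  then have "\<exists>\<Phi>. \<forall>n. cont (\<Phi> n) \<and> (\<forall>x. sqrt (W (\<Phi> n) x) \<le> 1 / real (Suc n))"
    by (intro choice allI)
  then obtain \<Phi> where \<Phi>: "\<And>n. cont (\<Phi> n)" "\<And>n x. sqrt (W (\<Phi> n) x) \<le> 1 / real (Suc n)" by blast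
  have "fnorm x (\<lambda>y. \<Phi> m y - \<Phi> n y) \<le> 1 / real (Suc m) + 1 / real (Suc n)" for m n x
  proof -
    \<comment> \<open>The triangle inequality through the vector representing \<open>F\<close> at
      \<open>x\<close>, obtained as a limit through the terms \<open>s x k\<close>.\<close>
    have "fnorm x (\<lambda>y. \<Phi> m y - \<Phi> n y) \<le> sqrt (W (\<Phi> m) x) + sqrt (W (\<Phi> n) x)"
    proof (rule LIMSEQ_le_const[OF tendsto_add[OF W_sqrt[OF \<Phi>(1)] W_sqrt[OF \<Phi>(1)]]])
      have "fnorm x (\<lambda>y. \<Phi> m y - \<Phi> n y) \<le> fnorm x (\<lambda>y. \<Phi> m y - s x k y) + fnorm x (\<lambda>y. \<Phi> n y - s x k y)" for k
        using fnorm_triangle_diff[OF \<Phi>(1)[of m] sc[of x k] \<Phi>(1)[of n], of x]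
          fnorm_minus[OF sc[of x k] \<Phi>(1)[of n], of x] by simp
      then show "\<exists>M. \<forall>k\<ge>M. fnorm x (\<lambda>y. \<Phi> m y - \<Phi> n y)
          \<le> fnorm x (\<lambda>y. \<Phi> m y - s x k y) + fnorm x (\<lambda>y. \<Phi> n y - s x k y)" by blast
    qed
    then show ?thesis using add_mono[OF \<Phi>(2)[of m x] \<Phi>(2)[of n x]] by linarith
  qed
  note dist = this
  have cau: "cauchy_fns \<Phi>"
    unfolding cauchy_fns_def
  proof (intro conjI allI impI \<Phi>)
    fix e :: real assume "e > 0"
    then have "e / 2 > 0" by simp
    then obtain M where M: "1 / real (Suc M) < e / 2" using nat_approx_posE by blast
    have small: "1 / real (Suc m) \<le> e / 2" if "m \<ge> M" for m
    proof -
      have "1 / real (Suc m) \<le> 1 / real (Suc M)" using that by (intro divide_left_mono) auto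
      then show ?thesis using M by linarith
    qed
    have "fnorm x (\<lambda>y. \<Phi> m y - \<Phi> n y) \<le> e" if "m \<ge> M" "n \<ge> M" for m n x
      using dist[of x m n] small[OF that(1)] small[OF that(2)] by linarith
    then show "\<exists>M. \<forall>m\<ge>M. \<forall>n\<ge>M. \<forall>x. fnorm x (\<lambda>y. \<Phi> m y - \<Phi> n y) \<le> e" by blast
  qed
  have "F f = (\<lambda>x. cnj (f (cls \<Phi>) x))" if f: "f \<in> carrier D" for f
  proof
    fix x
    obtain C where C: "C \<ge> 0" "\<And>\<phi> x. cont \<phi> \<Longrightarrow> cmod (f (iota \<phi>) x) \<le> C * fnorm x \<phi>"
      using dual_fnorm_bound[OF f] by blast
    \<comment> \<open>The fibre bound for \<open>f\<close> turns the uniform approximation into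
      convergence of values; thus the single class of \<Phi> has the same \<open>f\<close>-value at
      \<open>x\<close> as the pointwise choice \<open>s x\<close>.\<close>
    have le: "cmod (f (iota (\<Phi> k)) x - f (cls (s x)) x) \<le> C * (1 / real (Suc k))" for k
    proof -
      have "cmod (f (iota (\<Phi> k)) x - f (cls (s x)) x) \<le> C * sqrt (W (\<Phi> k) x)"
      proof (rule LIMSEQ_le[OF tendsto_norm[OF tendsto_diff[OF tendsto_const dual_limit[OF f s]]]
            tendsto_mult[OF tendsto_const W_sqrt[OF \<Phi>(1)]]])
        have "cmod (f (iota (\<Phi> k)) x - f (iota (s x n)) x) \<le> C * fnorm x (\<lambda>y. \<Phi> k y - s x n y)" for n
          using C(2)[OF continuous_on_diff[OF \<Phi>(1)[of k] sc[of x n]], of x]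
          by (simp add: dual_iota_diff[OF f \<Phi>(1) sc])
        then show "\<exists>M. \<forall>n\<ge>M. cmod (f (iota (\<Phi> k)) x - f (iota (s x n)) x) \<le> C * fnorm x (\<lambda>y. \<Phi> k y - s x n y)"
          by blast
      qed
      also have "\<dots> \<le> C * (1 / real (Suc k))" by (intro mult_left_mono \<Phi> C)
      finally show ?thesis .
    qed
    have "(\<lambda>k. C * (1 / real (Suc k))) \<longlonglongrightarrow> 0"
      by (rule tendsto_mult_right_zero) (rule LIMSEQ_Suc[OF lim_1_over_n])
    then have "(\<lambda>k. f (iota (\<Phi> k)) x - f (cls (s x)) x) \<longlonglongrightarrow> 0"
      by (rule Lim_null_comparison[OF always_eventually[OF allI[OF le]]])
    then have "(\<lambda>k. f (iota (\<Phi> k)) x) \<longlonglongrightarrow> f (cls (s x)) x" by (simp add: LIM_zero_iff)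
    then have "f (cls \<Phi>) x = f (cls (s x)) x"
      using dual_limit[OF f cau, of x] LIMSEQ_unique by blast
    then show "F f x = cnj (f (cls \<Phi>) x)" using Fs[OF f, of x] by simp
  qed
  then show ?thesis using cls_carrier[OF cau] by blast
qed

text \<open>The inclusion that holds for every element; only boundedness takes work. The dual norm
  is a supremum over the unit ball, so \<open>U\<close> is rescaled to norm at most 1; for an
  element of norm 0 the bound of \<open>f\<close> gives the value 0 directly.\<close>

lemma evaluation_bidual:
  assumes U: "U \<in> carrier L"
  shows "bidual_map A N U \<in> carrier DD"
proof -
  let ?E = "\<lambda>f. \<lambda>x. cnj (f U x)"
  have eq: "bidual_map A N U = restrict ?E (carrier D)"
    by (simp add: bidual_map_def)
  define n where "n = hilbert_norm A L U"
  have n: "0 \<le> n" unfolding n_def by (rule hilbert_norm_L_nonneg[OF U])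
  have bound: "cmod (f U x) \<le> n * mnorm D f" if f: "f \<in> carrier D" for f x
  proof -
    obtain C where C: "C \<ge> 0" "\<And>U x. U \<in> carrier L \<Longrightarrow> cmod (f U x) \<le> C * hilbert_norm A L U"
      using dual_bound[OF f] by blast
    show ?thesis
    proof (cases "n = 0")
      case True
      then show ?thesis using C(2)[OF U, of x] by (simp add: n_def)
    next
      case False
      then have np: "0 < n" using n by simp
      obtain s where s: "cauchy_fns s" "U = cls s" using U by (rule carrier_LE)
      let ?V = "mscale L (complex_of_real (1 / n)) U"
      have V: "?V \<in> carrier L" by (rule mscale_carrier[OF U])
      have "minner L ?V ?V y = complex_of_real (1 / n) * cnj (complex_of_real (1 / n)) * minner L U U y" for y
        using minner_scale_left[OF U V] minner_scale_left[OF U U] minner_cnj[OF V U, of y] minner_cnj[OF U U, of y]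
        by simp
      then have "cmod (minner L ?V ?V y) = cmod (minner L U U y) / n\<^sup>2" for y
        using np by (simp add: norm_mult norm_divide power2_eq_square)
      moreover have "cmod (minner L U U y) \<le> n\<^sup>2" for y
        using cmod_minner_le[OF U U, of y] by (simp add: n_def power2_eq_square)
      ultimately have "cmod (minner L ?V ?V y) \<le> 1" for y using np by simp
      then have "hilbert_norm A L ?V \<le> 1"
        unfolding hilbert_norm_def by (simp add: anorm_le)
      then have "anorm A (f ?V) \<le> mnorm D f" by (rule anorm_le_mnorm_D[OF f V])
      then have "cmod (f ?V x) \<le> mnorm D f"
        using anorm_ge[OF carrier_A_cont[OF dualD(2)[OF f V]], of x] by linarith
      then show ?thesis
        using np by (simp add: dualD(4)[OF f U] norm_mult norm_divide divide_le_eq mult.commute)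
    qed
  qed
  have "\<forall>f\<in>carrier D. anorm A (?E f) \<le> n * mnorm D f"
    using bound by (intro ballI anorm_le) simp
  moreover have "(\<lambda>W\<in>carrier L. \<lambda>x. cnj c * f W x) \<in> carrier D" if "f \<in> carrier D" for f c
    by (rule dual_mult[OF that const_carrier_A])
  moreover have "(\<lambda>W\<in>carrier L. \<lambda>x. cnj (a x) * f W x) \<in> carrier D" if "f \<in> carrier D" "a \<in> carrier A" for f a
    by (rule dual_mult[OF that(1) A_cnj[OF that(2)]])
  moreover have "?E f \<in> carrier A" if "f \<in> carrier D" for f
    by (rule A_cnj[OF dualD(2)[OF that U]])
  ultimately show ?thesis
    unfolding eq using U
    by (auto simp: dual_module_def[of A D] dual_add fun_eq_iff)
qed

lemma L_module_reflexive: "cstar_reflexive A L"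
proof -
  have "bidual_map A N ` carrier N = carrier DD"
  proof (rule equalityI; rule subsetI)
    fix F assume "F \<in> bidual_map A N ` carrier N"
    then show "F \<in> carrier DD" using evaluation_bidual by auto
  next
    fix F assume F: "F \<in> carrier DD"
    then obtain U where U: "U \<in> carrier L" "\<And>f. f \<in> carrier D \<Longrightarrow> F f = (\<lambda>x. cnj (f U x))"
      using bidual_evaluation by blast
    have "F = bidual_map A N U"
      unfolding bidual_map_def
      by (rule extensionalityI[OF bidualD(1)[OF F] restrict_extensional]) (simp add: U(2))
    then show "F \<in> bidual_map A N ` carrier N" using U(1) by simp
  qed
  then show ?thesis by (simp add: cstar_reflexive_def)
qed

end

theorem corollary4p2:
  fixes G :: "('g, 'b) monoid_scheme" and \<alpha> :: "'g \<Rightarrow> 'x::metric_space \<Rightarrow> 'x"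
  assumes "compact (UNIV :: 'x set)"
    and "group_action G UNIV \<alpha>"
    and "\<forall>g\<in>carrier G. homeomorphism UNIV UNIV (\<alpha> g) (\<alpha> (inv\<^bsub>G\<^esub> g))"
    and "lyapunov_stable G \<alpha>"
  shows "cstar_reflexive (invariant_algebra G \<alpha>) (L_module G \<alpha>)"
proof -
  interpret stable_action G \<alpha>
    using assms(1,2,4) by (rule stable_action.intro)
  show ?thesis by (rule L_module_reflexive)
qed

end
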